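(* Let $\mathfrak{P}\subseteq\mathcal{P}_1(\mathbb{R})$ be uniformly integrable, i.e. $\lim_{K\to\infty}\sup_{\mu\in\mathfrak{P}}\int_{\{|x|\ge K\}}|x|\,\mu(dx)=0$. Then for every $\delta>0$ there exists a constant $K=K(\delta,\mathfrak{P})$ such that the following holds: for every coupling $\pi\in\Pi(\mu,\nu)$, where $\mu\preceq_c\nu$ and $\nu\in\mathfrak{P}$, we have $$\inf_{\tilde\pi\in\mathcal{M}(\mu,\nu)}W_1^{nd}(\pi,\tilde\pi)\le K\,\epsilon_\pi+\delta .$$
   Context: $\mathcal{P}(\mathbb{R}^d)$ denotes the Borel probability measures on $\mathbb{R}^d$ and $\mathcal{P}_p(\mathbb{R}^d)$ those with $\int|x|^p\,d\mu<\infty$. For $\mu,\nu\in\mathcal{P}_1(\mathbb{R})$, $\Pi(\mu,\nu)$ is the set of probability measures on $\mathbb{R}^2$ with first marginal $\mu$ and second marginal $\nu$. For $\pi\in\mathcal{P}(\mathbb{R}^2)$, $\pi^1$ is its first marginal and $(\pi_{x_1})_{x_1\in\mathbb{R}}$ a disintegration (regular conditional distribution) of $\pi$ with respect to $\pi^1$. The set of martingale couplings is $$\mathcal{M}(\mu,\nu)=\Big\{\pi\in\Pi(\mu,\nu): \int(x_2-x_1)\,\pi_{x_1}(dx_2)=0\ \ \mu\text{-a.s.}\Big\}.$$ Convex order: $\mu\preceq_c\nu$ iff $\int f\,d\mu\le\int f\,d\nu$ for all convex $f:\mathbb{R}\to\mathbb{R}$. For $\pi\in\Pi(\mu,\nu)$,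 $$\epsilon_\pi:=\int\Big|\int(x_2-x_1)\,\pi_{x_1}(dx_2)\Big|\,\mu(dx_1).$$ The nested $1$-Wasserstein distance is $$W_1^{nd}(\pi,\tilde\pi)=\inf_{\gamma^1\in\Pi(\pi^1,\tilde\pi^1)}\Big(\int|x_1-y_1|\,\gamma^1(dx_1,dy_1)+\int\inf_{\gamma^2\in\Pi(\pi_{x_1},\tilde\pi_{y_1})}\int|x_2-y_2|\,\gamma^2(dx_2,dy_2)\,\gamma^1(dx_1,dy_1)\Big).$$ *)

theory Defs
  imports "HOL-Probability.Probability"
begin

definition Prob :: "'a::topological_space measure set" where
  "Prob = {\<mu>. sets \<mu> = sets borel \<and> prob_space \<mu>}"

definition Prob_p :: "real \<Rightarrow> 'a::real_normed_vector measure set" where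
  "Prob_p p = {\<mu> \<in> Prob. (\<integral>\<^sup>+x. ennreal (norm x powr p) \<partial>\<mu>) < \<infinity>}"

definition unif_integrable :: "real measure set \<Rightarrow> bool" where
  "unif_integrable P \<longleftrightarrow>
     ((\<lambda>K::real. SUP \<mu>\<in>P. \<integral>\<^sup>+x\<in>{x. K \<le> \<bar>x\<bar>}. ennreal \<bar>x\<bar> \<partial>\<mu>) \<longlongrightarrow> 0) at_top"

(* The integral with values in [-\<infinity>, \<infinity>]. A convex f has an affine minorant, so its negative part
   is integrable whenever \<mu> has a finite first moment and no \<infinity> - \<infinity> arises below. *)
definition ext_integral :: "'a measure \<Rightarrow> ('a \<Rightarrow> real) \<Rightarrow> ereal" where
  "ext_integral \<mu> f =
     enn2ereal (\<integral>\<^sup>+x. ennreal (f x) \<partial>\<mu>) - enn2ereal (\<integral>\<^sup>+x. ennreal (- f x) \<partial>\<mu>)"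

definition convex_order :: "real measure \<Rightarrow> real measure \<Rightarrow> bool" (infix \<open>\<preceq>\<^sub>c\<close> 50) where
  "\<mu> \<preceq>\<^sub>c \<nu> \<longleftrightarrow> (\<forall>f::real \<Rightarrow> real. convex_on UNIV f \<longrightarrow> ext_integral \<mu> f \<le> ext_integral \<nu> f)"

definition marginal1 :: "(real \<times> real) measure \<Rightarrow> real measure" where
  "marginal1 \<pi> = distr \<pi> borel fst"

definition marginal2 :: "(real \<times> real) measure \<Rightarrow> real measure" where
  "marginal2 \<pi> = distr \<pi> borel snd"

definition couplings :: "real measure \<Rightarrow> real measure \<Rightarrow> (real \<times> real) measure set" where
  "couplings \<mu> \<nu> = {\<pi> \<in> Prob. marginal1 \<pi> = \<mu> \<and> marginal2 \<pi> = \<nu>}"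

definition is_disintegration :: "(real \<times> real) measure \<Rightarrow> (real \<Rightarrow> real measure) \<Rightarrow> bool" where
  "is_disintegration \<pi> \<kappa> \<longleftrightarrow>
     \<kappa> \<in> borel \<rightarrow>\<^sub>M prob_algebra borel \<and>
     (\<forall>C \<in> sets (borel :: (real \<times> real) measure).
        emeasure \<pi> C = (\<integral>\<^sup>+x. emeasure (\<kappa> x) {y. (x, y) \<in> C} \<partial>marginal1 \<pi>))"

(* Every probability measure on the plane has a disintegration, and it is unique up to null sets
   of the first marginal; none of the notions below depends on the version chosen here. *)
definition disint :: "(real \<times> real) measure \<Rightarrow> real \<Rightarrow> real measure" where
  "disint \<pi> = (SOME \<kappa>. is_disintegration \<pi> \<kappa>)"

(* For \<nu> with finite first moment the inner integrand is integrable for \<mu>-almost every x1, so the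
   convention that the integral of a non-integrable function is 0 plays no role. The same holds
   for martingale_defect. *)
definition martingale_couplings :: "real measure \<Rightarrow> real measure \<Rightarrow> (real \<times> real) measure set" where
  "martingale_couplings \<mu> \<nu> =
     {\<pi> \<in> couplings \<mu> \<nu>. AE x1 in \<mu>. (\<integral>x2. x2 - x1 \<partial>disint \<pi> x1) = 0}"

definition martingale_defect :: "(real \<times> real) measure \<Rightarrow> ennreal" where
  "martingale_defect \<pi> =
     (\<integral>\<^sup>+x1. ennreal \<bar>\<integral>x2. x2 - x1 \<partial>disint \<pi> x1\<bar> \<partial>marginal1 \<pi>)"

definition W1 :: "real measure \<Rightarrow> real measure \<Rightarrow> ennreal" where
  "W1 \<mu> \<nu> = (INF \<gamma>\<in>couplings \<mu> \<nu>. \<integral>\<^sup>+(x, y). ennreal \<bar>x - y\<bar> \<partial>\<gamma>)"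

definition W1_nested :: "(real \<times> real) measure \<Rightarrow> (real \<times> real) measure \<Rightarrow> ennreal" where
  "W1_nested \<pi> \<pi>' =
     (INF \<gamma>\<in>couplings (marginal1 \<pi>) (marginal1 \<pi>').
        (\<integral>\<^sup>+(x1, y1). ennreal \<bar>x1 - y1\<bar> \<partial>\<gamma>) +
        (\<integral>\<^sup>+(x1, y1). W1 (disint \<pi> x1) (disint \<pi>' y1) \<partial>\<gamma>))"

end

theory Submission
  imports Defs
begin

text \<open>
  Keep the first marginal fixed. A coupling is then a kernel, encoded by its distribution functions
  \<open>F (x, t)\<close>, and the nested distance of two couplings is at most the integral of the difference
  \<open>\<bar>F - G\<bar>\<close>. Write \<open>d\<close> for the drift, that is the barycentre of the kernel at \<open>x\<close> minus \<open>x\<close>.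
  Starting from \<open>F0\<close>, minimise a smoothed \<open>L\<^sup>1\<close> norm of \<open>d\<close> plus \<open>lam\<close> times the distance
  to \<open>F0\<close> on the window \<open>(-R, R)\<close>. If mass sent low from points with low drift could be exchanged
  against mass sent high from points with much higher drift, the functional would decrease; so at
  the minimum the targets of different drift levels (\<open>3 lam\<close> apart) are separated by cut points.
  At a cut point the convex order bounds the negative drift below a level by the distance of
  successive cut points times the mass between the levels. Since the distances sum to at most
  \<open>2 R\<close> and the masses to at most 1, the total drift of the minimiser is of order \<open>R lam\<^sup>2\<close>, while
  its distance to \<open>F0\<close> is at most the drift of \<open>F0\<close> divided by \<open>lam\<close>. Iterating with \<open>lam / 2 ^ j\<close>
  produces a martingale kernel at distance at most (drift of \<open>F0\<close>) \<open>/ lam + 800 R lam\<close> on the window, and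
  uniform integrability controls the rest.
\<close>

section \<open>Distribution functions and first moments\<close>

text \<open>The obstacle is that changing the kernel at one point upsets the second marginal, so
  every move is an exchange between points. Smoothing is what makes exchanges effective: the
  derivative of the absolute value is a sign and tells apart few classes of points, whereas the
  derivative of the Huber function runs through all of [-1, 1]. An exchange costs at most 2
  \<open>lam\<close> per unit of drift it transfers, hence levels 3 \<open>lam\<close> apart are
  separated, and [-1, 0] holds about 1 / (3 \<open>lam\<close>) of them. Between consecutive levels,
  distance times mass is at least of the order of the remaining drift; by AM-GM the number of levels
  times the square root of drift / \<open>R\<close> is bounded, which gives the order
  \<open>R\<close> \<open>lam\<close>^2. The iteration lives on the exponent 2: the drift left at
  parameter \<open>lam\<close> costs a distance of order (\<open>R\<close> \<open>lam\<close>^2) /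
  (\<open>lam\<close> / 2) at the next one, so the distances form a geometric series. The penalty is
  confined to a window to keep the cut points in a bounded interval; outside, two kernels with the
  same second marginal differ by at most twice its tail.\<close>

abbreviation plane :: "(real \<times> real) measure" where "plane \<equiv> borel \<Otimes>\<^sub>M borel"

definition step :: "real \<Rightarrow> real \<Rightarrow> real" where
  "step y t = (if y \<le> t then 1 else 0)"

lemma measurable_step [measurable]:
  "f \<in> borel_measurable M \<Longrightarrow> g \<in> borel_measurable M \<Longrightarrow> (\<lambda>x. step (f x) (g x)) \<in> borel_measurable M"
  unfolding step_def by measurable

lemma step_bounds [simp]: "0 \<le> step y t" "step y t \<le> 1"
  by (auto simp: step_def)

lemma AE_lborel_ex_between:
  assumes ae: "AE t in lborel. Q t" and "a < (b :: real)"
  obtains t where "a < t" "t < b" "Q t"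
proof -
  have "\<exists>t\<in>{a<..<b}. Q t"
  proof (rule ccontr)
    assume "\<not> ?thesis"
    with ae have "AE t in lborel. t \<notin> {a<..<b}" by (auto elim!: eventually_mono)
    then have "emeasure lborel {a<..<b} = 0" by (subst (asm) AE_iff_measurable[of "{a<..<b}"]) auto
    then show False using assms(2) by simp
  qed
  then show ?thesis using that by auto
qed

lemma emeasure_lborel_Ico_eq: "emeasure lborel {a..<b} = ennreal (max 0 (b - a))" for a b :: real
  by (cases "a \<le> b") auto

lemma step_diff: "step y t - step z t = indicat_real {y..<z} t - indicat_real {z..<y} t"
  by (auto simp: step_def indicator_def)

lemma integrable_step_diff [simp]: "integrable lborel (\<lambda>t. step y t - step z t)"
  unfolding step_diff by (intro Bochner_Integration.integrable_diff) (auto simp: integrable_indicator_iff emeasure_lborel_Ico_eq)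

lemma integral_step_diff: "(\<integral>t. step y t - step z t \<partial>lborel) = z - y"
  unfolding step_diff
  by (subst Bochner_Integration.integral_diff) (auto simp: integrable_indicator_iff emeasure_lborel_Ico_eq measure_def max_def)

lemma integral_abs_step_diff: "(\<integral>t. \<bar>step y t - step z t\<bar> \<partial>lborel) = \<bar>y - z\<bar>"
proof -
  have "\<bar>step y t - step z t\<bar> = indicat_real {y..<z} t + indicat_real {z..<y} t" for t
    by (auto simp: step_def indicator_def)
  then show ?thesis
    by (simp, subst Bochner_Integration.integral_add)
       (auto simp: integrable_indicator_iff emeasure_lborel_Ico_eq measure_def max_def)
qed

lemma integral_tail_step_diff:
  "(\<integral>t. indicator {c..} t * (step 0 t - step y t) \<partial>lborel) = max 0 (y - c) - max 0 (- c)"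
proof -
  have "indicator {c..} t * (step 0 t - step y t)
      = indicat_real {max c 0..<y} t - indicat_real {max c y..<0} t" for t
    by (auto simp: step_def indicator_def)
  then show ?thesis
    by (simp, subst Bochner_Integration.integral_diff)
       (auto simp: integrable_indicator_iff emeasure_lborel_Ico_eq measure_def max_def)
qed

context
  fixes M :: "real measure"
  assumes prob: "prob_space M" and sets [measurable_cong, simp]: "sets M = sets borel"
    and moment: "integrable M (\<lambda>x. x)"
begin

interpretation prob_space M by (rule prob)
interpretation pair_sigma_finite M lborel ..

text \<open>The section at \<open>x\<close> has L1 norm |x|, so a finite first moment suffices.
  Applying Fubini to this one function yields the mean and the call functions of the measure from
  its distribution function.\<close>

lemma integrable_step_pair: "integrable (M \<Otimes>\<^sub>M lborel) (\<lambda>(x, t). step x t - step 0 t)"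
proof (rule Fubini_integrable)
  show "integrable M (\<lambda>x. \<integral>t. norm (case (x, t) of (x, t) \<Rightarrow> step x t - step 0 t) \<partial>lborel)"
    using moment by (simp add: integral_abs_step_diff)
qed auto

lemma integral_step_eq_cdf: "(\<integral>x. step x t \<partial>M) = cdf M t"
proof -
  have "(\<integral>x. step x t \<partial>M) = (\<integral>x. indicator {..t} x \<partial>M)"
    by (intro Bochner_Integration.integral_cong) (auto simp: step_def indicator_def)
  then show ?thesis by (simp add: cdf_def)
qed

lemma integral_step_diff_eq_cdf: "(\<integral>x. step x t - step z t \<partial>M) = cdf M t - step z t"
proof -
  have "integrable M (\<lambda>x. step x t)"
    by (rule integrable_const_bound[of _ 1]) auto
  then show ?thesis
    by (subst Bochner_Integration.integral_diff) (simp_all add: integral_step_eq_cdf prob_space)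
qed

lemma integrable_cdf_diff: "integrable lborel (\<lambda>t. cdf M t - step 0 t)"
  using integrable_snd[OF integrable_step_pair] by (simp add: integral_step_diff_eq_cdf)

lemma integral_cdf_diff: "(\<integral>t. cdf M t - step 0 t \<partial>lborel) = - (\<integral>x. x \<partial>M)"
  using integral_snd[OF integrable_step_pair] integral_fst[OF integrable_step_pair]
  by (simp add: integral_step_diff_eq_cdf integral_step_diff)

text \<open>The tail integral of a distribution function is a call function. The term
  \<open>max 0 (- c)\<close> is the call function of the point mass at 0 and cancels when two
  measures are compared.\<close>

lemma integral_tail_cdf_diff:
  "(\<integral>t. indicator {c..} t * (step 0 t - cdf M t) \<partial>lborel) = (\<integral>x. max 0 (x - c) \<partial>M) - max 0 (- c)"
proof -
  have i: "integrable (M \<Otimes>\<^sub>M lborel) (\<lambda>(x, t). indicator {c..} t * (step 0 t - step x t))"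
    by (rule Bochner_Integration.integrable_bound[OF integrable_step_pair]) (auto intro!: AE_I2 simp: indicator_def)
  have a: "(\<integral>x. step 0 t - step x t \<partial>M) = step 0 t - cdf M t" for t
    using integral_step_diff_eq_cdf[of t 0] integral_minus[of M "\<lambda>x. step x t - step 0 t"] by (simp del: integral_minus)
  have "integrable M (\<lambda>x. max 0 (x - c))"
    using moment by auto
  then show ?thesis
    using integral_snd[OF i] integral_fst[OF i]
    by (simp add: a integral_tail_step_diff prob_space)
qed

end

section \<open>Kernels with prescribed second marginal\<close>

text \<open>Of the second measure only the distribution function \<open>N\<close> is kept.
  \<open>mean_eq\<close> and \<open>tail_le\<close> are the convex order tested on the linear
  functions x, -x and on max 0 (x - c): the integral of \<open>cdf \<mu> t - N t\<close> over levels
  above \<open>c\<close> is the difference of the two call functions at \<open>c\<close>.\<close>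

locale kernel_problem =
  fixes \<mu> :: "real measure" and N :: "real \<Rightarrow> real"
  assumes prob: "prob_space \<mu>" and sets_mu [measurable_cong, simp]: "sets \<mu> = sets borel"
    and moment: "integrable \<mu> (\<lambda>x. x)"
    and N_int: "integrable lborel (\<lambda>t. N t - step 0 t)"
    and mean_eq: "(\<integral>t. cdf \<mu> t - N t \<partial>lborel) = 0"
    and tail_le: "\<And>c. 0 \<le> (\<integral>t. indicator {c..} t * (cdf \<mu> t - N t) \<partial>lborel)"
begin

sublocale prob_space \<mu> by (rule prob)
sublocale pair_sigma_finite \<mu> lborel ..

abbreviation "P \<equiv> \<mu> \<Otimes>\<^sub>M (lborel :: real measure)"

lemma space_mu [simp]: "space \<mu> = UNIV"
  using sets_eq_imp_space_eq[OF sets_mu] by simp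

text \<open>The conditional distribution functions of a kernel whose second marginal has distribution
  function \<open>N\<close>. Right continuity and the limits at infinity are not imposed, so that the class is
  closed under almost everywhere limits.\<close>

definition adm :: "(real \<times> real \<Rightarrow> real) \<Rightarrow> bool" where
  "adm F \<longleftrightarrow> F \<in> borel_measurable plane \<and> (\<forall>x t. 0 \<le> F (x, t) \<and> F (x, t) \<le> 1) \<and>
     (\<forall>x s t. s \<le> t \<longrightarrow> F (x, s) \<le> F (x, t)) \<and> (AE t in lborel. (\<integral>x. F (x, t) \<partial>\<mu>) = N t)"

text \<open>\<open>E0\<close> is the identity kernel, sending \<open>x\<close> to the point mass at
  \<open>x\<close>; \<open>K0\<close> sends every \<open>x\<close> to the point mass at 0.
  Distribution functions are not integrable over the line, so integrals are formed for differences
  with one of these two.\<close>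

definition E0 :: "real \<times> real \<Rightarrow> real" where "E0 z = step (fst z) (snd z)"
definition K0 :: "real \<times> real \<Rightarrow> real" where "K0 z = step 0 (snd z)"

lemma E0_K0_eq [simp]: "E0 (x, t) = step x t" "K0 (x, t) = step 0 t"
  by (simp_all add: E0_def K0_def)

lemma measurable_E0 [measurable]: "E0 \<in> borel_measurable plane"
  and measurable_K0 [measurable]: "K0 \<in> borel_measurable plane"
  unfolding E0_def K0_def by measurable

lemma admD:
  assumes "adm F"
  shows adm_measurable [measurable (raw)]: "F \<in> borel_measurable plane"
    and adm_nonneg: "0 \<le> F z" and adm_le_1: "F z \<le> 1"
    and adm_mono: "s \<le> t \<Longrightarrow> F (x, s) \<le> F (x, t)"
    and adm_marginal: "AE t in lborel. (\<integral>x. F (x, t) \<partial>\<mu>) = N t"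
  using assms unfolding adm_def by (cases z; auto)+

lemma measurable_P [measurable_dest]: "F \<in> borel_measurable plane \<Longrightarrow> F \<in> borel_measurable P"
  by (simp cong: measurable_cong_sets)

lemma integrable_section:
  assumes "F \<in> borel_measurable borel" "\<And>x. 0 \<le> F x" "\<And>x. F x \<le> (1::real)"
  shows "integrable \<mu> F"
  using assms by (intro integrable_const_bound[of _ 1]) auto

lemma measurable_section [measurable (raw)]:
  assumes "F \<in> borel_measurable plane"
  shows "(\<lambda>x. F (x, t)) \<in> borel_measurable borel"
  using assms by measurable

lemma adm_integrable_section: "adm F \<Longrightarrow> integrable \<mu> (\<lambda>x. F (x, t))"
  by (intro integrable_section) (auto simp: adm_nonneg adm_le_1 intro: measurable_section admD)

text \<open>For fixed \<open>t\<close> the difference \<open>F - K0\<close> has the same sign for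
  all \<open>x\<close>, so its L1 norm in \<open>x\<close> is dictated by the marginal and is common
  to all admissible \<open>F\<close>. Integrability, the tail bounds and the compactness argument
  all rest on this.\<close>

lemma adm_abs_K0:
  assumes "adm F" shows "AE t in lborel. (\<integral>x. \<bar>F (x, t) - K0 (x, t)\<bar> \<partial>\<mu>) = \<bar>N t - step 0 t\<bar>"
  using adm_marginal[OF assms]
proof eventually_elim
  case (elim t)
  note i = adm_integrable_section[OF assms, of t]
  show ?case
  proof (cases "0 \<le> t")
    case True
    have "(\<integral>x. \<bar>F (x, t) - K0 (x, t)\<bar> \<partial>\<mu>) = (\<integral>x. 1 - F (x, t) \<partial>\<mu>)"
      using True by (intro Bochner_Integration.integral_cong) (auto simp: step_def adm_le_1[OF assms])
    also have "\<dots> = 1 - N t" using i elim prob_space by (subst Bochner_Integration.integral_diff) auto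
    finally have *: "(\<integral>x. \<bar>F (x, t) - K0 (x, t)\<bar> \<partial>\<mu>) = 1 - N t" .
    moreover have "0 \<le> (\<integral>x. \<bar>F (x, t) - K0 (x, t)\<bar> \<partial>\<mu>)" by simp
    ultimately show ?thesis using True by (simp add: step_def)
  next
    case False
    have "(\<integral>x. \<bar>F (x, t) - K0 (x, t)\<bar> \<partial>\<mu>) = (\<integral>x. F (x, t) \<partial>\<mu>)"
      using False by (intro Bochner_Integration.integral_cong) (auto simp: step_def adm_nonneg[OF assms])
    moreover have "0 \<le> (\<integral>x. \<bar>F (x, t) - K0 (x, t)\<bar> \<partial>\<mu>)" by simp
    ultimately show ?thesis using False elim by (simp add: step_def)
  qed
qed

lemma integrable_adm_K0:
  assumes F: "adm F" shows "integrable P (\<lambda>z. F z - K0 z)"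
proof -
  note [measurable] = adm_measurable[OF F]
  interpret Q: pair_sigma_finite lborel \<mu> ..
  have "integrable (lborel \<Otimes>\<^sub>M \<mu>) (\<lambda>(t, x). F (x, t) - K0 (x, t))"
  proof (rule Q.Fubini_integrable)
    have "integrable lborel (\<lambda>t. \<bar>N t - step 0 t\<bar>)" using N_int by simp
    moreover have "(\<lambda>t. \<integral>x. \<bar>F (x, t) - K0 (x, t)\<bar> \<partial>\<mu>) \<in> borel_measurable lborel"
      by measurable
    ultimately show "integrable lborel (\<lambda>t. \<integral>x. norm (case (t, x) of (t, x) \<Rightarrow> F (x, t) - K0 (x, t)) \<partial>\<mu>)"
      using adm_abs_K0[OF F] integrable_cong_AE[of "\<lambda>t. \<integral>x. \<bar>F (x, t) - K0 (x, t)\<bar> \<partial>\<mu>" lborel "\<lambda>t. \<bar>N t - step 0 t\<bar>"]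
      by auto
    show "AE t in lborel. integrable \<mu> (\<lambda>x. case (t, x) of (t, x) \<Rightarrow> F (x, t) - K0 (x, t))"
      using adm_integrable_section[OF F] by (auto simp del: E0_K0_eq simp: K0_def)
  qed auto
  then show ?thesis
    using integrable_product_swap_iff[of "\<lambda>z. F z - K0 z"] by simp
qed

lemma integral_adm_abs_K0_on:
  assumes F: "adm F" and A [measurable]: "A \<in> sets borel"
  shows "(\<integral>z. indicator A (snd z) * \<bar>F z - K0 z\<bar> \<partial>P) = (\<integral>t. indicator A t * \<bar>N t - step 0 t\<bar> \<partial>lborel)"
proof -
  note [measurable] = adm_measurable[OF F]
  have "integrable P (\<lambda>z. indicator A (snd z) * \<bar>F z - K0 z\<bar>)"
    using integrable_adm_K0[OF F]
    by (rule Bochner_Integration.integrable_bound) (auto simp: indicator_def intro!: AE_I2 simp del: E0_K0_eq)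
  then have i: "integrable P (\<lambda>(x, t). indicator A t * \<bar>F (x, t) - K0 (x, t)\<bar>)"
    by (simp add: split_beta' del: E0_K0_eq)
  have [measurable]: "(\<lambda>t. N t - step 0 t) \<in> borel_measurable borel" using N_int by simp
  have "(\<integral>z. indicator A (snd z) * \<bar>F z - K0 z\<bar> \<partial>P)
      = (\<integral>t. indicator A t * (\<integral>x. \<bar>F (x, t) - K0 (x, t)\<bar> \<partial>\<mu>) \<partial>lborel)"
    using integral_snd[OF i] by (simp add: split_beta' del: E0_K0_eq)
  also have "\<dots> = (\<integral>t. indicator A t * \<bar>N t - step 0 t\<bar> \<partial>lborel)"
    using adm_abs_K0[OF F] by (intro integral_cong_AE) (auto elim!: eventually_mono simp del: E0_K0_eq)
  finally show ?thesis .
qed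

lemma integral_adm_abs_K0:
  assumes "adm F" shows "(\<integral>z. \<bar>F z - K0 z\<bar> \<partial>P) = (\<integral>t. \<bar>N t - step 0 t\<bar> \<partial>lborel)"
  using integral_adm_abs_K0_on[OF assms, of UNIV] by simp

lemma integrable_E0_K0: "integrable P (\<lambda>z. E0 z - K0 z)"
  using integrable_step_pair[OF prob sets_mu moment] by (simp add: split_beta' E0_def K0_def)

lemma integrable_adm_diff: "adm F \<Longrightarrow> adm G \<Longrightarrow> integrable P (\<lambda>z. F z - G z)"
  using Bochner_Integration.integrable_diff[OF integrable_adm_K0[of F] integrable_adm_K0[of G]] by simp

lemma integrable_E0_adm: "adm F \<Longrightarrow> integrable P (\<lambda>z. E0 z - F z)"
  using Bochner_Integration.integrable_diff[OF integrable_E0_K0 integrable_adm_K0[of F]] by simp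

lemma adm_convex:
  assumes F: "adm F" and G: "adm G" and u: "0 \<le> u" "u \<le> 1"
  shows "adm (\<lambda>z. (1 - u) * F z + u * G z)"
proof -
  note [measurable] = adm_measurable[OF F] adm_measurable[OF G]
  have "AE t in lborel. (\<integral>x. (1 - u) * F (x, t) + u * G (x, t) \<partial>\<mu>) = N t"
    using adm_marginal[OF F] adm_marginal[OF G]
    by eventually_elim (simp add: adm_integrable_section[OF F] adm_integrable_section[OF G] algebra_simps)
  moreover have "(1 - u) * F z + u * G z \<le> 1" for z
    using convex_bound_le[of "F z" 1 "G z" "1 - u" u] adm_le_1[OF F] adm_le_1[OF G] u by auto
  ultimately show ?thesis
    unfolding adm_def using u
    by (auto intro!: add_nonneg_nonneg mult_nonneg_nonneg add_mono mult_left_mono adm_nonneg[OF F] adm_nonneg[OF G] adm_mono[OF F] adm_mono[OF G])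
qed

section \<open>The L1 distance over a set of levels\<close>

definition dist_on :: "real set \<Rightarrow> (real \<times> real \<Rightarrow> real) \<Rightarrow> (real \<times> real \<Rightarrow> real) \<Rightarrow> real" where
  "dist_on A F G = (\<integral>z. indicator A (snd z) * \<bar>F z - G z\<bar> \<partial>P)"

lemma integrable_indicator_snd:
  assumes "integrable P f" "A \<in> sets borel"
  shows "integrable P (\<lambda>z. indicator A (snd z) * f z :: real)"
  using assms by (intro Bochner_Integration.integrable_bound[OF assms(1)]) (auto simp: indicator_def)

lemma integrable_dist_on: "adm F \<Longrightarrow> adm G \<Longrightarrow> A \<in> sets borel \<Longrightarrow> integrable P (\<lambda>z. indicator A (snd z) * \<bar>F z - G z\<bar>)"
  by (intro integrable_indicator_snd integrable_abs integrable_adm_diff)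

lemma dist_on_nonneg [simp]: "0 \<le> dist_on A F G"
  unfolding dist_on_def by (intro integral_nonneg_AE) auto

lemma dist_on_self [simp]: "dist_on A F F = 0"
  unfolding dist_on_def by simp

lemma dist_on_triangle:
  assumes "adm F" "adm G" "adm H" "A \<in> sets borel"
  shows "dist_on A F H \<le> dist_on A F G + dist_on A G H"
proof -
  have "dist_on A F H \<le> (\<integral>z. indicator A (snd z) * \<bar>F z - G z\<bar> + indicator A (snd z) * \<bar>G z - H z\<bar> \<partial>P)"
    unfolding dist_on_def using assms
    by (intro integral_mono Bochner_Integration.integrable_add integrable_dist_on) (auto simp: indicator_def)
  also have "\<dots> = dist_on A F G + dist_on A G H"
    unfolding dist_on_def using assms by (intro Bochner_Integration.integral_add integrable_dist_on)
  finally show ?thesis .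
qed

lemma dist_on_sym: "dist_on A F G = dist_on A G F"
  unfolding dist_on_def by (simp add: abs_minus_commute)

lemma dist_on_le_UNIV:
  assumes "adm F" "adm G" "A \<in> sets borel" shows "dist_on A F G \<le> dist_on UNIV F G"
  unfolding dist_on_def using assms
  by (intro integral_mono integrable_dist_on) (auto simp: indicator_def)

text \<open>Compare both functions with \<open>K0\<close>: the distance of an admissible function to
  \<open>K0\<close> over the levels in \<open>A\<close> is fixed by the marginal.\<close>

lemma dist_on_le_tail:
  assumes "adm F" "adm G" "A \<in> sets borel"
  shows "dist_on A F G \<le> 2 * (\<integral>t. indicator A t * \<bar>N t - step 0 t\<bar> \<partial>lborel)"
proof -
  have i: "integrable P (\<lambda>z. indicator A (snd z) * \<bar>H z - K0 z\<bar>)" if "adm H" for H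
    using assms(3) integrable_adm_K0[OF that] by (intro integrable_indicator_snd integrable_abs)
  have "dist_on A F G \<le> (\<integral>z. indicator A (snd z) * \<bar>F z - K0 z\<bar> + indicator A (snd z) * \<bar>G z - K0 z\<bar> \<partial>P)"
    unfolding dist_on_def
    by (intro integral_mono[OF integrable_dist_on[OF assms] Bochner_Integration.integrable_add[OF i i]] assms)
       (auto simp: indicator_def)
  also have "\<dots> = 2 * (\<integral>t. indicator A t * \<bar>N t - step 0 t\<bar> \<partial>lborel)"
    using i assms by (simp add: integral_adm_abs_K0_on)
  finally show ?thesis .
qed

lemma dist_on_convex:
  assumes F: "adm F" and G: "adm G" and H: "adm H" and u: "0 \<le> u" "u \<le> 1" and A: "A \<in> sets borel"
  shows "dist_on A H (\<lambda>z. (1 - u) * F z + u * G z) \<le> (1 - u) * dist_on A H F + u * dist_on A H G"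
proof -
  have *: "\<bar>H z - ((1 - u) * F z + u * G z)\<bar> \<le> (1 - u) * \<bar>H z - F z\<bar> + u * \<bar>H z - G z\<bar>" for z
  proof -
    have "H z - ((1 - u) * F z + u * G z) = (1 - u) * (H z - F z) + u * (H z - G z)"
      by (simp add: algebra_simps)
    then show ?thesis
      using abs_triangle_ineq[of "(1 - u) * (H z - F z)" "u * (H z - G z)"] u by (simp add: abs_mult)
  qed
  have "dist_on A H (\<lambda>z. (1 - u) * F z + u * G z)
      \<le> (\<integral>z. (1 - u) * (indicator A (snd z) * \<bar>H z - F z\<bar>) + u * (indicator A (snd z) * \<bar>H z - G z\<bar>) \<partial>P)"
    unfolding dist_on_def using assms
    by (intro integral_mono Bochner_Integration.integrable_add integrable_mult_right integrable_dist_on adm_convex)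
       (auto simp: indicator_def *)
  also have "\<dots> = (1 - u) * dist_on A H F + u * dist_on A H G"
    unfolding dist_on_def using assms
    by (subst Bochner_Integration.integral_add) (auto intro!: integrable_mult_right integrable_dist_on)
  finally show ?thesis .
qed

text \<open>The barycentre of the kernel at \<open>x\<close>, minus \<open>x\<close>.\<close>

definition drift :: "(real \<times> real \<Rightarrow> real) \<Rightarrow> real \<Rightarrow> real" where
  "drift F x = (\<integral>t. E0 (x, t) - F (x, t) \<partial>lborel)"

lemma measurable_drift [measurable (raw)]: "adm F \<Longrightarrow> drift F \<in> borel_measurable borel"
  unfolding drift_def
  by (intro sigma_finite_measure.borel_measurable_lebesgue_integral sigma_finite_lborel)
     (auto simp: split_beta' intro!: borel_measurable_diff adm_measurable[THEN measurable_P] simp del: E0_K0_eq)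

lemma integrable_drift: "adm F \<Longrightarrow> integrable \<mu> (drift F)"
  unfolding drift_def using integrable_fst'[OF integrable_E0_adm] by simp

lemma AE_drift_diff:
  assumes "adm F" "adm G"
  shows "AE x in \<mu>. drift G x - drift F x = (\<integral>t. F (x, t) - G (x, t) \<partial>lborel)"
  using AE_integrable_fst'[OF integrable_E0_adm[OF assms(1)]] AE_integrable_fst'[OF integrable_E0_adm[OF assms(2)]]
proof eventually_elim
  case (elim x)
  show ?case unfolding drift_def
    using Bochner_Integration.integral_diff[OF elim(2) elim(1)] by simp
qed

lemma integral_abs_drift_diff:
  assumes "adm F" "adm G"
  shows "(\<integral>x. \<bar>drift F x - drift G x\<bar> \<partial>\<mu>) \<le> dist_on UNIV F G"
proof -
  note [measurable] = adm_measurable[OF assms(1)] adm_measurable[OF assms(2)]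
  have i: "integrable P (\<lambda>z. \<bar>G z - F z\<bar>)" using integrable_adm_diff[OF assms(2,1)] by simp
  have "(\<integral>x. \<bar>drift F x - drift G x\<bar> \<partial>\<mu>) \<le> (\<integral>x. (\<integral>t. \<bar>G (x, t) - F (x, t)\<bar> \<partial>lborel) \<partial>\<mu>)"
  proof (rule integral_mono_AE)
    show "integrable \<mu> (\<lambda>x. \<bar>drift F x - drift G x\<bar>)" using assms integrable_drift by auto
    show "integrable \<mu> (\<lambda>x. \<integral>t. \<bar>G (x, t) - F (x, t)\<bar> \<partial>lborel)" using integrable_fst'[OF i] .
    show "AE x in \<mu>. \<bar>drift F x - drift G x\<bar> \<le> (\<integral>t. \<bar>G (x, t) - F (x, t)\<bar> \<partial>lborel)"
      using AE_drift_diff[OF assms(2,1)]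
      by eventually_elim (auto intro: integral_abs_bound)
  qed
  also have "\<dots> = (\<integral>z. \<bar>G z - F z\<bar> \<partial>P)" using integral_fst'[OF i] .
  finally show ?thesis by (simp add: dist_on_def abs_minus_commute)
qed

lemma AE_drift_convex:
  assumes "adm F" "adm G"
  shows "AE x in \<mu>. \<forall>u. drift (\<lambda>z. (1 - u) * F z + u * G z) x = (1 - u) * drift F x + u * drift G x"
  using AE_integrable_fst'[OF integrable_E0_adm[OF assms(1)]] AE_integrable_fst'[OF integrable_E0_adm[OF assms(2)]]
proof eventually_elim
  case (elim x)
  have "E0 (x, t) - ((1 - u) * F (x, t) + u * G (x, t))
     = (1 - u) * (E0 (x, t) - F (x, t)) + u * (E0 (x, t) - G (x, t))" for u t
    by (simp add: algebra_simps)
  then show ?case unfolding drift_def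
    using elim by (simp del: E0_K0_eq)
qed

lemma integral_drift:
  assumes "adm F" shows "(\<integral>x. drift F x \<partial>\<mu>) = 0"
proof -
  note [measurable] = adm_measurable[OF assms]
  have i: "integrable P (\<lambda>(x, t). E0 (x, t) - F (x, t))" using integrable_E0_adm[OF assms] by (simp add: split_beta' del: E0_K0_eq)
  have "(\<integral>x. drift F x \<partial>\<mu>) = (\<integral>t. (\<integral>x. E0 (x, t) - F (x, t) \<partial>\<mu>) \<partial>lborel)"
    unfolding drift_def using integral_fst[OF i] integral_snd[OF i] by simp
  also have "\<dots> = (\<integral>t. cdf \<mu> t - N t \<partial>lborel)"
  proof (intro integral_cong_AE)
    have "integrable lborel (\<lambda>t. (cdf \<mu> t - step 0 t) - (N t - step 0 t))"
      by (intro Bochner_Integration.integrable_diff N_int integrable_cdf_diff[OF prob sets_mu moment])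
    then show "(\<lambda>t. cdf \<mu> t - N t) \<in> borel_measurable lborel" by simp
    show "AE t in lborel. (\<integral>x. E0 (x, t) - F (x, t) \<partial>\<mu>) = cdf \<mu> t - N t"
      using adm_marginal[OF assms]
    proof eventually_elim
      case (elim t)
      have "integrable \<mu> (\<lambda>x. E0 (x, t))" by (intro integrable_section) auto
      then show ?case
        using elim adm_integrable_section[OF assms, of t] integral_step_eq_cdf[OF prob sets_mu moment]
        by simp
    qed
  qed auto
  finally show ?thesis using mean_eq by simp
qed

text \<open>The convex order in the form used at cut points: on average over \<mu>, the call
  functions of an admissible kernel dominate those of the identity kernel.\<close>

lemma tail_E0_adm:
  assumes "adm F" shows "0 \<le> (\<integral>z. indicator {c..} (snd z) * (E0 z - F z) \<partial>P)"
proof -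
  note [measurable] = adm_measurable[OF assms]
  have i: "integrable P (\<lambda>(x, t). indicator {c..} t * (E0 (x, t) - F (x, t)))"
    using integrable_indicator_snd[OF integrable_E0_adm[OF assms], of "{c..}"] by (simp add: split_beta' del: E0_K0_eq)
  have "(\<integral>z. indicator {c..} (snd z) * (E0 z - F z) \<partial>P) = (\<integral>t. (\<integral>x. indicator {c..} t * (E0 (x, t) - F (x, t)) \<partial>\<mu>) \<partial>lborel)"
    using integral_snd[OF i] by (simp add: split_beta' del: E0_K0_eq)
  also have "\<dots> = (\<integral>t. indicator {c..} t * (cdf \<mu> t - N t) \<partial>lborel)"
  proof (intro integral_cong_AE)
    have "integrable lborel (\<lambda>t. (cdf \<mu> t - step 0 t) - (N t - step 0 t))"
      by (intro Bochner_Integration.integrable_diff N_int integrable_cdf_diff[OF prob sets_mu moment])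
    then have [measurable]: "(\<lambda>t. cdf \<mu> t - N t) \<in> borel_measurable borel" by simp
    show "(\<lambda>t. indicator {c..} t * (cdf \<mu> t - N t)) \<in> borel_measurable lborel" by simp
    show "AE t in lborel. (\<integral>x. indicator {c..} t * (E0 (x, t) - F (x, t)) \<partial>\<mu>) = indicator {c..} t * (cdf \<mu> t - N t)"
      using adm_marginal[OF assms]
    proof eventually_elim
      case (elim t)
      have "integrable \<mu> (\<lambda>x. E0 (x, t))" by (intro integrable_section) auto
      then show ?case
        using elim adm_integrable_section[OF assms, of t] integral_step_eq_cdf[OF prob sets_mu moment]
        by simp
    qed
  qed auto
  finally show ?thesis using tail_le by simp
qed

section \<open>Existence of minimisers\<close>

text \<open>A probability measure with the null sets of \<open>P\<close>; on it the distribution functions are square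
  integrable, and Hilbert space arguments apply without discussing tails.\<close>

definition P' :: "(real \<times> real) measure" where
  "P' = density P (\<lambda>z. ennreal (std_normal_density (snd z)))"

lemma sets_P' [measurable_cong, simp]: "sets P' = sets plane"
  unfolding P'_def by (simp cong: sets_pair_measure_cong)

lemma space_P' [simp]: "space P' = UNIV"
  unfolding P'_def by (simp add: space_pair_measure)

lemma prob_space_P': "prob_space P'"
proof
  have "emeasure P' (space P') = (\<integral>\<^sup>+z. ennreal (std_normal_density (snd z)) * indicator (space P) z \<partial>P)"
    unfolding P'_def space_density by (intro emeasure_density sets.top) measurable
  also have "\<dots> = (\<integral>\<^sup>+z. ennreal (std_normal_density (snd z)) \<partial>P)"
    by (intro nn_integral_cong) simp
  also have "\<dots> = (\<integral>\<^sup>+x. (\<integral>\<^sup>+t. ennreal (std_normal_density t) \<partial>lborel) \<partial>\<mu>)"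
    by (subst lborel.nn_integral_fst[symmetric]) auto
  also have "(\<integral>\<^sup>+t. ennreal (std_normal_density t) \<partial>lborel) = 1"
    by (subst nn_integral_eq_integral) (auto simp: integral_normal_density)
  finally show "emeasure P' (space P') = 1" using emeasure_space_1 by simp
qed

lemma AE_P': "(AE z in P'. Q z) \<longleftrightarrow> (AE z in P. Q z)"
  unfolding P'_def
  by (subst AE_density) (auto simp: ennreal_zero_less_mult_iff normal_density_pos)

lemma AE_P_sections:
  assumes "AE z in P. Q z" "Measurable.pred plane Q"
  shows "AE t in lborel. AE x in \<mu>. Q (x, t)"
proof -
  have "{z \<in> space P. Q (fst z, snd z)} \<in> sets P"
    using assms(2) by (simp add: pred_def space_pair_measure cong: sets_pair_measure_cong)
  then show ?thesis
    using AE_commute[of "\<lambda>x t. Q (x, t)"] AE_pair[OF assms(1)] by simp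
qed

text \<open>Almost everywhere convergence already gives convergence in L1: all admissible functions
  have the same L1 distance from \<open>K0\<close>, so no mass escapes and Scheffe's lemma
  applies.\<close>

lemma adm_limit:
  assumes adm: "\<And>n. adm (Fs n)" and cauchy: "AE z in P. Cauchy (\<lambda>n. Fs n z)"
  obtains F where "adm F" "(\<lambda>n. dist_on UNIV (Fs n) F) \<longlonglongrightarrow> 0"
proof -
  note [measurable] = adm_measurable[OF adm]
  \<comment> \<open>The upper limit is defined, bounded and monotone in \<open>t\<close> at every
    point, as \<open>adm\<close> demands; a limit chosen almost everywhere would not be.\<close>
  define L where "L z = limsup (\<lambda>n. ereal (Fs n z))" for z
  define F where "F z = real_of_ereal (L z)" for z
  have L_bounds: "0 \<le> L z" "L z \<le> 1" for z
    unfolding L_def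
    by (auto intro!: le_Limsup Limsup_bounded always_eventually simp: adm_nonneg[OF adm] adm_le_1[OF adm] one_ereal_def zero_ereal_def)
  have L_eq: "L z = ereal (F z)" for z
    using L_bounds[of z] by (cases "L z") (auto simp: F_def)
  have F_meas [measurable]: "F \<in> borel_measurable plane"
    unfolding F_def L_def by measurable
  have lim: "AE z in P. (\<lambda>n. Fs n z) \<longlonglongrightarrow> F z"
    using cauchy
  proof eventually_elim
    case (elim z)
    then obtain l where l: "(\<lambda>n. Fs n z) \<longlonglongrightarrow> l"
      using Cauchy_convergent_iff convergent_def by blast
    then have "(\<lambda>n. ereal (Fs n z)) \<longlonglongrightarrow> ereal l" by simp
    then have "L z = ereal l"
      unfolding L_def using lim_imp_Limsup sequentially_bot by blast
    with l show ?case by (simp add: F_def)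
  qed
  \<comment> \<open>Convergence restated as a measurable predicate, so that the null set of the
    plane can be cut along lines of constant \<open>t\<close>.\<close>
  define Q where "Q z \<longleftrightarrow> liminf (\<lambda>n. ereal (Fs n z)) = limsup (\<lambda>n. ereal (Fs n z))" for z
  have [measurable]: "Measurable.pred plane Q"
    unfolding Q_def by measurable
  have "AE z in P. Q z" using lim
    by eventually_elim
       (simp add: Q_def lim_imp_Limsup[OF _ tendsto_ereal] lim_imp_Liminf[OF _ tendsto_ereal])
  then have "AE t in lborel. AE x in \<mu>. Q (x, t)" by (rule AE_P_sections) fact
  moreover have Q_lim: "(\<lambda>n. Fs n z) \<longlonglongrightarrow> F z" if "Q z" for z
  proof -
    have "(\<lambda>n. ereal (Fs n z)) \<longlonglongrightarrow> L z"
      using that unfolding Q_def L_def by (intro Liminf_eq_Limsup) auto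
    then show ?thesis by (simp add: L_eq)
  qed
  ultimately have sect: "AE t in lborel. AE x in \<mu>. (\<lambda>n. Fs n (x, t)) \<longlonglongrightarrow> F (x, t)"
    by (auto elim!: eventually_mono)
  have F_bounds: "0 \<le> F z" "F z \<le> 1" for z
    using L_bounds[of z] by (auto simp: L_eq)
  have "AE t in lborel. \<forall>n. (\<integral>x. Fs n (x, t) \<partial>\<mu>) = N t"
    unfolding AE_all_countable using adm_marginal[OF adm] by simp
  then have marg: "AE t in lborel. (\<integral>x. F (x, t) \<partial>\<mu>) = N t"
    using sect
  proof eventually_elim
    case (elim t)
    have "(\<lambda>n. \<integral>x. Fs n (x, t) \<partial>\<mu>) \<longlonglongrightarrow> (\<integral>x. F (x, t) \<partial>\<mu>)"
      by (rule integral_dominated_convergence[where w="\<lambda>_. 1"])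
         (use elim(2) adm_nonneg[OF adm] adm_le_1[OF adm] in auto)
    then show ?case using elim(1) LIMSEQ_unique tendsto_const by (metis (no_types, lifting) LIMSEQ_const_iff ext)
  qed
  have mono: "F (x, s) \<le> F (x, t)" if "s \<le> t" for x s t
  proof -
    have "L (x, s) \<le> L (x, t)"
      unfolding L_def using adm_mono[OF adm that] by (intro Limsup_mono) auto
    then show ?thesis by (simp add: L_eq)
  qed
  have F: "adm F"
    unfolding adm_def using F_bounds mono marg by auto
  have B: "(\<integral>\<^sup>+z. ennreal (norm (G z - K0 z)) \<partial>P) = ennreal (\<integral>t. \<bar>N t - step 0 t\<bar> \<partial>lborel)" if "adm G" for G
    using integrable_adm_K0[OF that] integral_adm_abs_K0[OF that]
    by (subst nn_integral_eq_integral) auto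
  have "(\<lambda>n. \<integral>\<^sup>+z. norm ((Fs n z - K0 z) - (F z - K0 z)) \<partial>P) \<longlonglongrightarrow> 0"
  proof (rule Scheffe_lemma1)
    show "AE z in P. (\<lambda>n. Fs n z - K0 z) \<longlonglongrightarrow> F z - K0 z"
      using lim by eventually_elim (intro tendsto_intros)
    show "limsup (\<lambda>n. \<integral>\<^sup>+z. norm (Fs n z - K0 z) \<partial>P) \<le> (\<integral>\<^sup>+z. norm (F z - K0 z) \<partial>P)"
      unfolding B[OF F] B[OF adm] by (simp add: Limsup_const)
  qed (intro integrable_adm_K0 adm F)+
  moreover have "(\<integral>\<^sup>+z. norm ((Fs n z - K0 z) - (F z - K0 z)) \<partial>P) = ennreal (dist_on UNIV (Fs n) F)" for n
    using integrable_adm_diff[OF adm F] unfolding dist_on_def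
    by (subst nn_integral_eq_integral) auto
  ultimately have "(\<lambda>n. ennreal (dist_on UNIV (Fs n) F)) \<longlonglongrightarrow> ennreal 0" by simp
  then have "(\<lambda>n. dist_on UNIV (Fs n) F) \<longlonglongrightarrow> 0"
    by (subst (asm) tendsto_ennreal_iff) auto
  with F that show ?thesis by blast
qed

abbreviation "mid F G \<equiv> (\<lambda>z::real \<times> real. (1 - 1/2) * F z + 1/2 * G z :: real)"

text \<open>Among near minimisers of \<open>\<Phi>\<close>, take almost minimisers of the \<open>L\<^sup>2\<close> norm; by the parallelogram
  law they form a Cauchy sequence.\<close>

theorem minimizer_exists:
  assumes ne: "C \<noteq> {}" and sub: "\<And>F. F \<in> C \<Longrightarrow> adm F"
    and mid: "\<And>F G. F \<in> C \<Longrightarrow> G \<in> C \<Longrightarrow> mid F G \<in> C"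
    and closed: "\<And>Fs F. (\<And>n. Fs n \<in> C) \<Longrightarrow> adm F \<Longrightarrow> (\<lambda>n. dist_on UNIV (Fs n) F) \<longlonglongrightarrow> 0 \<Longrightarrow> F \<in> C"
    and nonneg: "\<And>F. F \<in> C \<Longrightarrow> (0::real) \<le> \<Phi> F"
    and quasi: "\<And>F G. F \<in> C \<Longrightarrow> G \<in> C \<Longrightarrow> \<Phi> (mid F G) \<le> max (\<Phi> F) (\<Phi> G)"
    and cont: "\<And>Fs F. (\<And>n. Fs n \<in> C) \<Longrightarrow> F \<in> C \<Longrightarrow> (\<lambda>n. dist_on UNIV (Fs n) F) \<longlonglongrightarrow> 0
                 \<Longrightarrow> (\<lambda>n. \<Phi> (Fs n)) \<longlonglongrightarrow> \<Phi> F"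
  obtains F where "F \<in> C" "\<And>G. G \<in> C \<Longrightarrow> \<Phi> F \<le> \<Phi> G"
proof -
  interpret P': prob_space P' by (rule prob_space_P')
  define m where "m = Inf (\<Phi> ` C)"
  define D where "D n = {F \<in> C. \<Phi> F \<le> m + 1 / Suc n}" for n
  define Q where "Q F = (\<integral>z. (F z)\<^sup>2 \<partial>P')" for F :: "real \<times> real \<Rightarrow> real"
  define q where "q n = Inf (Q ` D n)" for n
  have bdd: "bdd_below (\<Phi> ` C)" using nonneg by (auto intro!: bdd_belowI[of _ 0])
  have m_le: "m \<le> \<Phi> F" if "F \<in> C" for F
    unfolding m_def using that bdd by (auto intro: cInf_lower)
  have D_ne: "D n \<noteq> {}" for n
  proof -
    have "Inf (\<Phi> ` C) < m + 1 / Suc n" by (simp add: m_def)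
    then show ?thesis
      using cInf_lessD[of "\<Phi> ` C"] ne by (force simp: D_def intro: less_imp_le)
  qed
  have int2: "integrable P' (\<lambda>z. F z * G z)" if "adm F" "adm G" for F G
    using that adm_measurable[OF that(1)] adm_measurable[OF that(2)]
    by (intro P'.integrable_const_bound[of _ 1])
       (auto simp: adm_nonneg abs_mult adm_le_1 intro!: mult_le_one)
  have Q_nonneg: "0 \<le> Q F" for F unfolding Q_def by simp
  have Q_le: "Q F \<le> 1" if "adm F" for F
  proof -
    have "Q F \<le> (\<integral>z. 1 \<partial>P')" unfolding Q_def
      using int2[OF that that] adm_nonneg[OF that] adm_le_1[OF that]
      by (intro integral_mono) (auto simp: power2_eq_square intro: mult_le_one)
    then show ?thesis using P'.prob_space by simp
  qed
  have bddQ: "bdd_below (Q ` A)" for A using Q_nonneg by (auto intro!: bdd_belowI[of _ 0])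
  have q_le: "q n \<le> Q F" if "F \<in> D n" for n F
    unfolding q_def using that bddQ by (auto intro: cInf_lower)
  have "\<exists>F \<in> D n. Q F < q n + 1 / Suc n" for n
    using cInf_lessD[of "Q ` D n" "q n + 1 / Suc n"] D_ne[of n] by (auto simp: q_def)
  then obtain Fs where Fs: "\<And>n. Fs n \<in> D n" "\<And>n. Q (Fs n) < q n + 1 / Suc n" by metis
  have FsC: "Fs n \<in> C" for n using Fs(1)[of n] by (simp add: D_def)
  have D_mono: "D j \<subseteq> D i" if "i \<le> j" for i j
  proof -
    have "1 / Suc j \<le> (1 / Suc i :: real)" using that by (simp add: field_simps)
    then show ?thesis by (auto simp: D_def)
  qed
  have q_mono: "q i \<le> q j" if "i \<le> j" for i j
    unfolding q_def using D_mono[OF that] D_ne[of j] bddQ by (intro cInf_superset_mono) auto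
  have q_le_1: "q n \<le> 1" for n
    using q_le[OF Fs(1)[of n]] Q_le[OF sub[OF FsC]] by (rule order_trans)
  have "convergent q"
    using incseq_convergent[of q 1] q_mono q_le_1 unfolding incseq_def convergent_def by metis
  then have q_cauchy: "Cauchy q" by (simp add: Cauchy_convergent_iff)
  have mid_D: "mid F G \<in> D i" if "F \<in> D i" "G \<in> D i" for F G i
    using that mid quasi[of F G] by (auto simp: D_def)
  have par: "(\<integral>z. (F z - G z)\<^sup>2 \<partial>P') = 2 * Q F + 2 * Q G - 4 * Q (mid F G)" if "adm F" "adm G" for F G
  proof -
    note i = int2[OF that(1) that(1)] int2[OF that(1) that(2)] int2[OF that(2) that(2)]
    have 1: "(F z - G z)\<^sup>2 = F z * F z - 2 * (F z * G z) + G z * G z" for z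
      by (simp add: power2_eq_square algebra_simps)
    have 2: "(mid F G z)\<^sup>2 = 1/4 * (F z * F z) + 1/2 * (F z * G z) + 1/4 * (G z * G z)" for z
      by (simp add: power2_eq_square field_simps)
    show ?thesis
      unfolding Q_def 1 2 using i by (simp add: power2_eq_square)
  qed
  \<comment> \<open>Both functions lie in \<open>D i\<close>, which is closed under midpoints by
    quasiconvexity, so the midpoint has norm at least \<open>q i\<close>. The parallelogram law
    leaves only the increment of the convergent sequence \<open>q\<close> and the
    tolerances.\<close>
  have est: "(\<integral>z. (Fs i z - Fs j z)\<^sup>2 \<partial>P') \<le> 2 * (q j - q i) + 4 / Suc i" if "i \<le> j" for i j
  proof -
    have "q i \<le> Q (mid (Fs i) (Fs j))"
      using Fs(1) D_mono[OF that] by (intro q_le mid_D) auto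
    moreover have "1 / Suc j \<le> (1 / Suc i :: real)" using that by (simp add: field_simps)
    moreover have "Q (Fs i) \<le> q i + 1 / Suc i" "Q (Fs j) \<le> q j + 1 / Suc j"
      using Fs(2)[of i] Fs(2)[of j] by auto
    ultimately have "2 * Q (Fs i) + 2 * Q (Fs j) - 4 * Q (mid (Fs i) (Fs j)) \<le> 2 * (q j - q i) + 4 * (1 / Suc i)"
      by argo
    then show ?thesis using par[OF sub[OF FsC] sub[OF FsC], of i j] by simp
  qed
  have int1: "integrable P' (Fs n)" for n
    using adm_measurable[OF sub[OF FsC[of n]]] sub[OF FsC[of n]]
    by (intro P'.integrable_const_bound[of _ 1]) (auto simp: adm_nonneg adm_le_1)
  have cauchy: "\<exists>M. \<forall>i\<ge>M. \<forall>j\<ge>M. (\<integral>z. norm (Fs i z - Fs j z) \<partial>P') < e" if "0 < e" for e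
  proof -
    define d where "d = e / 2"
    have d: "0 < d" using that by (simp add: d_def)
    obtain M1 where M1: "\<And>i j. i \<ge> M1 \<Longrightarrow> j \<ge> M1 \<Longrightarrow> \<bar>q i - q j\<bar> < d\<^sup>2 / 4"
      using q_cauchy d unfolding Cauchy_def dist_real_def by (metis zero_less_divide_iff zero_less_numeral zero_less_power)
    obtain M2 :: nat where M2: "inverse (Suc M2) < d\<^sup>2 / 8"
      using reals_Archimedean[of "d\<^sup>2 / 8"] d by auto
    have *: "(\<integral>z. norm (Fs i z - Fs j z) \<partial>P') < e" if ij: "i \<le> j" "max M1 M2 \<le> i" for i j
    proof -
      have "1 / Suc i \<le> inverse (real (Suc M2))" using ij by (simp add: field_simps)
      then have sq: "(\<integral>z. (Fs i z - Fs j z)\<^sup>2 \<partial>P') \<le> d\<^sup>2"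
      proof -
        have "q j - q i < d\<^sup>2 / 4" using M1[of i j] ij abs_ge_minus_self[of "q i - q j"] by linarith
        moreover have "4 / Suc i = 4 * (1 / real (Suc i))" by simp
        ultimately show ?thesis
          using est[OF ij(1)] M2 \<open>1 / Suc i \<le> inverse (real (Suc M2))\<close> by argo
      qed
      have ii: "integrable P' (\<lambda>z. (Fs i z - Fs j z)\<^sup>2)"
      proof -
        have "(Fs i z - Fs j z)\<^sup>2 = Fs i z * Fs i z - 2 * (Fs i z * Fs j z) + Fs j z * Fs j z" for z
          by (simp add: power2_eq_square algebra_simps)
        then show ?thesis using int2 sub FsC by simp
      qed
      \<comment> \<open>From L2 to L1 on a probability space, by |a| <= d / 2 + a^2 / (2 d).\<close>
      have "(\<integral>z. norm (Fs i z - Fs j z) \<partial>P') \<le> (\<integral>z. d / 2 + (Fs i z - Fs j z)\<^sup>2 / (2 * d) \<partial>P')"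
      proof (rule integral_mono)
        fix z
        have "0 \<le> (\<bar>Fs i z - Fs j z\<bar> - d)\<^sup>2" by simp
        then show "norm (Fs i z - Fs j z) \<le> d / 2 + (Fs i z - Fs j z)\<^sup>2 / (2 * d)"
          using d by (simp add: power2_eq_square field_simps)
      qed (use int1 ii in auto)
      also have "\<dots> = d / 2 + (\<integral>z. (Fs i z - Fs j z)\<^sup>2 \<partial>P') / (2 * d)"
        using ii P'.prob_space by simp
      also have "\<dots> \<le> d / 2 + d\<^sup>2 / (2 * d)"
        using sq d by (intro add_left_mono divide_right_mono) auto
      also have "\<dots> < e" using d by (simp add: d_def power2_eq_square field_simps)
      finally show ?thesis .
    qed
    have "(\<integral>z. norm (Fs i z - Fs j z) \<partial>P') < e" if "i \<ge> max M1 M2" "j \<ge> max M1 M2" for i j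
      using *[of i j] *[of j i] that by (cases "i \<le> j") (auto simp: abs_minus_commute)
    then show ?thesis by blast
  qed
  obtain r where r: "strict_mono r" "AE z in P'. Cauchy (\<lambda>n. Fs (r n) z)"
    using cauchy_L1_AE_cauchy_subseq[OF int1 cauchy] by auto
  obtain F where F: "adm F" "(\<lambda>n. dist_on UNIV (Fs (r n)) F) \<longlonglongrightarrow> 0"
    using adm_limit[of "\<lambda>n. Fs (r n)"] sub[OF FsC] r(2) unfolding AE_P' by blast
  have FC: "F \<in> C" using closed[OF FsC F] .
  have "(\<lambda>n. \<Phi> (Fs (r n))) \<longlonglongrightarrow> \<Phi> F" using cont[OF FsC FC F(2)] .
  moreover have "(\<lambda>n. m + 1 / Suc n) \<longlonglongrightarrow> m + 0"
    by (intro tendsto_intros LIMSEQ_Suc[OF lim_1_over_n])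
  moreover have "\<Phi> (Fs (r n)) \<le> m + 1 / Suc n" for n
    using Fs(1)[of "r n"] D_mono[OF strict_mono_imp_increasing[OF r(1), of n]] by (auto simp: D_def)
  ultimately have "\<Phi> F \<le> m"
    using LIMSEQ_le[of "\<lambda>n. \<Phi> (Fs (r n))" "\<Phi> F" "\<lambda>n. m + 1 / Suc n" m] by auto
  then show ?thesis using that[OF FC] m_le by force
qed

end

section \<open>The penalised problem\<close>

definition clip :: "real \<Rightarrow> real \<Rightarrow> real" where
  "clip \<theta> y = max (-1) (min 1 (y / \<theta>))"

text \<open>The Huber function, written as the Legendre transform of \<open>\<theta> p\<^sup>2 / 2\<close> on \<open>[-1, 1]\<close>;
  its derivative is \<open>clip \<theta>\<close>.\<close>

definition huber :: "real \<Rightarrow> real \<Rightarrow> real" where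
  "huber \<theta> y = clip \<theta> y * y - \<theta> * (clip \<theta> y)\<^sup>2 / 2"

lemma abs_clip_le: "\<bar>clip \<theta> y\<bar> \<le> 1"
  by (auto simp: clip_def)

lemma measurable_clip [measurable]: "clip \<theta> \<in> borel_measurable borel"
  unfolding clip_def by measurable

lemma measurable_huber [measurable]: "huber \<theta> \<in> borel_measurable borel"
  unfolding huber_def by measurable

lemma clip_tendsto: "(f \<longlongrightarrow> y) F \<Longrightarrow> ((\<lambda>n. clip \<theta> (f n)) \<longlongrightarrow> clip \<theta> y) F"
  unfolding clip_def divide_inverse by (intro tendsto_intros)

context
  fixes \<theta> :: real assumes \<theta>: "0 < \<theta>"
begin

lemma clip_cases:
  obtains "\<theta> \<le> y" "clip \<theta> y = 1" | "y \<le> - \<theta>" "clip \<theta> y = -1" | "y = \<theta> * clip \<theta> y"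
proof -
  consider "\<theta> \<le> y" | "y \<le> - \<theta>" | "- \<theta> < y" "y < \<theta>" by linarith
  then show ?thesis
  proof cases
    case 1 then show ?thesis using \<theta> that(1) by (simp add: clip_def)
  next
    case 2
    then have "y / \<theta> \<le> -1" using \<theta> by (simp add: field_simps)
    then show ?thesis using 2 that(2) by (simp add: clip_def)
  next
    case 3
    then have "-1 < y / \<theta>" "y / \<theta> < 1" using \<theta> by (simp_all add: field_simps)
    then show ?thesis using \<theta> that(3) by (simp add: clip_def)
  qed
qed

text \<open>\<open>clip \<theta> y\<close> maximises p y - \<theta> p^2 / 2 over p in [-1, 1]. With
  c = \<open>clip \<theta> y\<close>, the difference of the two values factors as (c - p) (y -
  \<theta> (c + p) / 2), and the factors never have opposite signs, whether y is beyond \<theta>,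
  beyond -\<theta>, or equal to \<theta> c.\<close>

lemma huber_ge:
  assumes "\<bar>p\<bar> \<le> 1" shows "p * y - \<theta> * p\<^sup>2 / 2 \<le> huber \<theta> y"
proof -
  have p: "-1 \<le> p" "p \<le> 1" using assms by auto
  let ?c = "clip \<theta> y"
  have "0 \<le> (?c - p) * (y - \<theta> * (?c + p) / 2)"
  proof (cases y rule: clip_cases)
    case 1
    have "\<theta> * (1 + p) / 2 \<le> \<theta>" using p \<theta> by (simp add: field_simps)
    with 1 p show ?thesis by (intro mult_nonneg_nonneg) auto
  next
    case 2
    have "- \<theta> \<le> \<theta> * (-1 + p) / 2" using mult_left_mono[of "-1" p \<theta>] p \<theta> by (simp add: field_simps)
    with 2 p show ?thesis by (intro mult_nonpos_nonpos) auto
  next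
    case 3
    have "(?c - p) * (\<theta> * ?c - \<theta> * (?c + p) / 2) = \<theta> / 2 * (?c - p)\<^sup>2"
      by (simp add: power2_eq_square field_simps)
    also have "\<dots> \<ge> 0" using \<theta> by simp
    finally show ?thesis using 3 by simp
  qed
  also have "\<dots> = huber \<theta> y - (p * y - \<theta> * p\<^sup>2 / 2)"
    by (simp add: huber_def power2_eq_square field_simps)
  finally show ?thesis by simp
qed

lemma huber_subgradient: "huber \<theta> z + clip \<theta> z * (y - z) \<le> huber \<theta> y"
  using huber_ge[OF abs_clip_le[of \<theta> z], of y] unfolding huber_def[of \<theta> z] by (simp add: algebra_simps)

lemma huber_nonneg: "0 \<le> huber \<theta> y"
  using huber_ge[of 0 y] by simp

lemma huber_le_abs: "huber \<theta> y \<le> \<bar>y\<bar>"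
proof -
  have "clip \<theta> y * y \<le> \<bar>clip \<theta> y\<bar> * \<bar>y\<bar>" by (metis abs_ge_self abs_mult)
  also have "\<dots> \<le> \<bar>y\<bar>" using abs_clip_le[of \<theta> y] by (simp add: mult_left_le_one_le)
  moreover have "0 \<le> \<theta> * (clip \<theta> y)\<^sup>2 / 2" using \<theta> by simp
  ultimately show ?thesis unfolding huber_def by linarith
qed

lemma huber_lipschitz: "\<bar>huber \<theta> y - huber \<theta> z\<bar> \<le> \<bar>y - z\<bar>"
proof -
  have *: "\<bar>clip \<theta> a * (y - z)\<bar> \<le> \<bar>y - z\<bar>" for a
    using abs_clip_le[of \<theta> a] by (simp add: abs_mult mult_left_le_one_le)
  have "huber \<theta> z + clip \<theta> z * (y - z) \<le> huber \<theta> y" "huber \<theta> y + clip \<theta> y * (z - y) \<le> huber \<theta> z"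
    by (rule huber_subgradient)+
  moreover have "clip \<theta> y * (z - y) = - (clip \<theta> y * (y - z))" by (simp add: algebra_simps)
  ultimately show ?thesis using *[of y] *[of z] by linarith
qed

lemma huber_midpoint: "huber \<theta> ((1 - 1/2) * y + 1/2 * z) \<le> 1/2 * huber \<theta> y + 1/2 * huber \<theta> z"
proof -
  let ?m = "(1 - 1/2) * y + 1/2 * z"
  have "clip \<theta> ?m * (y - ?m) + clip \<theta> ?m * (z - ?m) = 0"
    by (simp add: field_simps)
  then show ?thesis
    using huber_subgradient[of ?m y] huber_subgradient[of ?m z] by argo
qed

end

context kernel_problem
begin

definition smooth_defect :: "real \<Rightarrow> (real \<times> real \<Rightarrow> real) \<Rightarrow> real" where
  "smooth_defect \<theta> F = (\<integral>x. huber \<theta> (drift F x) \<partial>\<mu>)"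

definition defect :: "(real \<times> real \<Rightarrow> real) \<Rightarrow> real" where
  "defect F = (\<integral>x. \<bar>drift F x\<bar> \<partial>\<mu>)"

lemma integrable_huber_drift: "0 < \<theta> \<Longrightarrow> adm F \<Longrightarrow> integrable \<mu> (\<lambda>x. huber \<theta> (drift F x))"
  by (rule Bochner_Integration.integrable_bound[OF integrable_drift[of F]])
     (auto simp: abs_of_nonneg[OF huber_nonneg] intro!: huber_le_abs)

lemma smooth_defect_nonneg: "0 < \<theta> \<Longrightarrow> 0 \<le> smooth_defect \<theta> F"
  unfolding smooth_defect_def by (intro integral_nonneg_AE) (simp add: huber_nonneg)

lemma smooth_defect_le: "0 < \<theta> \<Longrightarrow> adm F \<Longrightarrow> smooth_defect \<theta> F \<le> defect F"
  unfolding smooth_defect_def defect_def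
  by (intro integral_mono integrable_huber_drift integrable_abs integrable_drift huber_le_abs)

text \<open>Kept general in \<open>f\<close> to serve both the Huber function and the absolute
  value; the drift itself is 1-Lipschitz from the L1 distance of kernels to L1 of \<mu>.\<close>

lemma drift_integral_lipschitz:
  fixes f :: "real \<Rightarrow> real"
  assumes lip: "\<And>y z. \<bar>f y - f z\<bar> \<le> \<bar>y - z\<bar>"
    and int: "\<And>F. adm F \<Longrightarrow> integrable \<mu> (\<lambda>x. f (drift F x))" and F: "adm F" and G: "adm G"
  shows "\<bar>(\<integral>x. f (drift F x) \<partial>\<mu>) - (\<integral>x. f (drift G x) \<partial>\<mu>)\<bar> \<le> dist_on UNIV F G"
proof -
  have "\<bar>(\<integral>x. f (drift F x) \<partial>\<mu>) - (\<integral>x. f (drift G x) \<partial>\<mu>)\<bar> = \<bar>\<integral>x. f (drift F x) - f (drift G x) \<partial>\<mu>\<bar>"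
    using int[OF F] int[OF G] by simp
  also have "\<dots> \<le> (\<integral>x. \<bar>f (drift F x) - f (drift G x)\<bar> \<partial>\<mu>)"
    by (rule integral_abs_bound)
  also have "\<dots> \<le> (\<integral>x. \<bar>drift F x - drift G x\<bar> \<partial>\<mu>)"
    by (intro integral_mono lip integrable_abs Bochner_Integration.integrable_diff int integrable_drift F G)
  also have "\<dots> \<le> dist_on UNIV F G" by (rule integral_abs_drift_diff[OF F G])
  finally show ?thesis .
qed

lemma smooth_defect_lipschitz:
  "0 < \<theta> \<Longrightarrow> adm F \<Longrightarrow> adm G \<Longrightarrow> \<bar>smooth_defect \<theta> F - smooth_defect \<theta> G\<bar> \<le> dist_on UNIV F G"
  unfolding smooth_defect_def by (intro drift_integral_lipschitz huber_lipschitz integrable_huber_drift)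

lemma defect_lipschitz: "adm F \<Longrightarrow> adm G \<Longrightarrow> \<bar>defect F - defect G\<bar> \<le> dist_on UNIV F G"
  unfolding defect_def by (intro drift_integral_lipschitz integrable_abs integrable_drift abs_triangle_ineq3)

lemma adm_mid: "adm F \<Longrightarrow> adm G \<Longrightarrow> adm (mid F G)"
  by (rule adm_convex) auto

lemma drift_integral_mid:
  fixes f :: "real \<Rightarrow> real"
  assumes mid: "\<And>y z. f ((1 - 1/2) * y + 1/2 * z) \<le> 1/2 * f y + 1/2 * f z"
    and int: "\<And>F. adm F \<Longrightarrow> integrable \<mu> (\<lambda>x. f (drift F x))" and F: "adm F" and G: "adm G"
  shows "(\<integral>x. f (drift (mid F G) x) \<partial>\<mu>) \<le> 1/2 * (\<integral>x. f (drift F x) \<partial>\<mu>) + 1/2 * (\<integral>x. f (drift G x) \<partial>\<mu>)"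
proof -
  have "(\<integral>x. f (drift (mid F G) x) \<partial>\<mu>) \<le> (\<integral>x. 1/2 * f (drift F x) + 1/2 * f (drift G x) \<partial>\<mu>)"
  proof (rule integral_mono_AE)
    show "AE x in \<mu>. f (drift (mid F G) x) \<le> 1/2 * f (drift F x) + 1/2 * f (drift G x)"
      using AE_drift_convex[OF F G]
    proof eventually_elim
      case (elim x)
      show ?case using mid unfolding elim[rule_format] .
    qed
  qed (intro Bochner_Integration.integrable_add integrable_mult_right int adm_mid F G)+
  also have "\<dots> = 1/2 * (\<integral>x. f (drift F x) \<partial>\<mu>) + 1/2 * (\<integral>x. f (drift G x) \<partial>\<mu>)"
    using int[OF F] int[OF G] by simp
  finally show ?thesis .
qed

lemma smooth_defect_mid:
  "0 < \<theta> \<Longrightarrow> adm F \<Longrightarrow> adm G \<Longrightarrow> smooth_defect \<theta> (mid F G) \<le> 1/2 * smooth_defect \<theta> F + 1/2 * smooth_defect \<theta> G"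
  unfolding smooth_defect_def by (intro drift_integral_mid huber_midpoint integrable_huber_drift)

lemma defect_mid: "adm F \<Longrightarrow> adm G \<Longrightarrow> defect (mid F G) \<le> 1/2 * defect F + 1/2 * defect G"
  unfolding defect_def
  by (intro drift_integral_mid integrable_abs integrable_drift) (auto simp: abs_if field_simps)

lemma dist_on_tendsto:
  assumes "\<And>n. adm (Fs n)" "adm F" "adm G" "A \<in> sets borel" and lim: "(\<lambda>n. dist_on UNIV (Fs n) F) \<longlonglongrightarrow> 0"
  shows "(\<lambda>n. dist_on A G (Fs n)) \<longlonglongrightarrow> dist_on A G F"
proof (rule LIM_zero_cancel, rule Lim_null_comparison[OF always_eventually lim], intro allI)
  fix n
  have "dist_on A F (Fs n) \<le> dist_on UNIV (Fs n) F"
    using dist_on_le_UNIV[OF assms(2,1,4), of n] by (simp add: dist_on_sym)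
  then show "norm (dist_on A G (Fs n) - dist_on A G F) \<le> dist_on UNIV (Fs n) F"
    using dist_on_triangle[OF assms(3) assms(2) assms(1) assms(4), of n]
      dist_on_triangle[OF assms(3) assms(1) assms(2) assms(4), of n]
    by (simp add: dist_on_sym[of A "Fs n" F])
qed

lemma functional_tendsto:
  assumes "\<And>F G. adm F \<Longrightarrow> adm G \<Longrightarrow> \<bar>\<Phi> F - \<Phi> G\<bar> \<le> dist_on UNIV F G"
    and "\<And>n. adm (Fs n)" "adm F" and lim: "(\<lambda>n. dist_on UNIV (Fs n) F) \<longlonglongrightarrow> 0"
  shows "(\<lambda>n. \<Phi> (Fs n) :: real) \<longlonglongrightarrow> \<Phi> F"
  by (rule LIM_zero_cancel, rule Lim_null_comparison[OF always_eventually lim]) (use assms in auto)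

lemma penalized_minimizer_exists:
  assumes "0 < \<theta>" "0 \<le> lam" and F0: "adm F0" and A: "A \<in> sets borel"
  obtains F where "adm F"
    "\<And>G. adm G \<Longrightarrow> smooth_defect \<theta> F + lam * dist_on A F0 F \<le> smooth_defect \<theta> G + lam * dist_on A F0 G"
proof (rule minimizer_exists[of "Collect adm" "\<lambda>F. smooth_defect \<theta> F + lam * dist_on A F0 F"])
  fix F G assume F: "F \<in> Collect adm" "G \<in> Collect adm"
  have "lam * dist_on A F0 (mid F G) \<le> lam * ((1 - 1/2) * dist_on A F0 F + 1/2 * dist_on A F0 G)"
    using F F0 A assms(2) by (intro mult_left_mono dist_on_convex) auto
  moreover have "smooth_defect \<theta> (mid F G) \<le> 1/2 * smooth_defect \<theta> F + 1/2 * smooth_defect \<theta> G"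
    using F assms(1) by (intro smooth_defect_mid) auto
  moreover have "lam * ((1 - 1/2) * dist_on A F0 F + 1/2 * dist_on A F0 G)
      = 1/2 * (lam * dist_on A F0 F) + 1/2 * (lam * dist_on A F0 G)"
    by (simp add: algebra_simps)
  moreover have "x + y \<le> max (a + c) (b + d)"
    if "y \<le> y'" "x \<le> 1/2 * a + 1/2 * b" "y' = 1/2 * c + 1/2 * d" for x y y' a b c d :: real
    using that by (auto simp: max_def)
  ultimately show "smooth_defect \<theta> (mid F G) + lam * dist_on A F0 (mid F G)
      \<le> max (smooth_defect \<theta> F + lam * dist_on A F0 F) (smooth_defect \<theta> G + lam * dist_on A F0 G)"
    by blast
next
  fix Fs F assume "\<And>n. Fs n \<in> Collect adm" "F \<in> Collect adm" "(\<lambda>n. dist_on UNIV (Fs n) F) \<longlonglongrightarrow> 0"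
  then show "(\<lambda>n. smooth_defect \<theta> (Fs n) + lam * dist_on A F0 (Fs n)) \<longlonglongrightarrow> smooth_defect \<theta> F + lam * dist_on A F0 F"
    using smooth_defect_lipschitz[OF assms(1)]
    by (intro tendsto_intros dist_on_tendsto[OF _ _ F0 A] functional_tendsto[of "smooth_defect \<theta>"]) auto
next
  fix F G assume "F \<in> Collect adm" "G \<in> Collect adm"
  then show "mid F G \<in> Collect adm" using adm_mid by blast
qed (use assms smooth_defect_nonneg that in auto)

text \<open>First-order condition along the segment from \<open>F\<close> to \<open>G\<close>. The
  penalty is not differentiable, but by the triangle inequality and convexity a step of length u
  raises the distance to \<open>F0\<close> by at most u times the distance of \<open>F\<close> and
  \<open>G\<close>.\<close>

lemma variational_inequality:
  assumes \<theta>: "0 < \<theta>" and lam: "0 \<le> lam" and F0: "adm F0" and A: "A \<in> sets borel" and F: "adm F" and G: "adm G"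
    and min: "\<And>G. adm G \<Longrightarrow> smooth_defect \<theta> F + lam * dist_on A F0 F \<le> smooth_defect \<theta> G + lam * dist_on A F0 G"
  shows "0 \<le> (\<integral>x. clip \<theta> (drift F x) * (drift G x - drift F x) \<partial>\<mu>) + lam * dist_on A F G"
proof -
  define e where "e x = drift G x - drift F x" for x
  have e_int [simp]: "integrable \<mu> e" unfolding e_def using integrable_drift F G by auto
  have [measurable]: "e \<in> borel_measurable borel" "drift F \<in> borel_measurable borel"
    unfolding e_def using F G by auto
  have clip_int: "integrable \<mu> (\<lambda>x. clip \<theta> (f x) * e x)" if [measurable]: "f \<in> borel_measurable borel" for f
    using abs_clip_le by (intro Bochner_Integration.integrable_bound[OF e_int]) (auto simp: abs_mult mult_left_le_one_le)
  have *: "0 \<le> (\<integral>x. clip \<theta> (drift F x + u * e x) * e x \<partial>\<mu>) + lam * dist_on A F G" if u: "0 < u" "u \<le> 1" for u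
  proof -
    let ?H = "\<lambda>z. (1 - u) * F z + u * G z"
    have H: "adm ?H" using u F G by (intro adm_convex) auto
    have "dist_on A F0 ?H \<le> dist_on A F0 F + dist_on A F ?H" by (intro dist_on_triangle F0 F H A)
    also have "dist_on A F ?H \<le> u * dist_on A F G"
      using dist_on_convex[OF F G F _ _ A, of u] u by simp
    finally have "lam * dist_on A F0 ?H \<le> lam * (dist_on A F0 F + u * dist_on A F G)"
      using lam by (intro mult_left_mono) auto
    \<comment> \<open>Convexity bounds an increment from above by the slope at the far end of the
      step, so the subgradient is taken at the perturbed drift. The slope at \<open>F\<close> itself
      appears in the limit u -> 0.\<close>
    moreover have "smooth_defect \<theta> ?H - smooth_defect \<theta> F \<le> u * (\<integral>x. clip \<theta> (drift F x + u * e x) * e x \<partial>\<mu>)"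
    proof -
      have "smooth_defect \<theta> ?H - smooth_defect \<theta> F = (\<integral>x. huber \<theta> (drift ?H x) - huber \<theta> (drift F x) \<partial>\<mu>)"
        unfolding smooth_defect_def using \<theta> F H by (simp add: integrable_huber_drift)
      also have "\<dots> \<le> (\<integral>x. u * (clip \<theta> (drift F x + u * e x) * e x) \<partial>\<mu>)"
      proof (rule integral_mono_AE)
        show "AE x in \<mu>. huber \<theta> (drift ?H x) - huber \<theta> (drift F x) \<le> u * (clip \<theta> (drift F x + u * e x) * e x)"
          using AE_drift_convex[OF F G]
        proof eventually_elim
          case (elim x)
          have d: "drift ?H x = drift F x + u * e x"
            unfolding elim[rule_format] by (simp add: e_def algebra_simps)
          have "drift F x - (drift F x + u * e x) = - (u * e x)" by simp
          then show ?case
            using huber_subgradient[OF \<theta>, of "drift F x + u * e x" "drift F x"] unfolding d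
            by (simp add: algebra_simps)
        qed
      qed (use \<theta> F H clip_int in \<open>auto intro!: integrable_huber_drift\<close>)
      finally show ?thesis by simp
    qed
    moreover note min[OF H]
    ultimately have "0 \<le> u * ((\<integral>x. clip \<theta> (drift F x + u * e x) * e x \<partial>\<mu>) + lam * dist_on A F G)"
      by (simp add: algebra_simps)
    then show ?thesis using u by (simp add: zero_le_mult_iff)
  qed
  have lim: "(\<lambda>n. \<integral>x. clip \<theta> (drift F x + 1 / Suc n * e x) * e x \<partial>\<mu>) \<longlonglongrightarrow> (\<integral>x. clip \<theta> (drift F x) * e x \<partial>\<mu>)"
  proof (rule integral_dominated_convergence[where w="\<lambda>x. \<bar>e x\<bar>"])
    show "AE x in \<mu>. (\<lambda>n. clip \<theta> (drift F x + 1 / Suc n * e x) * e x) \<longlonglongrightarrow> clip \<theta> (drift F x) * e x"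
    proof (intro AE_I2 tendsto_mult tendsto_const clip_tendsto)
      fix x
      have "(\<lambda>n. drift F x + 1 / Suc n * e x) \<longlonglongrightarrow> drift F x + 0 * e x"
        by (intro tendsto_intros LIMSEQ_Suc[OF lim_1_over_n])
      then show "(\<lambda>n. drift F x + 1 / Suc n * e x) \<longlonglongrightarrow> drift F x" by simp
    qed
  qed (use abs_clip_le in \<open>auto simp: abs_mult mult_left_le_one_le\<close>)
  have "0 \<le> (\<integral>x. clip \<theta> (drift F x) * e x \<partial>\<mu>) + lam * dist_on A F G"
    by (rule LIMSEQ_le_const[OF tendsto_add[OF lim tendsto_const]], intro exI allI impI, rule *) auto
  then show ?thesis by (simp add: e_def)
qed

end

section \<open>Swapping mass\<close>

text \<open>Here \<open>f\<close> is a conditional distribution function and \<open>h s\<close> the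
  mass above level \<open>s\<close>. Up to \<open>t\<close> the expression is \<open>f s\<close>
  times the constant \<open>1 - h t\<close>; beyond \<open>t\<close> it is
  \<open>f s - f t * h s\<close>, in which both terms move upwards. The two pieces agree at
  \<open>t\<close>.\<close>

lemma swap_lower_mono:
  fixes f :: "real \<Rightarrow> real"
  assumes "\<And>r s. r \<le> s \<Longrightarrow> f r \<le> f s" "\<And>r s. r \<le> s \<Longrightarrow> h s \<le> h r" "\<And>s. 0 \<le> f s" "\<And>s. 0 \<le> h s" "\<And>s. h s \<le> 1" "s \<le> s'"
  shows "f s - f (min s t) * h (max s t) \<le> f s' - f (min s' t) * (h (max s' t) :: real)"
proof -
  consider "s' \<le> t" | "s \<le> t" "t \<le> s'" | "t \<le> s" by linarith
  then show ?thesis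
  proof cases
    case 1
    have "f s * (1 - h t) \<le> f s' * (1 - h t)" using assms by (intro mult_right_mono) auto
    then show ?thesis using 1 assms(6) by (simp add: min_def max_def algebra_simps)
  next
    case 2
    have "f s * (1 - h t) \<le> f t * (1 - h t)" using assms 2 by (intro mult_right_mono) auto
    moreover have "f t * h s' \<le> f t * h t" using assms 2 by (intro mult_left_mono) auto
    moreover have "f t \<le> f s'" using assms 2 by auto
    ultimately show ?thesis using 2 assms(6) by (simp add: min_def max_def algebra_simps)
  next
    case 3
    then have eqs: "min s t = t" "max s t = s" "min s' t = t" "max s' t = s'" using assms(6) by auto
    have "f t * h s' \<le> f t * h s" using assms 3 by (intro mult_left_mono) auto
    moreover have "f s \<le> f s'" using assms by auto
    ultimately show ?thesis using eqs by simp
  qed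
qed

text \<open>The mirror image, with \<open>a s\<close> the mass below level \<open>s\<close>: beyond
  \<open>t\<close> the expression equals \<open>a t + f s * (1 - a t)\<close>.\<close>

lemma swap_upper_mono:
  fixes f :: "real \<Rightarrow> real"
  assumes "\<And>r s. r \<le> s \<Longrightarrow> f r \<le> f s" "\<And>r s. r \<le> s \<Longrightarrow> a r \<le> a s" "\<And>s. f s \<le> 1" "\<And>s. 0 \<le> a s" "\<And>s. a s \<le> 1" "s \<le> s'"
  shows "f s + (1 - f (max s t)) * a (min s t) \<le> f s' + (1 - f (max s' t)) * (a (min s' t) :: real)"
proof -
  consider "s' \<le> t" | "s \<le> t" "t \<le> s'" | "t \<le> s" by linarith
  then show ?thesis
  proof cases
    case 1
    have "(1 - f t) * a s \<le> (1 - f t) * a s'" using assms by (intro mult_left_mono) auto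
    moreover have "f s \<le> f s'" using assms by auto
    ultimately show ?thesis using 1 assms(6) by (simp add: min_def max_def)
  next
    case 2
    have "(1 - f t) * a s \<le> (1 - f t) * a t" using assms 2 by (intro mult_left_mono) auto
    moreover have "f t * (1 - a t) \<le> f s' * (1 - a t)" using assms 2 by (intro mult_right_mono) auto
    moreover have "f s \<le> f t" using assms 2 by auto
    ultimately show ?thesis using 2 assms(6) by (simp add: min_def max_def algebra_simps)
  next
    case 3
    then have eqs: "min s t = t" "max s t = s" "min s' t = t" "max s' t = s'" using assms(6) by auto
    have "f s * (1 - a t) \<le> f s' * (1 - a t)" using assms by (intro mult_right_mono) auto
    then show ?thesis using eqs by (simp add: algebra_simps)
  qed
qed

context kernel_problem
begin

definition lower_mass :: "(real \<times> real \<Rightarrow> real) \<Rightarrow> real set \<Rightarrow> real \<Rightarrow> real" where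
  "lower_mass F S s = (\<integral>x. indicator S x * F (x, s) \<partial>\<mu>)"

definition upper_mass :: "(real \<times> real \<Rightarrow> real) \<Rightarrow> real set \<Rightarrow> real \<Rightarrow> real" where
  "upper_mass F T s = (\<integral>x. indicator T x * (1 - F (x, s)) \<partial>\<mu>)"

lemma integrable_lower: "adm F \<Longrightarrow> S \<in> sets borel \<Longrightarrow> integrable \<mu> (\<lambda>x. indicator S x * F (x, s))"
  using adm_measurable[of F]
  by (intro integrable_section) (auto simp: indicator_def adm_nonneg adm_le_1)

lemma integrable_upper: "adm F \<Longrightarrow> S \<in> sets borel \<Longrightarrow> integrable \<mu> (\<lambda>x. indicator S x * (1 - F (x, s)))"
  using adm_measurable[of F]
  by (intro integrable_section) (auto simp: indicator_def adm_nonneg adm_le_1)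

context
  fixes F :: "real \<times> real \<Rightarrow> real" and S :: "real set" assumes F: "adm F" and S: "S \<in> sets borel"
begin

lemma lower_mass_nonneg: "0 \<le> lower_mass F S s"
  unfolding lower_mass_def by (intro integral_nonneg_AE) (simp add: adm_nonneg[OF F])

lemma upper_mass_nonneg: "0 \<le> upper_mass F S s"
  unfolding upper_mass_def by (intro integral_nonneg_AE) (simp add: adm_le_1[OF F])

lemma lower_mass_le_1: "lower_mass F S s \<le> 1"
proof -
  have "lower_mass F S s \<le> (\<integral>x. 1 \<partial>\<mu>)" unfolding lower_mass_def
    using integrable_lower[OF F S]
    by (intro integral_mono) (auto simp: indicator_def adm_le_1[OF F])
  then show ?thesis using prob_space by simp
qed

lemma upper_mass_le_1: "upper_mass F S s \<le> 1"
proof -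
  have "upper_mass F S s \<le> (\<integral>x. 1 \<partial>\<mu>)" unfolding upper_mass_def
    using integrable_upper[OF F S]
    by (intro integral_mono) (auto simp: indicator_def adm_nonneg[OF F])
  then show ?thesis using prob_space by simp
qed

lemma lower_mass_mono: "r \<le> s \<Longrightarrow> lower_mass F S r \<le> lower_mass F S s"
  unfolding lower_mass_def using integrable_lower[OF F S]
  by (intro integral_mono) (auto simp: indicator_def adm_mono[OF F])

lemma upper_mass_antimono: "r \<le> s \<Longrightarrow> upper_mass F S s \<le> upper_mass F S r"
  unfolding upper_mass_def using integrable_upper[OF F S]
  by (intro integral_mono) (auto simp: indicator_def adm_mono[OF F])

lemma measurable_lower_mass [measurable]: "lower_mass F S \<in> borel_measurable borel"
  by (intro borel_measurable_mono monoI lower_mass_mono)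

lemma measurable_upper_mass [measurable]: "upper_mass F S \<in> borel_measurable borel"
proof -
  have "(\<lambda>s. - upper_mass F S s) \<in> borel_measurable borel"
    by (intro borel_measurable_mono monoI) (simp add: upper_mass_antimono)
  then show ?thesis by simp
qed

end

text \<open>Below level \<open>t\<close>, the mass that \<open>F\<close> sends there from \<open>S\<close> is exchanged against the mass sent
  above \<open>t\<close> from \<open>T\<close>. This lifts the barycentres over \<open>S\<close> and lowers those over \<open>T\<close>.\<close>

definition swap_out :: "(real \<times> real \<Rightarrow> real) \<Rightarrow> real set \<Rightarrow> real set \<Rightarrow> real \<Rightarrow> real \<times> real \<Rightarrow> real" where
  "swap_out F S T t z = indicator S (fst z) * F (fst z, min (snd z) t) * upper_mass F T (max (snd z) t)"

definition swap_in :: "(real \<times> real \<Rightarrow> real) \<Rightarrow> real set \<Rightarrow> real set \<Rightarrow> real \<Rightarrow> real \<times> real \<Rightarrow> real" where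
  "swap_in F S T t z = indicator T (fst z) * (1 - F (fst z, max (snd z) t)) * lower_mass F S (min (snd z) t)"

text \<open>Each target at most \<open>t\<close> coming from \<open>S\<close> is paired with each
  target above \<open>t\<close> coming from \<open>T\<close>, with the product of the masses, and
  the two are exchanged. The value at \<open>s\<close> is the mass of the pairs that straddle both
  \<open>s\<close> and \<open>t\<close>: in total, the distribution functions at level
  \<open>s\<close> fall by it over \<open>S\<close> and rise by it over \<open>T\<close>.\<close>

definition swap_gain :: "(real \<times> real \<Rightarrow> real) \<Rightarrow> real set \<Rightarrow> real set \<Rightarrow> real \<Rightarrow> real \<Rightarrow> real" where
  "swap_gain F S T t s = lower_mass F S (min s t) * upper_mass F T (max s t)"

context
  fixes F :: "real \<times> real \<Rightarrow> real" and S T :: "real set" assumes F: "adm F" and S [measurable]: "S \<in> sets borel" and T [measurable]: "T \<in> sets borel"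
    and disj: "S \<inter> T = {}"
begin

lemmas [measurable] = adm_measurable[OF F] measurable_lower_mass[OF F S] measurable_upper_mass[OF F T]

lemma measurable_swap_out [measurable]: "swap_out F S T t \<in> borel_measurable plane"
  and measurable_swap_in [measurable]: "swap_in F S T t \<in> borel_measurable plane"
  unfolding swap_out_def swap_in_def by measurable

lemma swap_nonneg: "0 \<le> swap_out F S T t z" "0 \<le> swap_in F S T t z"
  by (simp_all add: swap_out_def swap_in_def adm_nonneg[OF F] adm_le_1[OF F] upper_mass_nonneg[OF F T] lower_mass_nonneg[OF F S])

lemma integral_swap_out: "(\<integral>x. swap_out F S T t (x, s) \<partial>\<mu>) = swap_gain F S T t s"
  by (simp add: swap_out_def swap_gain_def lower_mass_def)

lemma integral_swap_in: "(\<integral>x. swap_in F S T t (x, s) \<partial>\<mu>) = swap_gain F S T t s"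
  by (simp add: swap_in_def swap_gain_def upper_mass_def)

text \<open>The marginal survives because the parts subtracted over \<open>S\<close> and added over
  \<open>T\<close> have the same integral at each level. Monotonicity is
  \<open>swap_lower_mono\<close> over \<open>S\<close> and \<open>swap_upper_mono\<close> over
  \<open>T\<close>.\<close>

lemma adm_swap: "adm (\<lambda>z. F z - swap_out F S T t z + swap_in F S T t z)"
proof -
  note b = adm_nonneg[OF F] adm_le_1[OF F] upper_mass_nonneg[OF F T] lower_mass_nonneg[OF F S]
    upper_mass_le_1[OF F T] lower_mass_le_1[OF F S]
  have b1: "F (x, min s t) * upper_mass F T (max s t) \<le> F (x, s)" for x s
  proof -
    have "F (x, min s t) * upper_mass F T (max s t) \<le> F (x, min s t) * 1"
      by (intro mult_left_mono b)
    also have "\<dots> \<le> F (x, s)" using adm_mono[OF F, of "min s t" s] by simp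
    finally show ?thesis .
  qed
  have b2: "(1 - F (x, max s t)) * lower_mass F S (min s t) \<le> 1 - F (x, s)" for x s
  proof -
    have "(1 - F (x, max s t)) * lower_mass F S (min s t) \<le> (1 - F (x, max s t)) * 1"
      by (intro mult_left_mono b) (simp add: b)
    also have "\<dots> \<le> 1 - F (x, s)" using adm_mono[OF F, of s "max s t"] by simp
    finally show ?thesis .
  qed
  have b3: "0 \<le> F (x, min s t) * upper_mass F T (max s t)" "0 \<le> (1 - F (x, max s t)) * lower_mass F S (min s t)" for x s
    by (simp_all add: b)
  have bounds: "0 \<le> F (x, s) - swap_out F S T t (x, s) + swap_in F S T t (x, s)"
    "F (x, s) - swap_out F S T t (x, s) + swap_in F S T t (x, s) \<le> 1" for x s
    using b1[of x s] b2[of x s] b3[of x s] adm_nonneg[OF F, of "(x, s)"] adm_le_1[OF F, of "(x, s)"] disj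
    by (auto simp: swap_out_def swap_in_def indicator_def)
  have mono: "F (x, r) - swap_out F S T t (x, r) + swap_in F S T t (x, r)
      \<le> F (x, s) - swap_out F S T t (x, s) + swap_in F S T t (x, s)" if "r \<le> s" for x r s
  proof -
    have 1: "F (x, r) - F (x, min r t) * upper_mass F T (max r t) \<le> F (x, s) - F (x, min s t) * upper_mass F T (max s t)"
      by (rule swap_lower_mono) (auto simp: b adm_mono[OF F] upper_mass_antimono[OF F T] that)
    have 2: "F (x, r) + (1 - F (x, max r t)) * lower_mass F S (min r t)
        \<le> F (x, s) + (1 - F (x, max s t)) * lower_mass F S (min s t)"
      by (rule swap_upper_mono) (auto simp: b adm_mono[OF F] lower_mass_mono[OF F S] that)
    show ?thesis using 1 2 disj adm_mono[OF F that]
      by (auto simp: swap_out_def swap_in_def indicator_def)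
  qed
  have i: "integrable \<mu> (\<lambda>x. swap_out F S T t (x, s))" "integrable \<mu> (\<lambda>x. swap_in F S T t (x, s))" for s
    unfolding swap_out_def swap_in_def using integrable_lower[OF F S] integrable_upper[OF F T] by auto
  have "AE s in lborel. (\<integral>x. F (x, s) - swap_out F S T t (x, s) + swap_in F S T t (x, s) \<partial>\<mu>) = N s"
    using adm_marginal[OF F]
    by eventually_elim (simp add: i adm_integrable_section[OF F] integral_swap_in integral_swap_out)
  then show ?thesis
    unfolding adm_def using bounds mono by auto
qed

lemma abs_swap: "\<bar>F z - (F z - swap_out F S T t z + swap_in F S T t z)\<bar> = swap_out F S T t z + swap_in F S T t z"
  using disj swap_nonneg[of t z] by (auto simp: swap_out_def swap_in_def indicator_def)

lemma integrable_swap: "integrable P (swap_out F S T t)" "integrable P (swap_in F S T t)"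
proof -
  have i: "integrable P (\<lambda>z. F z - (F z - swap_out F S T t z + swap_in F S T t z))"
    by (intro integrable_adm_diff F adm_swap)
  have "norm (swap_out F S T t z) \<le> norm (F z - (F z - swap_out F S T t z + swap_in F S T t z))"
    "norm (swap_in F S T t z) \<le> norm (F z - (F z - swap_out F S T t z + swap_in F S T t z))" for z
    unfolding real_norm_def abs_swap using swap_nonneg[of t z] by auto
  then show "integrable P (swap_out F S T t)" "integrable P (swap_in F S T t)"
    by (intro Bochner_Integration.integrable_bound[OF i] AE_I2 measurable_P measurable_swap_out measurable_swap_in; simp)+
qed

lemma integral_swap:
  assumes B: "B \<in> sets borel"
  shows "(\<integral>z. indicator B (snd z) * swap_out F S T t z \<partial>P) = (\<integral>s. indicator B s * swap_gain F S T t s \<partial>lborel)"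
    and "(\<integral>z. indicator B (snd z) * swap_in F S T t z \<partial>P) = (\<integral>s. indicator B s * swap_gain F S T t s \<partial>lborel)"
    and "integrable lborel (swap_gain F S T t)"
proof -
  have 1: "integrable P (\<lambda>(x, s). indicator B s * swap_out F S T t (x, s))"
    using integrable_indicator_snd[OF integrable_swap(1) B] by (simp add: split_beta')
  have 2: "integrable P (\<lambda>(x, s). indicator B s * swap_in F S T t (x, s))"
    using integrable_indicator_snd[OF integrable_swap(2) B] by (simp add: split_beta')
  show "(\<integral>z. indicator B (snd z) * swap_out F S T t z \<partial>P) = (\<integral>s. indicator B s * swap_gain F S T t s \<partial>lborel)"
    using integral_snd[OF 1] by (simp add: split_beta' integral_swap_out)
  show "(\<integral>z. indicator B (snd z) * swap_in F S T t z \<partial>P) = (\<integral>s. indicator B s * swap_gain F S T t s \<partial>lborel)"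
    using integral_snd[OF 2] by (simp add: split_beta' integral_swap_in)
  have "integrable P (\<lambda>(x, s). swap_out F S T t (x, s))"
    using integrable_swap(1) by simp
  from integrable_snd[OF this] show "integrable lborel (swap_gain F S T t)"
    by (simp add: integral_swap_out)
qed

lemma swap_gain_nonneg: "0 \<le> swap_gain F S T t s"
  by (simp add: swap_gain_def upper_mass_nonneg[OF F T] lower_mass_nonneg[OF F S])

text \<open>The exchange transfers the total gain of drift from \<open>T\<close> to
  \<open>S\<close>, so the smoothed norm changes to first order by at most \<open>b - a\<close>
  times it, while the distance within \<open>B\<close> grows by at most twice the gain over
  \<open>B\<close>. Minimality forbids a net decrease.\<close>

lemma swap_inequality:
  assumes \<theta>: "0 < \<theta>" and lam: "0 \<le> lam" and F0: "adm F0" and B: "B \<in> sets borel"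
    and min: "\<And>G. adm G \<Longrightarrow> smooth_defect \<theta> F + lam * dist_on B F0 F \<le> smooth_defect \<theta> G + lam * dist_on B F0 G"
    and le: "\<And>x. x \<in> S \<Longrightarrow> clip \<theta> (drift F x) \<le> b" and ge: "\<And>x. x \<in> T \<Longrightarrow> a \<le> clip \<theta> (drift F x)"
  shows "(a - b) * (\<integral>s. swap_gain F S T t s \<partial>lborel) \<le> 2 * lam * (\<integral>s. indicator B s * swap_gain F S T t s \<partial>lborel)"
proof -
  let ?G = "\<lambda>z. F z - swap_out F S T t z + swap_in F S T t z"
  let ?I = "\<integral>s. swap_gain F S T t s \<partial>lborel"
  let ?d = "\<lambda>z. clip \<theta> (drift F (fst z)) * (swap_out F S T t z - swap_in F S T t z)"
  have [measurable]: "drift F \<in> borel_measurable borel" using F by measurable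
  have i: "integrable P ?d"
    using integrable_swap abs_clip_le
    by (intro Bochner_Integration.integrable_bound[OF Bochner_Integration.integrable_diff[OF integrable_swap(1)[of t] integrable_swap(2)[of t]]])
       (auto simp: abs_mult mult_left_le_one_le)
  have "(\<integral>x. clip \<theta> (drift F x) * (drift ?G x - drift F x) \<partial>\<mu>) = (\<integral>x. (\<integral>s. ?d (x, s) \<partial>lborel) \<partial>\<mu>)"
  proof (rule integral_cong_AE)
    have "drift ?G \<in> borel_measurable borel" using adm_swap by (rule measurable_drift)
    then show "(\<lambda>x. clip \<theta> (drift F x) * (drift ?G x - drift F x)) \<in> borel_measurable \<mu>" by simp
    show "AE x in \<mu>. clip \<theta> (drift F x) * (drift ?G x - drift F x) = (\<integral>s. ?d (x, s) \<partial>lborel)"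
      using AE_drift_diff[OF F adm_swap, of t] by eventually_elim simp
    show "(\<lambda>x. \<integral>s. ?d (x, s) \<partial>lborel) \<in> borel_measurable \<mu>"
      using integrable_fst'[OF i] by (rule borel_measurable_integrable)
  qed
  also have "\<dots> = (\<integral>z. ?d z \<partial>P)" by (rule integral_fst'[OF i])
  also have "\<dots> \<le> (\<integral>z. b * swap_out F S T t z - a * swap_in F S T t z \<partial>P)"
  proof (rule integral_mono[OF i])
    fix z
    have "clip \<theta> (drift F (fst z)) * swap_out F S T t z \<le> b * swap_out F S T t z"
      using le[of "fst z"] swap_nonneg[of t z] by (cases "fst z \<in> S") (auto simp: swap_out_def intro: mult_right_mono)
    moreover have "a * swap_in F S T t z \<le> clip \<theta> (drift F (fst z)) * swap_in F S T t z"
      using ge[of "fst z"] swap_nonneg[of t z] by (cases "fst z \<in> T") (auto simp: swap_in_def intro: mult_right_mono)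
    ultimately show "?d z \<le> b * swap_out F S T t z - a * swap_in F S T t z"
      by (simp add: algebra_simps)
  qed (use integrable_swap in auto)
  also have "\<dots> = (b - a) * ?I"
    using integral_swap(1,2)[of UNIV t] integrable_swap by (simp add: algebra_simps)
  finally have 1: "(\<integral>x. clip \<theta> (drift F x) * (drift ?G x - drift F x) \<partial>\<mu>) \<le> (b - a) * ?I" .
  have "dist_on B F ?G = (\<integral>z. indicator B (snd z) * swap_out F S T t z + indicator B (snd z) * swap_in F S T t z \<partial>P)"
    unfolding dist_on_def abs_swap by (simp add: distrib_left)
  also have "\<dots> = 2 * (\<integral>s. indicator B s * swap_gain F S T t s \<partial>lborel)"
    using integral_swap(1,2)[OF B] integrable_indicator_snd[OF _ B] integrable_swap
    by (subst Bochner_Integration.integral_add) auto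
  finally have 2: "dist_on B F ?G = 2 * (\<integral>s. indicator B s * swap_gain F S T t s \<partial>lborel)" .
  have "0 \<le> (b - a) * ?I + lam * dist_on B F ?G"
    using variational_inequality[OF \<theta> lam F0 B F adm_swap[of t] min] 1 by linarith
  then show ?thesis unfolding 2 by (simp add: algebra_simps)
qed

text \<open>If the gap in drift outweighs the penalty, or the penalty does not see the exchange, the
  total gain must be 0, hence also the gain at almost every level.\<close>

lemma separation:
  assumes \<theta>: "0 < \<theta>" and lam: "0 \<le> lam" and F0: "adm F0" and B: "B \<in> sets borel"
    and min: "\<And>G. adm G \<Longrightarrow> smooth_defect \<theta> F + lam * dist_on B F0 F \<le> smooth_defect \<theta> G + lam * dist_on B F0 G"
    and le: "\<And>x. x \<in> S \<Longrightarrow> clip \<theta> (drift F x) \<le> b" and ge: "\<And>x. x \<in> T \<Longrightarrow> a \<le> clip \<theta> (drift F x)"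
    and gap: "b < a" "2 * lam < a - b \<or> (\<forall>t. \<forall>s\<in>B. swap_gain F S T t s = 0)"
    and pr: "p < r"
  shows "lower_mass F S p * upper_mass F T r = 0"
proof -
  let ?I = "\<integral>s. swap_gain F S T r s \<partial>lborel"
  let ?J = "\<integral>s. indicator B s * swap_gain F S T r s \<partial>lborel"
  note ii = integral_swap(3)[of B r, OF B]
  have I0: "0 \<le> ?I" by (intro integral_nonneg_AE) (simp add: swap_gain_nonneg)
  have ineq: "(a - b) * ?I \<le> 2 * lam * ?J"
    by (rule swap_inequality[OF \<theta> lam F0 B min le ge])
  have "?I = 0"
    using gap(2)
  proof
    assume g: "2 * lam < a - b"
    have "?J \<le> ?I"
      using ii integrable_mult_indicator[of B lborel, OF _ ii] B
      by (intro integral_mono) (auto simp: indicator_def swap_gain_nonneg)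
    then have "2 * lam * ?J \<le> 2 * lam * ?I" using lam by (intro mult_left_mono) auto
    with ineq have "(a - b - 2 * lam) * ?I \<le> 0" by (simp add: algebra_simps)
    then show ?thesis using g I0 by (simp add: mult_le_0_iff)
  next
    assume "\<forall>t. \<forall>s\<in>B. swap_gain F S T t s = 0"
    then have "?J = 0" by (intro integral_eq_zero_AE AE_I2) (auto simp: indicator_def)
    with ineq have "(a - b) * ?I \<le> 0" by simp
    then show ?thesis using gap(1) I0 by (simp add: mult_le_0_iff)
  qed
  then have ae: "AE s in lborel. swap_gain F S T r s = 0"
    using integral_nonneg_eq_0_iff_AE[OF ii] by (simp add: swap_gain_nonneg)
  \<comment> \<open>For an exchange performed at \<open>r\<close>, the gain at \<open>s\<close>
    below \<open>r\<close> is the lower mass at \<open>s\<close> times the upper mass at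
    \<open>r\<close>. Finding such an \<open>s\<close> off a null set takes the strict inequality
    between \<open>p\<close> and \<open>r\<close>.\<close>
  obtain s where s: "p < s" "s < r" "swap_gain F S T r s = 0"
    using AE_lborel_ex_between[OF ae pr] .
  then have "lower_mass F S s * upper_mass F T r = 0" by (simp add: swap_gain_def min_def max_def)
  moreover have "0 \<le> lower_mass F S p" "lower_mass F S p \<le> lower_mass F S s"
    using s by (auto intro!: lower_mass_nonneg[OF F S] lower_mass_mono[OF F S])
  ultimately show ?thesis by auto
qed

end

text \<open>Subtract the drift over \<open>S\<close> from the convex order at \<open>c\<close>,
  pointwise. The contributions of \<open>S\<close> above \<open>c\<close> cancel, those of its
  complement below \<open>c\<close> are absent, and what is left is at most \<open>F\<close> over
  \<open>S\<close> below \<open>c\<close> and \<open>1 - F\<close> off \<open>S\<close> above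
  \<open>c\<close>.\<close>

lemma drift_le_masses:
  assumes F: "adm F" and S [measurable]: "S \<in> sets borel"
    and i1: "integrable lborel (\<lambda>s. indicator {..<c} s * lower_mass F S s)"
    and i2: "integrable lborel (\<lambda>s. indicator {c..} s * upper_mass F (- S) s)"
  shows "- (\<integral>x. indicator S x * drift F x \<partial>\<mu>)
    \<le> (\<integral>s. indicator {..<c} s * lower_mass F S s \<partial>lborel) + (\<integral>s. indicator {c..} s * upper_mass F (- S) s \<partial>lborel)"
proof -
  note [measurable] = adm_measurable[OF F]
  let ?U = "\<lambda>z. indicator {..<c} (snd z) * (indicator S (fst z) * F z)"
  let ?V = "\<lambda>z. indicator {c..} (snd z) * (indicator (- S) (fst z) * (1 - F z))"
  interpret Q: pair_sigma_finite lborel \<mu> ..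
  have a1: "integrable (lborel \<Otimes>\<^sub>M \<mu>) (\<lambda>(s, x). ?U (x, s))"
  proof (rule Q.Fubini_integrable)
    have "(\<integral>x. norm (?U (x, s)) \<partial>\<mu>) = indicator {..<c} s * lower_mass F S s" for s
      by (simp add: lower_mass_def abs_mult adm_nonneg[OF F])
    then show "integrable lborel (\<lambda>s. \<integral>x. norm (case (s, x) of (s, x) \<Rightarrow> ?U (x, s)) \<partial>\<mu>)" using i1 by simp
  qed (use integrable_lower[OF F S] in \<open>auto simp: indicator_def\<close>)
  have a2: "integrable (lborel \<Otimes>\<^sub>M \<mu>) (\<lambda>(s, x). ?V (x, s))"
  proof (rule Q.Fubini_integrable)
    have "(\<integral>x. norm (?V (x, s)) \<partial>\<mu>) = indicator {c..} s * upper_mass F (- S) s" for s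
      by (simp add: upper_mass_def abs_mult adm_le_1[OF F])
    then show "integrable lborel (\<lambda>s. \<integral>x. norm (case (s, x) of (s, x) \<Rightarrow> ?V (x, s)) \<partial>\<mu>)" using i2 by simp
  qed (use integrable_upper[OF F, of "- S"] in \<open>auto simp: indicator_def\<close>)
  have u: "integrable P ?U" using integrable_product_swap_iff[of ?U] a1 by simp
  have v: "integrable P ?V" using integrable_product_swap_iff[of ?V] a2 by simp
  have "integrable P (\<lambda>(x, s). ?U (x, s))" "integrable P (\<lambda>(x, s). ?V (x, s))" using u v by (simp_all add: split_beta')
  note eqs = integral_snd[OF this(1)] integral_snd[OF this(2)]
  have eqU: "(\<integral>z. ?U z \<partial>P) = (\<integral>s. indicator {..<c} s * lower_mass F S s \<partial>lborel)"
    using eqs(1) by (simp add: split_beta' lower_mass_def)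
  have eqV: "(\<integral>z. ?V z \<partial>P) = (\<integral>s. indicator {c..} s * upper_mass F (- S) s \<partial>lborel)"
    using eqs(2) by (simp add: split_beta' upper_mass_def)
  have i: "integrable P (\<lambda>z. indicator S (fst z) * (E0 z - F z))"
    by (rule Bochner_Integration.integrable_bound[OF integrable_E0_adm[OF F]]) (auto simp: indicator_def intro!: AE_I2)
  have eqd: "(\<integral>x. indicator S x * drift F x \<partial>\<mu>) = (\<integral>z. indicator S (fst z) * (E0 z - F z) \<partial>P)"
    using integral_fst'[OF i] by (simp add: drift_def)
  have j: "integrable P (\<lambda>z. indicator {c..} (snd z) * (E0 z - F z))"
    by (rule integrable_indicator_snd[OF integrable_E0_adm[OF F]]) simp
  have "(\<integral>z. indicator {c..} (snd z) * (E0 z - F z) \<partial>P) - (\<integral>z. indicator S (fst z) * (E0 z - F z) \<partial>P)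
     = (\<integral>z. indicator {c..} (snd z) * (E0 z - F z) - indicator S (fst z) * (E0 z - F z) \<partial>P)"
    using i j by simp
  also have "\<dots> \<le> (\<integral>z. ?U z + ?V z \<partial>P)"
  proof (rule integral_mono)
    fix z
    show "indicator {c..} (snd z) * (E0 z - F z) - indicator S (fst z) * (E0 z - F z) \<le> ?U z + ?V z"
      using step_bounds[of "fst z" "snd z"] adm_nonneg[OF F, of z] adm_le_1[OF F, of z] unfolding E0_def
      by (auto simp: indicator_def)
  qed (use i j u v in auto)
  also have "\<dots> = (\<integral>z. ?U z \<partial>P) + (\<integral>z. ?V z \<partial>P)" using u v by simp
  finally show ?thesis unfolding eqd eqU eqV using tail_E0_adm[OF F, of c] by linarith
qed

end

section \<open>From small drift to no drift\<close>

text \<open>The cut is the supremum of the levels where \<open>h\<close> does not vanish. The point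
  \<open>r\<close> makes this set nonempty, and by \<open>sep\<close> the point \<open>p\<close>
  bounds it.\<close>

lemma exists_cut:
  fixes a h :: "real \<Rightarrow> real"
  assumes sep: "\<And>p r. p < r \<Longrightarrow> a p * h r = 0" and a: "a p \<noteq> 0" and h: "h r \<noteq> 0"
  obtains c where "\<And>s. s < c \<Longrightarrow> a s = 0" "\<And>s. c < s \<Longrightarrow> h s = 0"
proof (rule that)
  have bdd: "bdd_above {r. h r \<noteq> 0}"
    using sep[of p] a by (intro bdd_aboveI[of _ p]) (auto simp: not_le[symmetric] intro: ccontr)
  fix s
  show "a s = 0" if "s < Sup {r. h r \<noteq> 0}"
    using less_cSup_iff[OF _ bdd, of s] h that sep[of s] by auto
  show "h s = 0" if "Sup {r. h r \<noteq> 0} < s"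
    using cSup_upper[OF _ bdd, of s] that by fastforce
qed

context kernel_problem
begin

text \<open>Over almost every point of \<open>S\<close> all mass has escaped to plus infinity, so
  \<open>F\<close> vanishes there and the integrand of the drift is nonnegative. The sign argument
  also covers a section that is not integrable, where the integral is 0 by convention.\<close>

lemma drift_nonneg_of_lower_mass:
  assumes F: "adm F" and S: "S \<in> sets borel" and zero: "\<And>s. lower_mass F S s = 0"
  shows "0 \<le> (\<integral>x. indicator S x * drift F x \<partial>\<mu>)"
proof (rule integral_nonneg_AE)
  have "AE x in \<mu>. indicator S x * F (x, real n) = 0" for n
    using zero[of n] integrable_lower[OF F S] unfolding lower_mass_def
    by (subst (asm) integral_nonneg_eq_0_iff_AE) (auto simp: adm_nonneg[OF F])
  then have "AE x in \<mu>. \<forall>n::nat. indicator S x * F (x, real n) = 0"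
    by (simp only: AE_all_countable) simp
  then show "AE x in \<mu>. 0 \<le> indicator S x * drift F x"
  proof eventually_elim
    case (elim x)
    show ?case
    proof (cases "x \<in> S")
      case True
      have "F (x, t) = 0" for t
      proof -
        obtain n :: nat where "t \<le> n" using real_arch_simple by blast
        then have "F (x, t) \<le> F (x, real n)" by (rule adm_mono[OF F])
        then show ?thesis using elim[rule_format, of n] True adm_nonneg[OF F, of "(x, t)"] by simp
      qed
      then show ?thesis by (simp add: drift_def)
    qed simp
  qed
qed

lemma drift_nonpos_of_upper_mass:
  assumes F: "adm F" and S: "S \<in> sets borel" and zero: "\<And>s. upper_mass F S s = 0"
  shows "(\<integral>x. indicator S x * drift F x \<partial>\<mu>) \<le> 0"
proof -
  have "AE x in \<mu>. indicator S x * (1 - F (x, - real n)) = 0" for n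
    using zero[of "- n"] integrable_upper[OF F S] unfolding upper_mass_def
    by (subst (asm) integral_nonneg_eq_0_iff_AE) (auto simp: adm_le_1[OF F])
  then have "AE x in \<mu>. \<forall>n::nat. indicator S x * (1 - F (x, - real n)) = 0"
    by (simp only: AE_all_countable) simp
  then have "AE x in \<mu>. indicator S x * drift F x \<le> 0"
  proof eventually_elim
    case (elim x)
    show ?case
    proof (cases "x \<in> S")
      case True
      have "F (x, t) = 1" for t
      proof -
        obtain n :: nat where "- t \<le> n" using real_arch_simple by blast
        then have "F (x, - real n) \<le> F (x, t)" by (intro adm_mono[OF F]) simp
        then show ?thesis using elim[rule_format, of n] True adm_le_1[OF F, of "(x, t)"] by simp
      qed
      moreover have "(\<integral>t. step x t - 1 \<partial>lborel) \<le> (\<integral>t. 0 \<partial>(lborel :: real measure))"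
        by (rule integral_mono') auto
      ultimately show ?thesis using True by (simp add: drift_def)
    qed simp
  qed
  then have "0 \<le> (\<integral>x. - (indicator S x * drift F x) \<partial>\<mu>)" by (intro integral_nonneg_AE) auto
  then show ?thesis by simp
qed

text \<open>If the minimiser had more drift than claimed, each of about 1 / (3 \<open>lam\<close>)
  level sets would carry negative drift of order \<open>R\<close> \<open>lam\<close>^2, and the gaps
  between them would need more distance and more mass than the window and \<mu> provide.\<close>

lemma improvement_step:
  assumes lam: "0 < lam" "lam < 1/18" and R: "0 < R" and F0: "adm F0"
  obtains F where "adm F" "defect F \<le> 200 * R * lam\<^sup>2" "dist_on {-R<..<R} F0 F \<le> defect F0 / lam"
proof -
  define \<theta> where "\<theta> = 25 * R * lam\<^sup>2"
  define B where "B = {-R<..<R}"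
  have \<theta>: "0 < \<theta>" using lam R by (simp add: \<theta>_def)
  have lam0: "0 \<le> lam" using lam by simp
  have B [measurable]: "B \<in> sets borel" by (simp add: B_def)
  obtain F where F: "adm F" and min:
    "\<And>G. adm G \<Longrightarrow> smooth_defect \<theta> F + lam * dist_on B F0 F \<le> smooth_defect \<theta> G + lam * dist_on B F0 G"
    using penalized_minimizer_exists[OF \<theta> lam0 F0 B] by blast
  have dist: "dist_on B F0 F \<le> defect F0 / lam"
    using min[OF F0] smooth_defect_nonneg[OF \<theta>, of F] smooth_defect_le[OF \<theta> F0] lam
    by (simp add: field_simps)
  have "defect F \<le> 200 * R * lam\<^sup>2"
  proof (rule ccontr)
    assume big: "\<not> ?thesis"
    define d where "d = drift F"
    have d_int: "integrable \<mu> d" unfolding d_def by (rule integrable_drift[OF F])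
    have [measurable]: "d \<in> borel_measurable borel" unfolding d_def using F by measurable
    \<comment> \<open>Half of the 200 is the share of the negative part of the drift; the 25 of
      \<theta> is what smoothing may hide.\<close>
    define q where "q = 75 * R * lam\<^sup>2"
    have q: "0 < q" using R lam by (simp add: q_def)
    define n where "n = nat \<lfloor>1 / (3 * lam)\<rfloor>"
    have n_le: "3 * lam * n \<le> 1"
    proof -
      have "real n \<le> 1 / (3 * lam)" unfolding n_def using lam by (simp add: of_nat_nat)
      then show ?thesis using lam by (simp add: field_simps)
    qed
    have n_ge: "1 - 3 * lam < 3 * lam * n"
    proof -
      have "1 / (3 * lam) < real n + 1" unfolding n_def using lam by (simp add: of_nat_nat)
      then show ?thesis using lam by (simp add: field_simps)
    qed
    define S where "S k = {x. clip \<theta> (d x) \<le> - (3 * lam * real k)}" for k :: nat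
    have S [measurable]: "S k \<in> sets borel" for k unfolding S_def by measurable
    have nS: "- S k \<in> sets borel" for k using sets.compl_sets[OF S[of k]] by (simp add: Compl_eq_Diff_UNIV)
    have S_mono: "S (Suc k) \<subseteq> S k" for k unfolding S_def using lam by (auto simp: algebra_simps)
    define A where "A k = lower_mass F (S k)" for k
    define H where "H k = upper_mass F (- S k)" for k
    note nonneg = lower_mass_nonneg[OF F S, folded A_def] upper_mass_nonneg[OF F nS, folded H_def]

    have int_S: "integrable \<mu> (\<lambda>x. indicator (S k) x * d x)" "integrable \<mu> (\<lambda>x. indicator (- S k) x * d x)" for k
      using integrable_mult_indicator[OF _ d_int, of "S k"] integrable_mult_indicator[OF _ d_int, of "- S k"] S nS by auto
    \<comment> \<open>The drift integrates to 0, so its negative part carries half of the defect.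
      Off \<open>S k\<close> the clipped drift exceeds -1, since 3 \<open>lam\<close> k <= 1, and
      therefore the drift is at least -\<theta> there.\<close>
    have q_le: "q < - (\<integral>x. indicator (S k) x * d x \<partial>\<mu>)" if "k \<le> n" for k
    proof -
      have k: "3 * lam * k \<le> 1"
        using n_le that lam by (meson mult_left_mono of_nat_mono order_trans mult_nonneg_nonneg zero_le_numeral less_imp_le)
      have pt: "(\<bar>d x\<bar> - d x) / 2 - \<theta> \<le> - (indicator (S k) x * d x)" for x
      proof (cases "x \<in> S k")
        case True
        have "0 \<le> 3 * lam * real k" using lam by simp
        then have "clip \<theta> (d x) \<le> 0" using True by (simp add: S_def)
        then have "d x \<le> 0"
          by (cases "d x" rule: clip_cases[OF \<theta>]) (use \<theta> mult_nonneg_nonpos[of \<theta> "clip \<theta> (d x)"] in auto)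
        then show ?thesis using True \<theta> by simp
      next
        case False
        then have "-1 < clip \<theta> (d x)" using k by (simp add: S_def)
        then have "- \<theta> \<le> d x"
          using mult_left_mono[of "-1" "clip \<theta> (d x)" \<theta>] \<theta>
          by (cases "d x" rule: clip_cases[OF \<theta>]) auto
        then show ?thesis using False \<theta> by (auto simp: abs_if field_simps)
      qed
      have "(\<integral>x. d x \<partial>\<mu>) = 0" unfolding d_def using integral_drift[OF F] by simp
      then have "defect F / 2 - \<theta> = (\<integral>x. (\<bar>d x\<bar> - d x) / 2 - \<theta> \<partial>\<mu>)"
        unfolding defect_def d_def[symmetric] using d_int prob_space by simp
      also have "\<dots> \<le> (\<integral>x. - (indicator (S k) x * d x) \<partial>\<mu>)"
        by (intro integral_mono pt) (use d_int int_S in auto)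
      finally have "defect F / 2 - \<theta> \<le> - (\<integral>x. indicator (S k) x * d x \<partial>\<mu>)" by simp
      moreover have "q < defect F / 2 - \<theta>" using big by (simp add: q_def \<theta>_def)
      ultimately show ?thesis by linarith
    qed
    have A_ne: "\<exists>p. A k p \<noteq> 0" if "k \<le> n" for k
      using drift_nonneg_of_lower_mass[OF F S, of k] q_le[OF that] q unfolding A_def d_def by force
    have H_ne: "\<exists>r. H k r \<noteq> 0" if "k \<le> n" for k
    proof -
      have "(\<integral>x. indicator (S k) x * d x + indicator (- S k) x * d x \<partial>\<mu>) = (\<integral>x. d x \<partial>\<mu>)"
        by (intro Bochner_Integration.integral_cong) (auto simp: indicator_def)
      then have "(\<integral>x. indicator (S k) x * d x \<partial>\<mu>) + (\<integral>x. indicator (- S k) x * d x \<partial>\<mu>) = 0"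
        unfolding Bochner_Integration.integral_add[OF int_S] using integral_drift[OF F] by (simp add: d_def)
      then show ?thesis
        using drift_nonpos_of_upper_mass[OF F nS, of k] q_le[OF that] q unfolding H_def d_def by force
    qed
    \<comment> \<open>Convex order at \<open>c\<close>: nothing from outside \<open>S k\<close>
      lands above \<open>c\<close>, so only the targets of \<open>S k\<close> between
      \<open>c'\<close> and \<open>c\<close> can account for negative drift, and their mass is at
      most \<open>p\<close>.\<close>
    have bound: "q < max 0 (c - c') * p"
      if k: "k \<le> n" and c: "\<And>s. c < s \<Longrightarrow> H k s = 0" and c': "\<And>s. s < c' \<Longrightarrow> A k s = 0"
        and p: "\<And>s. s < c \<Longrightarrow> A k s \<le> p" for k c c' p
    proof -
      have H0: "AE s in lborel. indicator {c..} s * H k s = 0"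
        using AE_lborel_singleton[of c] by eventually_elim (use c in \<open>auto simp: indicator_def\<close>)
      have [measurable]: "A k \<in> borel_measurable borel" "H k \<in> borel_measurable borel"
        unfolding A_def H_def using measurable_lower_mass[OF F S] measurable_upper_mass[OF F nS] by auto
      have i2: "integrable lborel (\<lambda>s. indicator {c..} s * H k s)"
        using integrable_cong_AE[of "\<lambda>s. indicator {c..} s * H k s" lborel "\<lambda>_. 0"] H0 by simp
      have r: "integrable lborel (\<lambda>s. indicator {c'..<c} s * p)"
        by (intro integrable_mult_left) (simp add: integrable_indicator_iff emeasure_lborel_Ico_eq)
      have le: "indicator {..<c} s * A k s \<le> indicator {c'..<c} s * p" for s
        using p[of s] c'[of s] by (auto simp: indicator_def)
      have i1: "integrable lborel (\<lambda>s. indicator {..<c} s * A k s)"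
      proof (rule Bochner_Integration.integrable_bound[OF r])
        show "AE s in lborel. norm (indicator {..<c} s * A k s) \<le> norm (indicator {c'..<c} s * p)"
        proof (rule AE_I2)
          fix s
          show "norm (indicator {..<c} s * A k s) \<le> norm (indicator {c'..<c} s * p)"
            using order_trans[OF le abs_ge_self, of s] nonneg(1)[of k s] by (simp only: real_norm_def abs_of_nonneg mult_nonneg_nonneg indicator_pos_le)
        qed
      qed simp
      have "- (\<integral>x. indicator (S k) x * d x \<partial>\<mu>) \<le> (\<integral>s. indicator {..<c} s * A k s \<partial>lborel) + (\<integral>s. indicator {c..} s * H k s \<partial>lborel)"
        unfolding d_def A_def H_def
        by (rule drift_le_masses[OF F S]) (use i1 i2 in \<open>auto simp: A_def H_def\<close>)
      also have "(\<integral>s. indicator {c..} s * H k s \<partial>lborel) = 0"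
        using H0 by (rule integral_eq_zero_AE)
      also have "(\<integral>s. indicator {..<c} s * A k s \<partial>lborel) \<le> (\<integral>s. indicator {c'..<c} s * p \<partial>lborel)"
        using i1 r le by (rule integral_mono)
      also have "\<dots> = max 0 (c - c') * p"
        by (cases "c' \<le> c") auto
      finally show ?thesis using q_le[OF k] by simp
    qed
    \<comment> \<open>A cut point separating the targets of the points below and above one and the same level
      would, by the convex order, make the drift below that level nonnegative.\<close>
    have no_cut: "\<exists>p r. p < r \<and> A k p * H k r \<noteq> 0" if k: "k \<le> n" for k
    proof (rule ccontr)
      assume "\<not> ?thesis"
      then obtain c where c: "\<And>s. s < c \<Longrightarrow> A k s = 0" "\<And>s. c < s \<Longrightarrow> H k s = 0"
        using exists_cut[of "A k" "H k"] A_ne[OF k] H_ne[OF k] by blast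
      have "q < max 0 (c - c) * 0" by (rule bound[OF k]) (use c in auto)
      then show False using q by simp
    qed
    \<comment> \<open>If one side of the exchange has no mass in the window, the penalty does not see the exchange,
      so that arbitrarily close levels are separated already.\<close>
    have inside: False if k: "k \<le> n" and out: "(\<forall>s<R. A k s = 0) \<or> (\<forall>s>-R. H k s = 0)" for k
    proof -
      obtain p r where pr: "p < r" and ne: "A k p * H k r \<noteq> 0" using no_cut[OF k] by blast
      \<comment> \<open>\<open>separation\<close> asks for a positive gap, which \<open>S k\<close>
        and its complement do not have; the sets \<open>T m\<close> have one and exhaust the
        complement.\<close>
      define T where "T m = {x. - (3 * lam * real k) + 1 / Suc m \<le> clip \<theta> (d x)}" for m :: nat
      have T [measurable]: "T m \<in> sets borel" for m unfolding T_def by measurable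
      have T_sub: "T m \<subseteq> - S k" for m
      proof
        fix x assume "x \<in> T m"
        moreover have "0 < 1 / real (Suc m)" by simp
        ultimately show "x \<in> - S k" unfolding T_def S_def mem_Collect_eq Compl_iff by linarith
      qed
      have H_T: "upper_mass F (T m) s \<le> H k s" for m s
        unfolding H_def upper_mass_def using integrable_upper[OF F T] integrable_upper[OF F nS] T_sub[of m]
        by (intro integral_mono) (auto simp: indicator_def adm_le_1[OF F])
      have zero: "upper_mass F (T m) r = 0" for m
      proof -
        have "lower_mass F (S k) p * upper_mass F (T m) r = 0"
        proof (rule separation[OF F S T _ \<theta> lam0 F0 B min, where a = "- (3 * lam * real k) + 1 / Suc m" and b = "- (3 * lam * real k)"])
          show "S k \<inter> T m = {}" using T_sub by auto
          show "2 * lam < - (3 * lam * real k) + 1 / real (Suc m) - - (3 * lam * real k) \<or>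
              (\<forall>t. \<forall>s\<in>B. swap_gain F (S k) (T m) t s = 0)"
          proof (rule disjI2, intro allI ballI)
            fix t s assume "s \<in> B"
            then have "- R < max s t" "min s t < R" by (auto simp: B_def)
            then show "swap_gain F (S k) (T m) t s = 0"
              using out H_T[of m "max s t"] upper_mass_nonneg[OF F T, of m "max s t"]
              by (auto simp: swap_gain_def A_def)
          qed
        qed (use pr in \<open>auto simp: S_def T_def d_def\<close>)
        then show ?thesis using ne by (simp add: A_def)
      qed
      have "AE x in \<mu>. indicator (T m) x * (1 - F (x, r)) = 0" for m
        using zero[of m] integrable_upper[OF F T] unfolding upper_mass_def
        by (subst (asm) integral_nonneg_eq_0_iff_AE) (auto simp: adm_le_1[OF F])
      then have "AE x in \<mu>. \<forall>m. indicator (T m) x * (1 - F (x, r)) = 0"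
        by (simp only: AE_all_countable) simp
      then have "AE x in \<mu>. indicator (- S k) x * (1 - F (x, r)) = 0"
      proof eventually_elim
        case (elim x)
        show ?case
        proof (cases "x \<in> S k")
          case False
          then have "0 < clip \<theta> (d x) + 3 * lam * real k" by (simp add: S_def)
          then obtain m where "inverse (real (Suc m)) < clip \<theta> (d x) + 3 * lam * real k"
            using reals_Archimedean by blast
          then have "x \<in> T m" by (simp add: T_def inverse_eq_divide)
          then show ?thesis using elim[rule_format, of m] by simp
        qed simp
      qed
      then have "H k r = 0" unfolding H_def upper_mass_def by (rule integral_eq_zero_AE)
      then show False using ne by simp
    qed
    have "\<exists>c. (\<forall>s<c. A (Suc k) s = 0) \<and> (\<forall>s>c. H k s = 0)" if k: "Suc k \<le> n" for k
    proof -
      have sep: "A (Suc k) p * H k r = 0" if "p < r" for p r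
        unfolding A_def H_def
      proof (rule separation[OF F S nS _ \<theta> lam0 F0 B min, where a = "- (3 * lam * real k)" and b = "- (3 * lam * real (Suc k))"])
        show "S (Suc k) \<inter> - S k = {}" using S_mono by auto
      qed (use lam that in \<open>auto simp: S_def d_def algebra_simps\<close>)
      show ?thesis
        using exists_cut[of "A (Suc k)" "H k", OF sep] A_ne[OF k] H_ne[of k] k by (metis Suc_leD)
    qed
    then obtain c where c: "\<And>k s. Suc k \<le> n \<Longrightarrow> s < c k \<Longrightarrow> A (Suc k) s = 0"
      "\<And>k s. Suc k \<le> n \<Longrightarrow> c k < s \<Longrightarrow> H k s = 0" by metis
    have c_in: "- R < c k" "c k < R" if "Suc k \<le> n" for k
      using inside[OF that] inside[of k] c[OF that] that
      by (meson Suc_leD less_le_trans not_le)+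
    define p where "p k = prob (S k - S (Suc k))" for k
    \<comment> \<open>Nothing from \<open>S (Suc (Suc k))\<close> lands below
      \<open>c (Suc k)\<close>, so only points between the two levels contribute there.\<close>
    have p_bound: "A (Suc k) s \<le> p (Suc k)" if k: "Suc (Suc k) \<le> n" "s < c (Suc k)" for k s
    proof -
      let ?D = "S (Suc k) - S (Suc (Suc k))"
      have D: "?D \<in> sets borel" by measurable
      have "A (Suc k) s = (\<integral>x. indicator (S (Suc (Suc k))) x * F (x, s) + indicator ?D x * F (x, s) \<partial>\<mu>)"
        unfolding A_def lower_mass_def using S_mono[of "Suc k"]
        by (intro Bochner_Integration.integral_cong) (auto simp: indicator_def)
      also have "\<dots> = A (Suc (Suc k)) s + (\<integral>x. indicator ?D x * F (x, s) \<partial>\<mu>)"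
        unfolding A_def lower_mass_def
        by (intro Bochner_Integration.integral_add integrable_lower[OF F] S D)
      also have "A (Suc (Suc k)) s = 0" using c(1)[OF k] .
      also have "(\<integral>x. indicator ?D x * F (x, s) \<partial>\<mu>) \<le> (\<integral>x. indicator ?D x \<partial>\<mu>)"
      proof (rule integral_mono[OF integrable_lower[OF F D]])
        show "integrable \<mu> (indicat_real ?D)"
          using D by (intro integrable_section) (auto simp: indicator_def)
      qed (auto simp: indicator_def adm_le_1[OF F])
      also have "\<dots> = p (Suc k)" using D by (simp add: p_def)
      finally show ?thesis by simp
    qed
    \<comment> \<open>AM-GM, applied to \<open>bound\<close> between the cut points \<open>c k\<close> and \<open>c (Suc k)\<close>.\<close>
    have incr: "12 * lam \<le> (c (Suc k) - c k) / (2 * R) + p (Suc k)" if k: "Suc (Suc k) \<le> n" for k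
    proof -
      have b: "q < max 0 (c (Suc k) - c k) * p (Suc k)"
        using k by (intro bound[of "Suc k"] c p_bound) auto
      have "c k < c (Suc k)" using b q by (cases "c k < c (Suc k)") auto
      define x where "x = (c (Suc k) - c k) / (2 * R)"
      have x: "0 < x" using \<open>c k < c (Suc k)\<close> R by (simp add: x_def)
      have "R * (75 * lam\<^sup>2) < R * (2 * (x * p (Suc k)))"
        using b \<open>c k < c (Suc k)\<close> R by (simp add: x_def q_def)
      then have "75 * lam\<^sup>2 < 2 * (x * p (Suc k))" using R by (simp only: mult_less_cancel_left_pos)
      \<comment> \<open>75 / 2 is lowered to 36 = 6^2, so that (x + p)^2 >= 4 x p is at least a
        perfect square, (12 \<open>lam\<close>)^2.\<close>
      then have "36 * lam\<^sup>2 \<le> x * p (Suc k)" using zero_le_power2[of lam] by linarith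
      moreover have "0 \<le> (x - p (Suc k))\<^sup>2" by simp
      ultimately have "(12 * lam)\<^sup>2 \<le> (x + p (Suc k))\<^sup>2" by (simp add: power2_eq_square algebra_simps)
      then show ?thesis unfolding x_def[symmetric]
        by (rule power2_le_imp_le) (use x in \<open>simp add: p_def\<close>)
    qed
    have p_sum: "(\<Sum>k<m. p (Suc k)) \<le> prob (S 0) - prob (S (Suc m))" for m
    proof (induction m)
      case 0
      have "prob (S (Suc 0)) \<le> prob (S 0)" using S_mono[of 0] S by (intro finite_measure_mono) auto
      then show ?case by simp
    next
      case (Suc m)
      have "p (Suc m) = prob (S (Suc m)) - prob (S (Suc (Suc m)))"
        unfolding p_def using S_mono S by (intro finite_measure_Diff) auto
      then show ?case using Suc by simp
    qed
    have sum: "m * (12 * lam) \<le> (c m - c 0) / (2 * R) + (\<Sum>k<m. p (Suc k))" if "Suc m \<le> n" for m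
      using that
    proof (induction m)
      case (Suc m)
      have "(c (Suc m) - c 0) / (2 * R) = (c m - c 0) / (2 * R) + (c (Suc m) - c m) / (2 * R)"
        by (simp add: add_divide_distrib[symmetric])
      then show ?case using Suc incr[of m] by (simp add: algebra_simps)
    qed simp
    have "6 * lam * 3 < 1" using lam by simp
    then have "n \<noteq> 0" using n_ge lam by (intro notI) simp
    then obtain m where m: "n = Suc m" using not0_implies_Suc by blast
    have "(c m - c 0) / (2 * R) \<le> 1"
      using c_in[of m] c_in[of 0] m R by (simp add: field_simps)
    moreover have "(\<Sum>k<m. p (Suc k)) \<le> 1"
      using p_sum[of m] prob_le_1[of "S 0"] measure_nonneg[of \<mu> "S (Suc m)"] by linarith
    moreover have "m * (12 * lam) \<le> (c m - c 0) / (2 * R) + (\<Sum>k<m. p (Suc k))"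
      using sum[of m] m by simp
    \<comment> \<open>The cut points \<open>c 0\<close>, ..., \<open>c m\<close> have
      \<open>m = n - 1\<close> gaps, and 12 \<open>lam\<close> m > 4 - 24 \<open>lam\<close>, which
      exceeds 2 since \<open>lam\<close> < 1/18. The budget is 1 for normalised distance plus 1 for
      mass.\<close>
    ultimately have "m * (12 * lam) \<le> 2" by linarith
    then show False using n_ge lam unfolding m by (simp add: algebra_simps)
  qed
  then show ?thesis using that F dist unfolding B_def by blast
qed

lemma defect_nonneg: "0 \<le> defect F"
  unfolding defect_def by simp

text \<open>In terms of the halved parameter l the drift at hand is at most 800 R l^2, so the next
  step costs at most 800 R l in distance. Summing over l = \<open>lam\<close> / 2,
  \<open>lam\<close> / 4, ... gives the last term.\<close>

lemma small_defect_nearby: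
  assumes lam: "0 < lam" "lam < 1/18" and R: "0 < R" and F0: "adm F0"
  obtains G where "adm G" "defect G \<le> 200 * R * (lam / 2 ^ j)\<^sup>2"
    "dist_on {-R<..<R} F0 G \<le> defect F0 / lam + 800 * R * lam * (1 - 1 / 2 ^ j)"
proof (induction j arbitrary: thesis)
  case 0
  show ?case using improvement_step[OF lam R F0] 0 by auto
next
  case (Suc j)
  obtain G where G: "adm G" "defect G \<le> 200 * R * (lam / 2 ^ j)\<^sup>2"
    "dist_on {-R<..<R} F0 G \<le> defect F0 / lam + 800 * R * lam * (1 - 1 / 2 ^ j)"
    using Suc.IH .
  define l where "l = lam / 2 ^ Suc j"
  have "(1::real) \<le> 2 ^ Suc j" by (rule one_le_power) simp
  then have l_le: "l \<le> lam" unfolding l_def using lam by (simp add: divide_le_eq mult_le_cancel_left1 del: power_Suc)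
  have "0 < l" using lam by (simp add: l_def)
  note l = this le_less_trans[OF l_le lam(2)]
  obtain G' where G': "adm G'" "defect G' \<le> 200 * R * l\<^sup>2" "dist_on {-R<..<R} G G' \<le> defect G / l"
    using improvement_step[OF l R G(1)] .
  have "lam / 2 ^ j = 2 * l" by (simp add: l_def)
  then have "defect G \<le> 800 * R * l * l" using G(2) by (simp add: power2_eq_square mult_ac)
  then have "defect G / l \<le> 800 * R * l" using l by (simp add: divide_le_eq)
  moreover have "dist_on {-R<..<R} F0 G' \<le> dist_on {-R<..<R} F0 G + dist_on {-R<..<R} G G'"
    by (intro dist_on_triangle F0 G G') simp
  ultimately have "dist_on {-R<..<R} F0 G' \<le> defect F0 / lam + 800 * R * lam * (1 - 1 / 2 ^ j) + 800 * R * l"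
    using G(3) G'(3) by linarith
  also have "\<dots> = defect F0 / lam + 800 * R * lam * (1 - 1 / 2 ^ Suc j)"
    by (simp add: l_def field_simps)
  finally show ?case using Suc.prems[OF G'(1)] G'(2) by (simp add: l_def)
qed

text \<open>The estimates control the iterates only on the window. Instead of passing to a limit,
  \<open>defect\<close> is minimised over all admissible functions within the distance that bounds
  every iterate; the iterates show that the minimum is 0.\<close>

theorem martingale_nearby:
  assumes lam: "0 < lam" "lam < 1/18" and R: "0 < R" and F0: "adm F0"
  obtains F where "adm F" "defect F = 0" "dist_on {-R<..<R} F0 F \<le> defect F0 / lam + 800 * R * lam"
proof -
  define b where "b = defect F0 / lam + 800 * R * lam"
  define B where "B = {-R<..<R}"
  have B: "B \<in> sets borel" by (simp add: B_def)
  define C where "C = {F. adm F \<and> dist_on B F0 F \<le> b}"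
  have near: "\<exists>G \<in> C. defect G \<le> 200 * R * (lam / 2 ^ j)\<^sup>2" for j
  proof -
    obtain G where G: "adm G" "defect G \<le> 200 * R * (lam / 2 ^ j)\<^sup>2"
      "dist_on {-R<..<R} F0 G \<le> defect F0 / lam + 800 * R * lam * (1 - 1 / 2 ^ j)"
      using small_defect_nearby[OF lam R F0] .
    have "800 * R * lam * (1 - 1 / 2 ^ j) \<le> 800 * R * lam * 1"
      using lam R by (intro mult_left_mono) auto
    then show ?thesis using G unfolding C_def B_def b_def by force
  qed
  obtain F where F: "F \<in> C" "\<And>G. G \<in> C \<Longrightarrow> defect F \<le> defect G"
  proof (rule minimizer_exists[of C defect])
    show "C \<noteq> {}" using near by blast
    fix F G assume "F \<in> C" "G \<in> C"
    then have FG: "adm F" "adm G" "dist_on B F0 F \<le> b" "dist_on B F0 G \<le> b" by (auto simp: C_def)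
    show "defect (mid F G) \<le> max (defect F) (defect G)"
      using defect_mid[OF FG(1,2)] by (auto simp: max_def)
    have "dist_on B F0 (mid F G) \<le> (1 - 1/2) * dist_on B F0 F + 1/2 * dist_on B F0 G"
      using FG F0 B by (intro dist_on_convex) auto
    also have "\<dots> \<le> b" using FG by simp
    finally show "mid F G \<in> C" using adm_mid[OF FG(1,2)] by (simp only: C_def mem_Collect_eq)
  next
    fix Fs F assume Fs: "\<And>n. Fs n \<in> C" and F: "adm F" and lim: "(\<lambda>n. dist_on UNIV (Fs n) F) \<longlonglongrightarrow> 0"
    have "dist_on B F0 F \<le> b"
      using dist_on_tendsto[OF _ F F0 B lim] Fs
      by (intro LIMSEQ_le_const2[of "\<lambda>n. dist_on B F0 (Fs n)"]) (auto simp: C_def)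
    then show "F \<in> C" using F by (simp add: C_def)
  next
    fix Fs F assume "\<And>n. Fs n \<in> C" "F \<in> C" "(\<lambda>n. dist_on UNIV (Fs n) F) \<longlonglongrightarrow> 0"
    then show "(\<lambda>n. defect (Fs n)) \<longlonglongrightarrow> defect F"
      by (intro functional_tendsto[of defect] defect_lipschitz) (auto simp: C_def)
  qed (auto simp: C_def defect_nonneg)
  have "(\<lambda>j. 200 * R * (lam / 2 ^ j)\<^sup>2) \<longlonglongrightarrow> 200 * R * (lam * 0)\<^sup>2"
    unfolding divide_inverse power_inverse[symmetric]
    by (intro tendsto_intros LIMSEQ_power_zero) simp
  moreover have "defect F \<le> 200 * R * (lam / 2 ^ j)\<^sup>2" for j
    using near[of j] F(2) by (auto intro: order_trans)
  ultimately have "defect F \<le> 200 * R * (lam * 0)\<^sup>2"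
    by (intro LIMSEQ_le_const[of "\<lambda>j. 200 * R * (lam / 2 ^ j)\<^sup>2"]) auto
  then have "defect F \<le> 0" by simp
  then show ?thesis using that[of F] F(1) defect_nonneg[of F] by (auto simp: C_def B_def b_def)
qed

end

section \<open>Kernels and disintegrations\<close>

lemma AE_decseq_tendsto_0:
  fixes f :: "nat \<Rightarrow> 'a \<Rightarrow> real"
  assumes "finite_measure M" and [measurable]: "\<And>n. f n \<in> borel_measurable M"
    and bnd: "\<And>n x. 0 \<le> f n x" "\<And>n x. f n x \<le> 1" and dec: "\<And>x. decseq (\<lambda>n. f n x)"
    and lim: "(\<lambda>n. \<integral>x. f n x \<partial>M) \<longlonglongrightarrow> 0"
  shows "AE x in M. (\<lambda>n. f n x) \<longlonglongrightarrow> 0"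
proof -
  interpret finite_measure M by fact
  define L where "L x = lim (\<lambda>n. f n x)" for x
  have L: "(\<lambda>n. f n x) \<longlonglongrightarrow> L x" for x
  proof -
    have "convergent (\<lambda>n. f n x)"
      using decseq_convergent[OF dec, of 0 x] bnd(1) unfolding convergent_def by metis
    then show ?thesis by (simp add: L_def convergent_LIMSEQ_iff)
  qed
  have [measurable]: "L \<in> borel_measurable M"
    by (rule borel_measurable_LIMSEQ_real[OF L]) simp
  have L_bnd: "0 \<le> L x" "L x \<le> 1" for x
    using LIMSEQ_le_const[OF L, of 0] LIMSEQ_le_const2[OF L, of _ 1] bnd by auto
  have "(\<lambda>n. \<integral>x. f n x \<partial>M) \<longlonglongrightarrow> (\<integral>x. L x \<partial>M)"
    by (rule integral_dominated_convergence[where w="\<lambda>_. 1"]) (use L bnd in auto)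
  then have "(\<integral>x. L x \<partial>M) = 0" using lim LIMSEQ_unique by blast
  moreover have "integrable M L" using L_bnd by (intro integrable_const_bound[of _ 1]) auto
  ultimately have "AE x in M. L x = 0"
    using integral_nonneg_eq_0_iff_AE[of M L] L_bnd by auto
  then show ?thesis
  proof eventually_elim
    case (elim x)
    then show ?case using L[of x] by simp
  qed
qed

text \<open>For a monotone \<open>f\<close> with values in [0, 1] this means limits 0 and 1 at the
  two ends. Countably many inequalities at integers make the set of good \<open>x\<close>
  measurable.\<close>

definition proper_tails :: "(real \<Rightarrow> real) \<Rightarrow> bool" where
  "proper_tails f \<longleftrightarrow> (\<forall>m::nat. \<exists>n::nat. f (- real n) < 1 / real (Suc m)) \<and> (\<forall>m::nat. \<exists>n::nat. 1 - f (real n) < 1 / real (Suc m))"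

lemma AE_proper_tails:
  fixes F :: "real \<times> real \<Rightarrow> real"
  assumes fin: "prob_space M" and [measurable_cong]: "sets M = sets borel"
    and [measurable]: "F \<in> borel_measurable plane"
    and bnd: "\<And>z. 0 \<le> F z" "\<And>z. F z \<le> 1" and mono: "\<And>x s t. s \<le> t \<Longrightarrow> F (x, s) \<le> F (x, t)"
    and bot: "(\<lambda>n. \<integral>x. F (x, - real n) \<partial>M) \<longlonglongrightarrow> 0" and top: "(\<lambda>n. \<integral>x. F (x, real n) \<partial>M) \<longlonglongrightarrow> 1"
  shows "AE x in M. proper_tails (\<lambda>t. F (x, t))"
proof -
  interpret prob_space M by fact
  have i: "integrable M (\<lambda>x. F (x, t))" for t
    using bnd by (intro integrable_const_bound[of _ 1]) auto
  have 1: "AE x in M. (\<lambda>n. F (x, - real n)) \<longlonglongrightarrow> 0"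
    by (rule AE_decseq_tendsto_0) (use bnd bot in \<open>auto simp: decseq_def intro!: mono finite_measure_axioms\<close>)
  have "(\<lambda>n. \<integral>x. 1 - F (x, real n) \<partial>M) \<longlonglongrightarrow> 1 - 1"
    using tendsto_diff[OF tendsto_const[of 1] top] i prob_space by simp
  then have 2: "AE x in M. (\<lambda>n. 1 - F (x, real n)) \<longlonglongrightarrow> 0"
    by (intro AE_decseq_tendsto_0) (use bnd in \<open>auto simp: decseq_def intro!: mono finite_measure_axioms\<close>)
  have ex: "\<exists>n. f n < 1 / real (Suc m)" if "f \<longlonglongrightarrow> 0" for f :: "nat \<Rightarrow> real" and m :: nat
    using order_tendstoD(2)[OF that, of "1 / real (Suc m)"] eventually_happens by fastforce
  show ?thesis using 1 2 by eventually_elim (use ex in \<open>simp add: proper_tails_def\<close>)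
qed

text \<open>\<open>g\<close> is the right limit of \<open>f\<close>: regularising from the right
  makes a distribution function of \<open>f\<close> and alters it at most at its jumps.\<close>

lemma right_limit_distribution:
  fixes f :: "real \<Rightarrow> real"
  assumes bnd: "\<And>t. 0 \<le> f t" "\<And>t. f t \<le> 1" and mono: "\<And>s t. s \<le> t \<Longrightarrow> f s \<le> f t" and good: "proper_tails f"
  defines "g \<equiv> \<lambda>t. INF n. f (t + 1 / real (Suc n))"
  shows "f t \<le> g t" "t < s \<Longrightarrow> g t \<le> f s"
    "real_distribution (interval_measure g)" "cdf (interval_measure g) = g"
proof -
  have bdd: "bdd_below (range (\<lambda>n. f (t + 1 / real (Suc n))))" for t
    using bnd by (auto intro!: bdd_belowI[of _ 0])
  show lower: "f t \<le> g t" for t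
    unfolding g_def by (intro cINF_greatest mono) auto
  show upper: "g t \<le> f s" if "t < s" for s t
  proof -
    have "0 < s - t" using that by simp
    then obtain n where "inverse (real (Suc n)) < s - t" using reals_Archimedean by blast
    then have "f (t + 1 / real (Suc n)) \<le> f s" by (intro mono) (simp add: inverse_eq_divide)
    then show ?thesis unfolding g_def using cINF_lower[OF bdd[of t], of n] by simp
  qed
  have g0: "0 \<le> g t" and g1: "g t \<le> 1" for t
    using lower[of t] bnd(1)[of t] upper[of t "t + 1"] bnd(2)[of "t + 1"] by auto
  have g_mono: "g s \<le> g t" if "s \<le> t" for s t
    using upper[of s t] lower[of t] that by (cases "s = t") auto
  have cont: "continuous (at_right a) g" for a
    unfolding continuous_within
  proof (rule order_tendstoI)
    fix y assume "y < g a"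
    then show "\<forall>\<^sub>F x in at_right a. y < g x"
      by (intro eventually_at_right_less[THEN eventually_mono]) (rule less_le_trans[OF _ g_mono], auto)
  next
    fix y assume "g a < y"
    then obtain n where n: "f (a + 1 / real (Suc n)) < y"
      unfolding g_def using cINF_less_iff[OF _ bdd] by auto
    have "g x < y" if "a < x" "x < a + 1 / real (Suc n)" for x
      using upper[OF that(2)] n by simp
    then show "\<forall>\<^sub>F x in at_right a. g x < y"
      unfolding eventually_at_right_field by (intro exI[of _ "a + 1 / real (Suc n)"]) auto
  qed
  have arch: "\<exists>m. 1 / real (Suc m) < y" if "0 < y" for y :: real
    using reals_Archimedean[OF that] by (simp add: inverse_eq_divide)
  have bot: "(g \<longlongrightarrow> 0) at_bot"
  proof (rule order_tendstoI)
    fix y :: real assume "0 < y"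
    then obtain n :: nat where n: "f (- real n) < y"
      using arch good unfolding proper_tails_def by (meson less_trans)
    have "g x < y" if "x < - real n" for x
      using upper[OF that] n by simp
    then show "\<forall>\<^sub>F x in at_bot. g x < y" unfolding eventually_at_bot_dense by blast
  next
    fix y :: real assume "y < 0"
    then show "\<forall>\<^sub>F x in at_bot. y < g x" by (intro always_eventually allI less_le_trans[OF _ g0])
  qed
  have top: "(g \<longlongrightarrow> 1) at_top"
  proof (rule order_tendstoI)
    fix y :: real assume "y < 1"
    then obtain m where m: "1 / real (Suc m) < 1 - y" using arch[of "1 - y"] by auto
    obtain n :: nat where "1 - f (real n) < 1 / real (Suc m)"
      using good unfolding proper_tails_def by blast
    with m have n: "y < f (real n)" by linarith
    have "y < g x" if "real n < x" for x
      using lower[of "real n"] g_mono[of "real n" x] n that by simp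
    then show "\<forall>\<^sub>F x in at_top. y < g x" unfolding eventually_at_top_dense by blast
  next
    fix y :: real assume "1 < y"
    then show "\<forall>\<^sub>F x in at_top. g x < y" by (intro always_eventually allI le_less_trans[OF g1])
  qed
  show "real_distribution (interval_measure g)"
    by (rule real_distribution_interval_measure[OF g_mono cont bot top])
  show "cdf (interval_measure g) = g"
    by (rule cdf_interval_measure[OF g_mono cont bot])
qed

lemma kernel_measurableI:
  assumes "\<And>x. real_distribution (K x)" "\<And>t. (\<lambda>x. cdf (K x) t) \<in> borel_measurable M"
  shows "K \<in> M \<rightarrow>\<^sub>M prob_algebra borel"
proof (rule measurable_prob_algebra_generated)
  show "sets (borel :: real measure) = sigma_sets UNIV (range atMost)"
    by (subst borel_eq_atMost) simp
  show "Int_stable (range atMost :: real set set)" by (auto simp: Int_stable_def)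
  fix A :: "real set" assume "A \<in> range atMost"
  then obtain t where A: "A = {..t}" by auto
  have "emeasure (K x) A = ennreal (cdf (K x) t)" for x
  proof -
    interpret real_distribution "K x" by fact
    show ?thesis by (simp add: A cdf_def emeasure_eq_measure)
  qed
  then show "(\<lambda>x. emeasure (K x) A) \<in> borel_measurable M"
    using assms(2) by simp
next
  fix x interpret real_distribution "K x" by fact
  show "prob_space (K x)" "sets (K x) = sets borel" by (auto intro: prob_space_axioms)
qed auto

text \<open>Only a sandwich is claimed, since passing to right limits changes \<open>F\<close> at
  jumps whose position may depend on \<open>x\<close>.\<close>

lemma kernel_of_cdf:
  fixes F :: "real \<times> real \<Rightarrow> real"
  assumes [measurable]: "F \<in> borel_measurable plane"
    and bnd: "\<And>z. 0 \<le> F z" "\<And>z. F z \<le> 1" and mono: "\<And>x s t. s \<le> t \<Longrightarrow> F (x, s) \<le> F (x, t)"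
    and good: "AE x in M. proper_tails (\<lambda>t. F (x, t))"
  obtains K where "K \<in> borel \<rightarrow>\<^sub>M prob_algebra borel"
    "AE x in M. \<forall>t. F (x, t) \<le> cdf (K x) t \<and> (\<forall>s>t. cdf (K x) t \<le> F (x, s))"
proof -
  define G where "G x = (\<lambda>t. INF n. F (x, t + 1 / real (Suc n)))" for x
  \<comment> \<open>On the exceptional null set some probability measure must stand in, for
    \<open>K\<close> to be a kernel at every point; the point mass at 0 serves.\<close>
  define K where "K x = (if proper_tails (\<lambda>t. F (x, t)) then interval_measure (G x) else return borel 0)" for x
  have R: "F (x, t) \<le> G x t" "t < s \<Longrightarrow> G x t \<le> F (x, s)"
    "real_distribution (interval_measure (G x))" "cdf (interval_measure (G x)) = G x"
    if "proper_tails (\<lambda>t. F (x, t))" for x s t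
  proof -
    note R' = right_limit_distribution[of "\<lambda>t. F (x, t)", OF bnd mono that]
    show "F (x, t) \<le> G x t" unfolding G_def by (rule R'(1))
    show "G x t \<le> F (x, s)" if "t < s" unfolding G_def by (rule R'(2)[OF _ that])
    show "real_distribution (interval_measure (G x))" unfolding G_def by (rule R'(3))
    show "cdf (interval_measure (G x)) = G x" unfolding G_def by (rule R'(4))
  qed
  have [measurable]: "Measurable.pred borel (\<lambda>x. proper_tails (\<lambda>t. F (x, t)))"
    unfolding proper_tails_def by measurable
  have [measurable]: "(\<lambda>x. G x t) \<in> borel_measurable borel" for t
    unfolding G_def using bnd by (intro borel_measurable_cINF) (auto intro!: bdd_belowI[of _ 0])
  have dist: "real_distribution (K x)" for x
  proof (cases "proper_tails (\<lambda>t. F (x, t))")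
    case True
    then show ?thesis using R(3) by (simp add: K_def)
  next
    case False
    have "prob_space (return borel (0::real))" by (rule prob_space_return) simp
    then show ?thesis using False
      by (auto simp: K_def real_distribution_def real_distribution_axioms_def)
  qed
  have "(\<lambda>x. cdf (K x) t) \<in> borel_measurable borel" for t
  proof -
    have "cdf (K x) t = (if proper_tails (\<lambda>t. F (x, t)) then G x t else step 0 t)" for x
      using fun_cong[OF R(4)[of x], of t] by (auto simp: K_def cdf_def measure_return step_def)
    then show ?thesis by simp
  qed
  then have "K \<in> borel \<rightarrow>\<^sub>M prob_algebra borel" by (intro kernel_measurableI dist)
  moreover have "AE x in M. \<forall>t. F (x, t) \<le> cdf (K x) t \<and> (\<forall>s>t. cdf (K x) t \<le> F (x, s))"
    using good
  proof eventually_elim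
    case (elim x)
    have "K x = interval_measure (G x)" unfolding K_def by (rule if_P[OF elim])
    then have "cdf (K x) = G x" by (rule ssubst) (rule R(4)[OF elim])
    then show ?case by (rule ssubst) (intro allI conjI impI R(1,2)[OF elim])
  qed
  ultimately show ?thesis by (rule that[of K])
qed

lemma kernel_real_distribution:
  assumes "K \<in> borel \<rightarrow>\<^sub>M prob_algebra (borel :: real measure)" shows "real_distribution (K (x::real))"
  using measurable_space[OF assms, of x]
  by (auto simp: space_prob_algebra real_distribution_def real_distribution_axioms_def)

lemma sets_borel_pair: "sets plane = sets (borel :: (real \<times> real) measure)"
  by (rule arg_cong[OF borel_prod])

section \<open>Joint laws of kernels\<close>

definition joint :: "real measure \<Rightarrow> (real \<Rightarrow> real measure) \<Rightarrow> (real \<times> real) measure" where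
  "joint M K = M \<bind> (\<lambda>x. distr (K x) plane (Pair x))"

context
  fixes M :: "real measure" and K :: "real \<Rightarrow> real measure"
  assumes M: "prob_space M" "sets M = sets borel" and K [measurable]: "K \<in> borel \<rightarrow>\<^sub>M prob_algebra borel"
begin

lemma joint_kernel: "(\<lambda>x. distr (K x) plane (Pair x)) \<in> borel \<rightarrow>\<^sub>M prob_algebra plane"
  by measurable

lemma M_prob_algebra: "M \<in> space (prob_algebra borel)"
  using M by (simp add: space_prob_algebra)

lemma sets_joint: "sets (joint M K) = sets borel"
  unfolding joint_def using sets_bind'[OF M_prob_algebra joint_kernel] sets_borel_pair by (rule trans)

lemma prob_space_joint: "prob_space (joint M K)"
  unfolding joint_def by (rule prob_space_bind'[OF M_prob_algebra joint_kernel])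

lemma emeasure_joint:
  assumes "C \<in> sets borel"
  shows "emeasure (joint M K) C = (\<integral>\<^sup>+x. emeasure (K x) {y. (x, y) \<in> C} \<partial>M)"
proof -
  have C: "C \<in> sets plane" using assms unfolding sets_borel_pair .
  have "emeasure (joint M K) C = (\<integral>\<^sup>+x. emeasure (distr (K x) plane (Pair x)) C \<partial>M)"
    unfolding joint_def by (rule emeasure_bind_prob_algebra[OF M_prob_algebra joint_kernel C])
  also have "\<dots> = (\<integral>\<^sup>+x. emeasure (K x) {y. (x, y) \<in> C} \<partial>M)"
  proof (rule nn_integral_cong)
    fix x
    interpret real_distribution "K x" by (rule kernel_real_distribution[OF K])
    have "Pair x \<in> K x \<rightarrow>\<^sub>M plane" by simp
    then show "emeasure (distr (K x) plane (Pair x)) C = emeasure (K x) {y. (x, y) \<in> C}"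
      using C by (simp add: emeasure_distr vimage_def)
  qed
  finally show ?thesis .
qed

lemma marginal1_joint: "marginal1 (joint M K) = M"
proof (rule measure_eqI)
  show "sets (marginal1 (joint M K)) = sets M" by (simp add: marginal1_def M)
  fix A assume "A \<in> sets (marginal1 (joint M K))"
  then have A: "A \<in> sets borel" by (simp add: marginal1_def)
  have f: "fst \<in> joint M K \<rightarrow>\<^sub>M borel"
    unfolding measurable_cong_sets[OF trans[OF sets_joint sets_borel_pair[symmetric]] refl] by simp
  have sp: "space (joint M K) = UNIV" using sets_eq_imp_space_eq[OF sets_joint] by simp
  have "A \<times> (UNIV :: real set) \<in> sets borel" using A unfolding sets_borel_pair[symmetric] by simp
  moreover have "fst -` A = A \<times> (UNIV :: real set)" by auto
  ultimately have "emeasure (marginal1 (joint M K)) A = (\<integral>\<^sup>+x. emeasure (K x) {y. (x, y) \<in> A \<times> UNIV} \<partial>M)"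
    unfolding marginal1_def emeasure_distr[OF f A] sp using emeasure_joint[of "A \<times> UNIV"] by simp
  also have "\<dots> = (\<integral>\<^sup>+x. indicator A x \<partial>M)"
  proof (rule nn_integral_cong)
    fix x
    interpret real_distribution "K x" by (rule kernel_real_distribution[OF K])
    show "emeasure (K x) {y. (x, y) \<in> A \<times> UNIV} = indicator A x"
      using emeasure_space_1 by (auto simp: indicator_def)
  qed
  also have "\<dots> = emeasure M A" using A M(2) by simp
  finally show "emeasure (marginal1 (joint M K)) A = emeasure M A" .
qed

lemma is_disintegration_joint: "is_disintegration (joint M K) K"
  unfolding is_disintegration_def marginal1_joint using K emeasure_joint by auto

end

section \<open>Couplings and the uniqueness of disintegrations\<close>

lemma marginals:
  assumes "\<pi> \<in> couplings \<mu> \<nu>"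
  shows "prob_space \<pi>" "sets \<pi> = sets borel" "space \<pi> = UNIV" "marginal1 \<pi> = \<mu>"
    "prob_space \<mu>" "sets \<mu> = sets borel" "prob_space \<nu>" "sets \<nu> = sets borel"
    "A \<in> sets borel \<Longrightarrow> emeasure \<mu> A = emeasure \<pi> (A \<times> UNIV)"
    "A \<in> sets borel \<Longrightarrow> emeasure \<nu> A = emeasure \<pi> (UNIV \<times> A)"
proof -
  have \<pi>: "prob_space \<pi>" "sets \<pi> = sets borel" and m: "marginal1 \<pi> = \<mu>" "marginal2 \<pi> = \<nu>"
    using assms by (auto simp: couplings_def Prob_def)
  show "prob_space \<pi>" "sets \<pi> = sets borel" "marginal1 \<pi> = \<mu>" by fact+
  show sp: "space \<pi> = UNIV" using sets_eq_imp_space_eq[OF \<pi>(2)] by simp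
  have f: "fst \<in> \<pi> \<rightarrow>\<^sub>M borel" "snd \<in> \<pi> \<rightarrow>\<^sub>M borel"
    unfolding measurable_cong_sets[OF trans[OF \<pi>(2) sets_borel_pair[symmetric]] refl] by simp_all
  show "prob_space \<mu>" "prob_space \<nu>"
    using prob_space.prob_space_distr[OF \<pi>(1) f(1)] prob_space.prob_space_distr[OF \<pi>(1) f(2)] m
    by (simp_all add: marginal1_def marginal2_def)
  show "sets \<mu> = sets borel" "sets \<nu> = sets borel"
    using m by (auto simp: marginal1_def marginal2_def)
  have "fst -` A = A \<times> (UNIV :: real set)" "snd -` A = (UNIV :: real set) \<times> A" for A :: "real set" by auto
  then show "emeasure \<mu> A = emeasure \<pi> (A \<times> UNIV)" "emeasure \<nu> A = emeasure \<pi> (UNIV \<times> A)" if "A \<in> sets borel"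
    using emeasure_distr[OF f(1) that] emeasure_distr[OF f(2) that] m sp
    by (simp_all add: marginal1_def marginal2_def)
qed

lemma Times_borel: "A \<in> sets borel \<Longrightarrow> B \<in> sets borel \<Longrightarrow> A \<times> B \<in> sets (borel :: (real \<times> real) measure)"
  unfolding sets_borel_pair[symmetric] by simp

lemma measure_eq_on_strips:
  assumes M: "prob_space M" "sets M = sets borel" and M': "prob_space M'" "sets M' = sets borel"
    and eq: "\<And>A t. A \<in> sets borel \<Longrightarrow> emeasure M (A \<times> {..t}) = emeasure M' (A \<times> {..t::real})"
  shows "M = (M' :: (real \<times> real) measure)"
proof (rule measure_eqI_generator_eq[where E = "{A \<times> {..t} | A t. A \<in> sets borel}" and \<Omega> = UNIV and A = "\<lambda>n. UNIV \<times> {..real n}"])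
  let ?E = "{A \<times> {..t} | (A :: real set) (t :: real). A \<in> sets borel}"
  have "sets plane
      = sets (sigma (space (borel :: real measure) \<times> space (borel :: real measure))
          {a \<times> b | a b. a \<in> sets borel \<and> b \<in> range atMost})"
  proof (rule sets_pair_eq[where Ca = "{UNIV}" and Cb = "range (\<lambda>n. {..real n})"])
    show "sets (borel :: real measure) = sigma_sets (space borel) (sets borel)"
      by (rule sets.sigma_sets_eq[symmetric])
    show "sets (borel :: real measure) = sigma_sets (space borel) (range atMost)"
      by (subst borel_eq_atMost) simp
    show "\<Union> (range (\<lambda>n. {..real n})) = space borel"
      by (auto simp: real_arch_simple)
  qed auto
  also have "\<dots> = sigma_sets UNIV {a \<times> b | a b. a \<in> sets borel \<and> b \<in> range atMost}"
    by (subst sets_measure_of) auto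
  also have "{a \<times> b | a b. a \<in> sets borel \<and> b \<in> range atMost} = ?E" by auto
  finally have g: "sets (borel :: (real \<times> real) measure) = sigma_sets UNIV ?E" unfolding sets_borel_pair by simp
  show "sets M = sigma_sets UNIV ?E" "sets M' = sigma_sets UNIV ?E" using g M M' by auto
  show "Int_stable ?E"
  proof (rule Int_stableI)
    fix a b assume "a \<in> ?E" "b \<in> ?E"
    then obtain A t B s where ab: "a = A \<times> {..t}" "b = B \<times> {..s}" "A \<in> sets borel" "B \<in> sets borel" by auto
    then have "a \<inter> b = (A \<inter> B) \<times> {..min t s}" by auto
    then show "a \<inter> b \<in> ?E" using ab by blast
  qed
  show "emeasure M X = emeasure M' X" if "X \<in> ?E" for X
  proof -
    obtain A t where "X = A \<times> {..t}" "A \<in> sets borel" using \<open>X \<in> ?E\<close> by blast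
    then show ?thesis using eq by simp
  qed
  show "emeasure M (UNIV \<times> {..real n}) \<noteq> \<infinity>" for n
    using finite_measure.emeasure_finite[OF prob_space.axioms(1)[OF M(1)]] by simp
  show "(\<Union>n. UNIV \<times> {..real n}) = UNIV" by (auto simp: real_arch_simple)
  show "range (\<lambda>n. UNIV \<times> {..real n}) \<subseteq> ?E" by auto
  show "?E \<subseteq> Pow UNIV" by simp
qed

lemma le_cdf_right:
  assumes "finite_borel_measure M" and le: "\<And>x. a < x \<Longrightarrow> c \<le> cdf M x"
  shows "c \<le> cdf M a"
proof (rule tendsto_lowerbound)
  show "(cdf M \<longlongrightarrow> cdf M a) (at_right a)"
    using finite_borel_measure.cdf_is_right_cont[OF assms(1)] by (simp add: continuous_within)
  show "\<forall>\<^sub>F x in at_right a. c \<le> cdf M x"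
    by (rule eventually_at_right_less[THEN eventually_mono]) (rule le)
qed simp

lemma cdf_le_of_rat:
  assumes M': "finite_borel_measure M'" and le: "\<And>q. a < real_of_rat q \<Longrightarrow> cdf M a \<le> cdf M' (real_of_rat q)"
  shows "cdf M a \<le> cdf M' a"
proof (rule le_cdf_right[OF M'])
  fix x assume "a < x"
  then obtain q where q: "a < real_of_rat q" "real_of_rat q < x" using of_rat_dense by blast
  then show "cdf M a \<le> cdf M' x"
    using finite_borel_measure.cdf_nondecreasing[OF M', of "real_of_rat q" x] le[of q] by simp
qed

lemma cdf_le_of_AE:
  assumes M: "finite_borel_measure M" and M': "finite_borel_measure M'" and ae: "AE t in lborel. cdf M t \<le> cdf M' t"
  shows "cdf M a \<le> cdf M' a"
proof (rule le_cdf_right[OF M'])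
  fix x assume "a < x"
  then obtain t where "a < t" "t < x" "cdf M t \<le> cdf M' t" using AE_lborel_ex_between[OF ae] by blast
  then show "cdf M a \<le> cdf M' x"
    using finite_borel_measure.cdf_nondecreasing[OF M, of a t] finite_borel_measure.cdf_nondecreasing[OF M', of t x] by simp
qed

text \<open>Densities with respect to \<mu> are unique, so the kernels agree on each rational
  half-line off one common null set. Right continuity carries the equality to all levels.\<close>

lemma disintegration_unique:
  assumes \<pi>: "\<pi> \<in> couplings \<mu> \<nu>" and K: "is_disintegration \<pi> K" and L: "is_disintegration \<pi> L"
  shows "AE x in \<mu>. K x = L x"
proof -
  note m = marginals[OF \<pi>]
  interpret prob_space \<mu> by fact
  have KL: "K \<in> borel \<rightarrow>\<^sub>M prob_algebra borel" "L \<in> borel \<rightarrow>\<^sub>M prob_algebra borel"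
    using K L by (auto simp: is_disintegration_def)
  have mK: "(\<lambda>x. emeasure (J x) {..t}) \<in> borel_measurable \<mu>" if "J \<in> borel \<rightarrow>\<^sub>M prob_algebra borel" for J and t :: real
    unfolding measurable_cong_sets[OF m(6) refl]
    by (rule measurable_compose[OF measurable_prob_algebraD[OF that] measurable_emeasure_subprob_algebra]) simp
  have int: "(\<integral>\<^sup>+x. emeasure (J x) {..t} * indicator A x \<partial>\<mu>) = emeasure \<pi> (A \<times> {..t})"
    if "is_disintegration \<pi> J" "A \<in> sets borel" for J A t
  proof -
    have "emeasure \<pi> (A \<times> {..t}) = (\<integral>\<^sup>+x. emeasure (J x) {y. (x, y) \<in> A \<times> {..t}} \<partial>\<mu>)"
      using that Times_borel[OF that(2), of "{..t}"] m(4) by (auto simp: is_disintegration_def)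
    also have "\<dots> = (\<integral>\<^sup>+x. emeasure (J x) {..t} * indicator A x \<partial>\<mu>)"
      by (intro nn_integral_cong) (auto simp: indicator_def atMost_def)
    finally show ?thesis ..
  qed
  have "AE x in \<mu>. emeasure (K x) {..t} = emeasure (L x) {..t}" for t
    by (rule density_unique_finite_measure) (use mK[OF KL(1)] mK[OF KL(2)] int[OF K] int[OF L] m(6) in auto)
  then have "AE x in \<mu>. \<forall>q::rat. emeasure (K x) {..real_of_rat q} = emeasure (L x) {..real_of_rat q}"
    by (simp add: AE_all_countable)
  then show ?thesis
  proof eventually_elim
    case (elim x)
    interpret K: real_distribution "K x" by (rule kernel_real_distribution[OF KL(1)])
    interpret L: real_distribution "L x" by (rule kernel_real_distribution[OF KL(2)])
    have rat: "cdf (K x) (real_of_rat q) = cdf (L x) (real_of_rat q)" for q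
      using elim by (simp add: cdf_def K.emeasure_eq_measure L.emeasure_eq_measure)
    have "cdf (K x) a \<le> cdf (L x) a" for a
      by (rule cdf_le_of_rat[OF L.finite_borel_measure_M]) (simp add: K.cdf_nondecreasing rat[symmetric])
    moreover have "cdf (L x) a \<le> cdf (K x) a" for a
      by (rule cdf_le_of_rat[OF K.finite_borel_measure_M]) (simp add: L.cdf_nondecreasing rat)
    ultimately have "cdf (K x) = cdf (L x)" by (intro ext antisym)
    then show "K x = L x"
      by (intro cdf_unique K.real_distribution_axioms L.real_distribution_axioms)
  qed
qed

section \<open>Existence of disintegrations\<close>

definition slice :: "(real \<times> real) measure \<Rightarrow> (real \<times> real) set \<Rightarrow> (real \<times> real \<Rightarrow> real) \<Rightarrow> real measure" where
  "slice M C f = distr (density M (indicator C)) borel f"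

lemma emeasure_slice:
  assumes M: "sets M = sets borel" and f: "f \<in> borel_measurable borel" and C: "C \<in> sets borel" and A: "A \<in> sets borel"
  shows "emeasure (slice M C f) A = emeasure M (C \<inter> f -` A)"
proof -
  have sp: "space M = UNIV" using sets_eq_imp_space_eq[OF M] by simp
  have f': "f \<in> borel_measurable (density M (indicator C))"
    using f M by (simp cong: measurable_cong_sets)
  have "f -` A \<in> sets M" using measurable_sets[OF f A] M by simp
  then show ?thesis
    unfolding slice_def emeasure_distr[OF f' A] using C M sp by (simp add: emeasure_restricted)
qed

lemma finite_borel_measure_slice:
  assumes "prob_space M" "sets M = sets borel" "f \<in> borel_measurable borel" "C \<in> sets borel"
  shows "finite_borel_measure (slice M C f)"
proof -
  interpret prob_space M by fact
  have "emeasure (slice M C f) (space (slice M C f)) \<noteq> \<infinity>"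
    using emeasure_slice[OF assms(2,3,4), of UNIV] by (simp add: slice_def)
  then have "finite_measure (slice M C f)" by (rule finite_measureI)
  then show ?thesis by (auto simp: finite_borel_measure_def finite_borel_measure_axioms_def slice_def)
qed

lemma measurable_fst_snd_plane: "(fst :: real \<times> real \<Rightarrow> real) \<in> borel_measurable borel" "(snd :: real \<times> real \<Rightarrow> real) \<in> borel_measurable borel"
  unfolding measurable_cong_sets[OF sets_borel_pair[symmetric] refl] by simp_all

text \<open>For rational q the density with respect to \<mu> of the measure sending A to the
  \<pi>-mass of A times (-oo, q] is the conditional distribution function at q. Off a null set these
  densities are monotone in q and at most 1; the kernel built from them reproduces \<pi> on
  strips.\<close>

lemma disintegration_exists:
  assumes \<pi>: "\<pi> \<in> couplings \<mu> \<nu>"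
  obtains K where "is_disintegration \<pi> K"
proof -
  note m = marginals[OF \<pi>]
  note [measurable_cong] = m(6)
  interpret M: prob_space \<mu> by fact
  interpret pi: prob_space \<pi> by fact
  have \<nu>: "real_distribution \<nu>"
    using m(7,8) by (auto simp: real_distribution_def real_distribution_axioms_def)
  note \<nu>f = real_distribution.finite_borel_measure_M[OF \<nu>]
  have strip: "UNIV \<times> S \<inter> fst -` A = A \<times> S" for A S :: "real set" by auto
  have "\<exists>g\<in>borel_measurable borel. \<forall>A\<in>sets borel. (\<integral>\<^sup>+x. g x * indicator A x \<partial>\<mu>) = emeasure \<pi> (A \<times> S)"
    if S: "S \<in> sets borel" for S
  proof -
    let ?s = "slice \<pi> (UNIV \<times> S) fst"
    have e: "emeasure ?s A = emeasure \<pi> (A \<times> S)" if "A \<in> sets borel" for A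
      using emeasure_slice[OF m(2) measurable_fst_snd_plane(1) Times_borel[OF _ S] that, of UNIV] by (simp add: strip)
    have "absolutely_continuous \<mu> ?s"
      unfolding absolutely_continuous_def
    proof
      fix A assume "A \<in> null_sets \<mu>"
      then have A: "A \<in> sets borel" "emeasure \<mu> A = 0" using m(6) by auto
      have "emeasure \<pi> (A \<times> S) \<le> emeasure \<pi> (A \<times> UNIV)"
        using A m(2) Times_borel[OF A(1), of UNIV] by (intro emeasure_mono) auto
      then have "emeasure ?s A = 0" using A m(9) e by simp
      then show "A \<in> null_sets ?s" using A by (auto simp: slice_def)
    qed
    then have d: "density \<mu> (RN_deriv \<mu> ?s) = ?s"
      by (rule M.density_RN_deriv) (simp add: slice_def m(6))
    have g: "RN_deriv \<mu> ?s \<in> borel_measurable borel"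
      using borel_measurable_RN_deriv[of \<mu> ?s] by (simp cong: measurable_cong_sets)
    have "(\<integral>\<^sup>+x. RN_deriv \<mu> ?s x * indicator A x \<partial>\<mu>) = emeasure \<pi> (A \<times> S)" if "A \<in> sets borel" for A
    proof -
      have "emeasure (density \<mu> (RN_deriv \<mu> ?s)) A = (\<integral>\<^sup>+x. RN_deriv \<mu> ?s x * indicator A x \<partial>\<mu>)"
        using that m(6) by (intro emeasure_density) auto
      then show ?thesis unfolding d using e[OF that] by simp
    qed
    with g show ?thesis by blast
  qed
  then obtain g where g [measurable]: "\<And>S. S \<in> sets borel \<Longrightarrow> g S \<in> borel_measurable borel"
    and g_int: "\<And>S A. S \<in> sets borel \<Longrightarrow> A \<in> sets borel \<Longrightarrow> (\<integral>\<^sup>+x. g S x * indicator A x \<partial>\<mu>) = emeasure \<pi> (A \<times> S)"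
    by metis
  have add: "AE x in \<mu>. g (S \<union> T) x = g S x + g T x" if S: "S \<in> sets borel" and T: "T \<in> sets borel" and ST: "S \<inter> T = {}" for S T
  proof (rule M.density_unique_finite_measure)
    fix A assume "A \<in> sets \<mu>"
    then have A: "A \<in> sets borel" using m(6) by simp
    have "emeasure \<pi> (A \<times> (S \<union> T)) = emeasure \<pi> (A \<times> S \<union> A \<times> T)" by (simp add: Sigma_Un_distrib2)
    also have "\<dots> = emeasure \<pi> (A \<times> S) + emeasure \<pi> (A \<times> T)"
      using Times_borel[OF A S] Times_borel[OF A T] m(2) ST by (intro plus_emeasure[symmetric]) auto
    finally show "(\<integral>\<^sup>+x. g (S \<union> T) x * indicator A x \<partial>\<mu>) = (\<integral>\<^sup>+x. (g S x + g T x) * indicator A x \<partial>\<mu>)"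
      using S T A g[OF S] g[OF T] by (simp add: g_int distrib_right nn_integral_add)
  qed (use g[OF S] g[OF T] g[of "S \<union> T"] S T in auto)
  have one: "AE x in \<mu>. g UNIV x = 1"
    by (rule M.density_unique_finite_measure) (use g[of UNIV] m(6,9) in \<open>auto simp: g_int\<close>)
  have mono: "AE x in \<mu>. g S x \<le> g T x" if "S \<in> sets borel" "T \<in> sets borel" "S \<subseteq> T" for S T
  proof -
    have "S \<union> (T - S) = T" using that by auto
    then have "AE x in \<mu>. g T x = g S x + g (T - S) x" using add[of S "T - S"] that by auto
    then show ?thesis by eventually_elim simp
  qed
  \<comment> \<open>Truncation at 1 makes the bounds hold at every \<open>x\<close>; almost
    everywhere it changes nothing.\<close>
  define r where "r q x = enn2real (min 1 (g {..real_of_rat q} x))" for q x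
  have r_bnd: "0 \<le> r q x" "r q x \<le> 1" for q x
    by (auto simp: r_def enn2real_leI)
  have [measurable]: "r q \<in> borel_measurable borel" for q unfolding r_def by measurable
  \<comment> \<open>A countable supremum over earlier rationals is monotone in the level and jointly
    measurable everywhere, and for almost every \<open>x\<close> it returns the densities at
    rational levels.\<close>
  define F where "F z = (SUP q. if real_of_rat q \<le> snd z then r q (fst z) else 0)" for z
  have bdd: "bdd_above (range (\<lambda>q. if real_of_rat q \<le> t then r q x else 0))" for t x
    using r_bnd by (auto intro!: bdd_aboveI[of _ 1])
  have F_meas [measurable]: "F \<in> borel_measurable plane"
    unfolding F_def by (rule borel_measurable_cSUP) (use bdd in \<open>auto\<close>)
  have F0: "0 \<le> F z" for z
  proof -
    have "0 \<le> (if real_of_rat 0 \<le> snd z then r 0 (fst z) else 0)" using r_bnd by simp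
    also have "\<dots> \<le> F z" unfolding F_def by (rule cSUP_upper[OF _ bdd]) simp
    finally show ?thesis .
  qed
  have F1: "F z \<le> 1" for z unfolding F_def using r_bnd by (intro cSUP_least) auto
  have F_mono: "F (x, s) \<le> F (x, t)" if "s \<le> t" for x s t
    unfolding F_def using that r_bnd bdd[of t x]
    by (intro cSUP_mono) (auto intro: order_trans)
  have "AE x in \<mu>. g {..real_of_rat q} x \<le> 1" for q
    using mono[of "{..real_of_rat q}" UNIV] one by (auto elim: eventually_elim2)
  then have le1: "AE x in \<mu>. \<forall>q. g {..real_of_rat q} x \<le> 1" by (simp add: AE_all_countable)
  have "AE x in \<mu>. \<forall>q q'. q \<le> q' \<longrightarrow> g {..real_of_rat q} x \<le> g {..real_of_rat q'} x"
    unfolding AE_all_countable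
  proof (intro allI)
    fix q q' :: rat
    show "AE x in \<mu>. q \<le> q' \<longrightarrow> g {..real_of_rat q} x \<le> g {..real_of_rat q'} x"
      using mono[of "{..real_of_rat q}" "{..real_of_rat q'}"] by (cases "q \<le> q'") (auto simp: of_rat_less_eq)
  qed
  with le1 have F_rat: "AE x in \<mu>. \<forall>q. ennreal (F (x, real_of_rat q)) = g {..real_of_rat q} x"
  proof eventually_elim
    case (elim x)
    show ?case
    proof
      fix q
      have r_eq: "ennreal (r p x) = g {..real_of_rat p} x" for p
        using elim(1)[rule_format, of p] le_less_trans[OF elim(1)[rule_format, of p] ennreal_one_less_top]
        by (simp add: r_def min_absorb2)
      have "r p x \<le> r q x" if "p \<le> q" for p
        using elim(2) that r_bnd r_eq by (metis ennreal_le_iff)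
      then have "F (x, real_of_rat q) = r q x"
        unfolding F_def using r_bnd
        by (intro cSup_eq_maximum) (auto simp: of_rat_less_eq intro!: image_eqI[of _ _ q])
      then show "ennreal (F (x, real_of_rat q)) = g {..real_of_rat q} x" using r_eq by simp
    qed
  qed
  have F_int: "(\<integral>\<^sup>+x. ennreal (F (x, real_of_rat q)) * indicator A x \<partial>\<mu>) = emeasure \<pi> (A \<times> {..real_of_rat q})"
    if "A \<in> sets borel" for A q
  proof -
    have "(\<integral>\<^sup>+x. ennreal (F (x, real_of_rat q)) * indicator A x \<partial>\<mu>) = (\<integral>\<^sup>+x. g {..real_of_rat q} x * indicator A x \<partial>\<mu>)"
      using F_rat by (intro nn_integral_cong_AE) (auto elim!: eventually_mono)
    then show ?thesis using g_int that by simp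
  qed
  have F_cdf: "(\<integral>x. F (x, real_of_rat q) \<partial>\<mu>) = cdf \<nu> (real_of_rat q)" for q
  proof -
    have "(\<integral>x. F (x, real_of_rat q) \<partial>\<mu>) = enn2real (\<integral>\<^sup>+x. ennreal (F (x, real_of_rat q)) \<partial>\<mu>)"
      using F0 by (intro integral_eq_nn_integral) auto
    also have "(\<integral>\<^sup>+x. ennreal (F (x, real_of_rat q)) \<partial>\<mu>) = emeasure \<nu> {..real_of_rat q}"
      using F_int[of UNIV q] m(10) by simp
    finally show ?thesis by (simp add: cdf_def measure_def)
  qed
  have good: "AE x in \<mu>. proper_tails (\<lambda>t. F (x, t))"
  proof (rule AE_proper_tails[OF m(5,6) F_meas F0 F1 F_mono])
    show "(\<lambda>n. \<integral>x. F (x, - real n) \<partial>\<mu>) \<longlonglongrightarrow> 0"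
      using finite_borel_measure.cdf_lim_neg_infty[OF \<nu>f] F_cdf[of "- of_nat n" for n] by (simp add: of_rat_minus)
    show "(\<lambda>n. \<integral>x. F (x, real n) \<partial>\<mu>) \<longlonglongrightarrow> 1"
      using real_distribution.cdf_lim_infty_prob[OF \<nu>] F_cdf[of "of_nat n" for n] by simp
  qed
  obtain K where K: "K \<in> borel \<rightarrow>\<^sub>M prob_algebra borel"
    and sandwich: "AE x in \<mu>. \<forall>t. F (x, t) \<le> cdf (K x) t \<and> (\<forall>s>t. cdf (K x) t \<le> F (x, s))"
    using kernel_of_cdf[OF F_meas F0 F1 F_mono good] by blast
  let ?J = "joint \<mu> K"
  note J = prob_space_joint[OF m(5,6) K] sets_joint[OF m(5,6) K]
  have "?J = \<pi>"
  proof (rule measure_eq_on_strips[OF J m(1,2)])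
    fix A :: "real set" and t :: real assume A: "A \<in> sets borel"
    let ?S = "\<lambda>M. slice M (A \<times> UNIV) snd"
    have fb: "finite_borel_measure (?S ?J)" "finite_borel_measure (?S \<pi>)"
      using J m(1,2) A by (auto intro!: finite_borel_measure_slice measurable_fst_snd_plane Times_borel)
    have strip2: "A \<times> UNIV \<inter> snd -` {..t} = A \<times> {..t}" for t :: real by auto
    have S: "emeasure (?S ?J) {..t} = emeasure ?J (A \<times> {..t})" "emeasure (?S \<pi>) {..t} = emeasure \<pi> (A \<times> {..t})" for t
      using emeasure_slice[OF J(2) measurable_fst_snd_plane(2) Times_borel[OF A], of UNIV "{..t}"]
        emeasure_slice[OF m(2) measurable_fst_snd_plane(2) Times_borel[OF A], of UNIV "{..t}"] by (simp_all add: strip2)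
    have EJ: "emeasure ?J (A \<times> {..t}) = (\<integral>\<^sup>+x. ennreal (cdf (K x) t) * indicator A x \<partial>\<mu>)" for t
    proof -
      have "emeasure (K x) {y. (x, y) \<in> A \<times> {..t}} = ennreal (cdf (K x) t) * indicator A x" for x
      proof -
        interpret real_distribution "K x" by (rule kernel_real_distribution[OF K])
        show ?thesis by (auto simp: indicator_def cdf_def emeasure_eq_measure atMost_def)
      qed
      then show ?thesis using emeasure_joint[OF m(5,6) K Times_borel[OF A, of "{..t}"]] by simp
    qed
    have cdf_S: "cdf (?S M) t = enn2real (emeasure (?S M) {..t})" for M t
      by (simp add: cdf_def measure_def)
    have fin: "emeasure M X < top" if "prob_space M" for M :: "(real \<times> real) measure" and X
      using finite_measure.emeasure_finite[OF prob_space.axioms(1)[OF that]] by (simp add: less_top)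
    \<comment> \<open>The sandwich bounds the kernel at \<open>t\<close> only by \<open>F\<close> at
      later levels, so the slices are compared at rationals beyond \<open>t\<close>; right
      continuity closes the gap.\<close>
    have up: "cdf (?S ?J) t \<le> cdf (?S \<pi>) (real_of_rat q)" if "t < real_of_rat q" for t q
      unfolding cdf_S S EJ F_int[OF A, symmetric]
    proof (rule enn2real_mono)
      show "(\<integral>\<^sup>+x. ennreal (cdf (K x) t) * indicator A x \<partial>\<mu>) \<le> (\<integral>\<^sup>+x. ennreal (F (x, real_of_rat q)) * indicator A x \<partial>\<mu>)"
        using sandwich that by (intro nn_integral_mono_AE) (auto elim!: eventually_mono intro!: mult_right_mono ennreal_leI)
      show "(\<integral>\<^sup>+x. ennreal (F (x, real_of_rat q)) * indicator A x \<partial>\<mu>) < top"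
        unfolding F_int[OF A] using fin[OF m(1)] .
    qed
    have down: "cdf (?S \<pi>) (real_of_rat q) \<le> cdf (?S ?J) (real_of_rat q)" for q
      unfolding cdf_S S EJ F_int[OF A, symmetric]
    proof (rule enn2real_mono)
      show "(\<integral>\<^sup>+x. ennreal (F (x, real_of_rat q)) * indicator A x \<partial>\<mu>) \<le> (\<integral>\<^sup>+x. ennreal (cdf (K x) (real_of_rat q)) * indicator A x \<partial>\<mu>)"
        using sandwich by (intro nn_integral_mono_AE) (auto elim!: eventually_mono intro!: mult_right_mono ennreal_leI)
      show "(\<integral>\<^sup>+x. ennreal (cdf (K x) (real_of_rat q)) * indicator A x \<partial>\<mu>) < top"
        unfolding EJ[symmetric] using fin[OF J(1)] .
    qed
    have "cdf (?S ?J) t \<le> cdf (?S \<pi>) t"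
      by (rule cdf_le_of_rat[OF fb(2)]) (rule up)
    moreover have "cdf (?S \<pi>) t \<le> cdf (?S ?J) t"
      by (rule cdf_le_of_rat[OF fb(1)])
         (rule order_trans[OF finite_borel_measure.cdf_nondecreasing[OF fb(2)] down], simp)
    ultimately have "cdf (?S ?J) t = cdf (?S \<pi>) t" by simp
    then show "emeasure ?J (A \<times> {..t}) = emeasure \<pi> (A \<times> {..t})"
      unfolding cdf_S S using fin[OF J(1)] fin[OF m(1)] by (metis ennreal_enn2real)
  qed
  then show ?thesis using that is_disintegration_joint[OF m(5,6) K] by simp
qed

text \<open>Quantile coupling: \<open>M.I\<close> and \<open>M'.I\<close> are the quantile functions
  on (0, 1) under Lebesgue measure. For fixed \<open>t\<close> they lie on different sides of
  \<open>t\<close> only for u between the two values of the distribution functions, and Fubini turns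
  this into the area between the graphs.\<close>

lemma W1_le_cdf:
  assumes M: "real_distribution M" and M': "real_distribution M'"
  shows "W1 M M' \<le> (\<integral>\<^sup>+t. ennreal \<bar>cdf M t - cdf M' t\<bar> \<partial>lborel)"
proof -
  interpret M: cdf_distribution M unfolding cdf_distribution_def by fact
  interpret M': cdf_distribution M' unfolding cdf_distribution_def by fact
  let ?\<Omega> = "restrict_space lborel {0<..<1::real}"
  interpret \<Omega>: prob_space ?\<Omega>
    by (auto simp: space_restrict_space emeasure_restrict_space intro!: prob_spaceI)
  have sets_\<Omega>: "sets ?\<Omega> = sets (restrict_space borel {0<..<1})"
    by (rule sets_restrict_space_cong) simp
  have I [measurable]: "M.I \<in> borel_measurable ?\<Omega>" "M'.I \<in> borel_measurable ?\<Omega>"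
    using M.measurable_CI M'.measurable_CI unfolding measurable_cong_sets[OF sets_\<Omega> refl] by auto
  have p: "(\<lambda>u. (M.I u, M'.I u)) \<in> ?\<Omega> \<rightarrow>\<^sub>M borel"
    unfolding measurable_cong_sets[OF refl sets_borel_pair[symmetric]] by measurable
  define \<gamma> where "\<gamma> = distr ?\<Omega> borel (\<lambda>u. (M.I u, M'.I u))"
  have "\<gamma> \<in> couplings M M'"
    unfolding couplings_def Prob_def \<gamma>_def marginal1_def marginal2_def
    using \<Omega>.prob_space_distr[OF p] distr_distr[OF measurable_fst_snd_plane(1) p] distr_distr[OF measurable_fst_snd_plane(2) p]
      M.distr_I_eq_M M'.distr_I_eq_M by (simp add: comp_def)
  then have "W1 M M' \<le> (\<integral>\<^sup>+(x, y). ennreal \<bar>x - y\<bar> \<partial>\<gamma>)"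
    unfolding W1_def by (rule INF_lower)
  also have "\<dots> = (\<integral>\<^sup>+u. ennreal \<bar>M.I u - M'.I u\<bar> \<partial>?\<Omega>)"
  proof -
    have "(\<lambda>z. ennreal \<bar>fst z - snd z\<bar>) \<in> borel_measurable (borel :: (real \<times> real) measure)"
      using measurable_fst_snd_plane by measurable
    then show ?thesis unfolding \<gamma>_def by (subst nn_integral_distr[OF p]) (auto simp: split_beta')
  qed
  also have "\<dots> = (\<integral>\<^sup>+u. (\<integral>\<^sup>+t. ennreal \<bar>step (M.I u) t - step (M'.I u) t\<bar> \<partial>lborel) \<partial>?\<Omega>)"
    by (intro nn_integral_cong, subst nn_integral_eq_integral) (auto simp: integral_abs_step_diff)
  also have "\<dots> = (\<integral>\<^sup>+t. (\<integral>\<^sup>+u. ennreal \<bar>step (M.I u) t - step (M'.I u) t\<bar> \<partial>?\<Omega>) \<partial>lborel)"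
  proof -
    interpret pair_sigma_finite ?\<Omega> "lborel :: real measure" ..
    have "(\<lambda>(u, t). ennreal \<bar>step (M.I u) t - step (M'.I u) t\<bar>) \<in> borel_measurable (?\<Omega> \<Otimes>\<^sub>M lborel)"
      by measurable
    from Fubini'[OF this] show ?thesis by simp
  qed
  also have "\<dots> \<le> (\<integral>\<^sup>+t. ennreal \<bar>cdf M t - cdf M' t\<bar> \<partial>lborel)"
  proof (rule nn_integral_mono)
    fix t
    let ?a = "min (cdf M t) (cdf M' t)" and ?b = "max (cdf M t) (cdf M' t)"
    have eq: "\<bar>step (M.I u) t - step (M'.I u) t\<bar> \<le> indicat_real {?a..?b} u" if "u \<in> {0<..<1}" for u
      using M.pseudoinverse'[rule_format, OF that, of t] M'.pseudoinverse'[rule_format, OF that, of t]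
      by (auto simp: step_def indicator_def min_def max_def)
    have "(\<integral>\<^sup>+u. ennreal \<bar>step (M.I u) t - step (M'.I u) t\<bar> \<partial>?\<Omega>) \<le> (\<integral>\<^sup>+u. ennreal (indicat_real {?a..?b} u) \<partial>?\<Omega>)"
      using eq by (intro nn_integral_mono ennreal_leI) (auto simp: space_restrict_space)
    also have "\<dots> \<le> (\<integral>\<^sup>+u. indicator {?a..?b} u \<partial>lborel)"
      by (subst nn_integral_restrict_space, simp, intro nn_integral_mono) (auto simp: indicator_def)
    also have "\<dots> = ennreal \<bar>cdf M t - cdf M' t\<bar>"
      by (simp add: abs_if min_def max_def)
    finally show "(\<integral>\<^sup>+u. ennreal \<bar>step (M.I u) t - step (M'.I u) t\<bar> \<partial>?\<Omega>) \<le> ennreal \<bar>cdf M t - cdf M' t\<bar>" .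
  qed
  finally show ?thesis .
qed

section \<open>The nested distance\<close>

text \<open>The functions agree wherever \<open>f\<close> is continuous, and a monotone function has
  only countably many discontinuities.\<close>

lemma AE_eq_of_right_sandwich:
  fixes f g :: "real \<Rightarrow> real"
  assumes mono: "\<And>s t. s \<le> t \<Longrightarrow> f s \<le> f t" and le: "\<And>t. f t \<le> g t" and ge: "\<And>s t. t < s \<Longrightarrow> g t \<le> f s"
  shows "AE t in lborel. f t = g t"
proof -
  have "f t = g t" if "isCont f t" for t
  proof (rule antisym[OF le])
    have "(f \<longlongrightarrow> f t) (at_right t)"
      using that by (auto simp: isCont_def intro: tendsto_within_subset)
    then show "g t \<le> f t"
      by (rule tendsto_lowerbound) (auto intro!: eventually_at_right_less[THEN eventually_mono] ge)
  qed
  then have "{t. f t \<noteq> g t} \<subseteq> {t. \<not> isCont f t}" by auto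
  moreover have "countable {t. \<not> isCont f t}"
    by (rule mono_ctble_discont) (auto intro!: monoI mono)
  ultimately have "countable {t. f t \<noteq> g t}" by (rule countable_subset)
  then have "{t. f t \<noteq> g t} \<in> null_sets lborel" by (rule countable_imp_null_set_lborel)
  then show ?thesis by (rule AE_I') auto
qed

lemma integral_step_cdf:
  assumes M: "real_distribution M" and int: "integrable M (\<lambda>y. y)"
  shows "(\<integral>t. step x t - cdf M t \<partial>lborel) = (\<integral>y. y - x \<partial>M)"
proof -
  interpret real_distribution M by fact
  note i = integrable_cdf_diff[OF prob_space_axioms events_eq_borel int]
  have "(\<integral>t. step x t - cdf M t \<partial>lborel) = (\<integral>t. (step x t - step 0 t) - (cdf M t - step 0 t) \<partial>lborel)"
    by (intro Bochner_Integration.integral_cong) auto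
  also have "\<dots> = (0 - x) - (- expectation (\<lambda>y. y))"
    unfolding Bochner_Integration.integral_diff[OF integrable_step_diff i] integral_step_diff
      integral_cdf_diff[OF prob_space_axioms events_eq_borel int] ..
  finally have "(\<integral>t. step x t - cdf M t \<partial>lborel) = expectation (\<lambda>y. y) - x" by simp
  then show ?thesis using int prob_space by simp
qed

text \<open>Write the distribution function as an average of steps. The levels between 0 and y leave
  the window only if |y| >= R, and then their total length is |y|.\<close>

lemma integral_tail_cdf_le:
  assumes M: "real_distribution M" and int: "integrable M (\<lambda>y. y)" and R: "0 \<le> R"
    and tail: "(\<integral>\<^sup>+x\<in>{x. R \<le> \<bar>x\<bar>}. ennreal \<bar>x\<bar> \<partial>M) \<le> ennreal e" and e: "0 \<le> e"
  shows "(\<integral>t. indicator (- {-R<..<R}) t * \<bar>cdf M t - step 0 t\<bar> \<partial>lborel) \<le> e"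
proof -
  interpret real_distribution M by fact
  interpret pair_sigma_finite M lborel ..
  note ij = integrable_step_pair[OF prob_space_axioms events_eq_borel int]
  have i: "integrable (M \<Otimes>\<^sub>M lborel) (\<lambda>(y, t). indicator (- {-R<..<R}) t * \<bar>step y t - step 0 t\<bar>)"
    by (rule Bochner_Integration.integrable_bound[OF ij]) (auto intro!: AE_I2 simp: indicator_def)
  have r: "integrable M (\<lambda>y. indicator {x. R \<le> \<bar>x\<bar>} y * \<bar>y\<bar>)"
    by (rule Bochner_Integration.integrable_bound[OF int]) (auto simp: indicator_def)
  have il: "integrable lborel (\<lambda>t. indicator (- {-R<..<R}) t * \<bar>cdf M t - step 0 t\<bar>)"
    using integrable_mult_indicator[OF _ integrable_abs[OF integrable_cdf_diff[OF prob_space_axioms events_eq_borel int]], of "- {-R<..<R}"]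
    by simp
  have "(\<integral>t. indicator (- {-R<..<R}) t * \<bar>cdf M t - step 0 t\<bar> \<partial>lborel)
      \<le> (\<integral>t. (\<integral>y. indicator (- {-R<..<R}) t * \<bar>step y t - step 0 t\<bar> \<partial>M) \<partial>lborel)"
  proof (rule integral_mono[OF il integrable_snd[OF i]])
    fix t
    have "\<bar>cdf M t - step 0 t\<bar> \<le> (\<integral>y. \<bar>step y t - step 0 t\<bar> \<partial>M)"
      using integral_abs_bound[of M "\<lambda>y. step y t - step 0 t"]
        integral_step_diff_eq_cdf[OF prob_space_axioms events_eq_borel int, of t 0] by simp
    then show "indicator (- {-R<..<R}) t * \<bar>cdf M t - step 0 t\<bar>
        \<le> (\<integral>y. indicator (- {-R<..<R}) t * \<bar>step y t - step 0 t\<bar> \<partial>M)"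
      by (simp add: mult_left_mono)
  qed
  also have "\<dots> = (\<integral>y. (\<integral>t. indicator (- {-R<..<R}) t * \<bar>step y t - step 0 t\<bar> \<partial>lborel) \<partial>M)"
    using integral_fst[OF i] integral_snd[OF i] by simp
  also have "\<dots> \<le> (\<integral>y. indicator {x. R \<le> \<bar>x\<bar>} y * \<bar>y\<bar> \<partial>M)"
  proof (rule integral_mono[OF integrable_fst[OF i] r])
    fix y
    have 1: "integrable lborel (\<lambda>t. indicator (- {-R<..<R}) t * \<bar>step y t - step 0 t\<bar>)"
      using integrable_mult_indicator[of "- {-R<..<R}" lborel "\<lambda>t. \<bar>step y t - step 0 t\<bar>"] by simp
    have "(\<integral>t. indicator (- {-R<..<R}) t * \<bar>step y t - step 0 t\<bar> \<partial>lborel)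
        \<le> (\<integral>t. indicator {x. R \<le> \<bar>x\<bar>} y * \<bar>step y t - step 0 t\<bar> \<partial>lborel)"
      by (rule integral_mono[OF 1], intro integrable_mult_right integrable_abs integrable_step_diff)
         (auto simp: indicator_def step_def)
    then show "(\<integral>t. indicator (- {-R<..<R}) t * \<bar>step y t - step 0 t\<bar> \<partial>lborel) \<le> indicator {x. R \<le> \<bar>x\<bar>} y * \<bar>y\<bar>"
      by (simp add: integral_abs_step_diff)
  qed
  also have "\<dots> = enn2real (\<integral>\<^sup>+y. ennreal (indicator {x. R \<le> \<bar>x\<bar>} y * \<bar>y\<bar>) \<partial>M)"
    by (rule integral_eq_nn_integral) auto
  also have "(\<integral>\<^sup>+y. ennreal (indicator {x. R \<le> \<bar>x\<bar>} y * \<bar>y\<bar>) \<partial>M) = (\<integral>\<^sup>+x\<in>{x. R \<le> \<bar>x\<bar>}. ennreal \<bar>x\<bar> \<partial>M)"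
    by (intro nn_integral_cong) (auto simp: indicator_def)
  also have "enn2real \<dots> \<le> enn2real (ennreal e)"
    using tail by (intro enn2real_mono) auto
  finally show ?thesis using e by simp
qed

lemma ext_integral_eq: "integrable M f \<Longrightarrow> ext_integral M f = ereal (\<integral>x. f x \<partial>M)"
proof -
  assume i: "integrable M f"
  have fin: "(\<integral>\<^sup>+x. ennreal (f x) \<partial>M) \<noteq> \<infinity>" "(\<integral>\<^sup>+x. ennreal (- f x) \<partial>M) \<noteq> \<infinity>"
    using integrableD[OF i] by auto
  then have "enn2ereal (\<integral>\<^sup>+x. ennreal (f x) \<partial>M) = ereal (enn2real (\<integral>\<^sup>+x. ennreal (f x) \<partial>M))"
    "enn2ereal (\<integral>\<^sup>+x. ennreal (- f x) \<partial>M) = ereal (enn2real (\<integral>\<^sup>+x. ennreal (- f x) \<partial>M))"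
    by (simp_all add: enn2ereal_ennreal[symmetric] less_top)
  then show ?thesis by (simp add: ext_integral_def real_lebesgue_integral_def[OF i])
qed

lemma Prob_p_1D:
  assumes "\<mu> \<in> Prob_p (1::real)" shows "real_distribution (\<mu> :: real measure)" "integrable \<mu> (\<lambda>x. x)"
proof -
  have \<mu>: "sets \<mu> = sets borel" "prob_space \<mu>" "(\<integral>\<^sup>+x. ennreal (norm x powr 1) \<partial>\<mu>) < \<infinity>"
    using assms by (auto simp: Prob_p_def Prob_def)
  then show "real_distribution \<mu>" by (auto simp: real_distribution_def real_distribution_axioms_def)
  have "(\<lambda>x. x) \<in> borel_measurable \<mu>" using \<mu>(1) by (simp cong: measurable_cong_sets)
  then show "integrable \<mu> (\<lambda>x. x)" using \<mu>(3) by (simp add: integrable_iff_bounded)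
qed

lemma convex_order_integrals:
  assumes \<mu>: "real_distribution \<mu>" "integrable \<mu> (\<lambda>x. x)" and \<nu>: "real_distribution \<nu>" "integrable \<nu> (\<lambda>x. x)"
    and le: "\<mu> \<preceq>\<^sub>c \<nu>"
  shows "(\<integral>x. x \<partial>\<mu>) = (\<integral>x. x \<partial>\<nu>)" "(\<integral>x. max 0 (x - c) \<partial>\<mu>) \<le> (\<integral>x. max 0 (x - c) \<partial>\<nu>)"
proof -
  interpret m: real_distribution \<mu> by fact
  interpret n: real_distribution \<nu> by fact
  have *: "(\<integral>x. f x \<partial>\<mu>) \<le> (\<integral>x. f x \<partial>\<nu>)" if "convex_on UNIV f" "integrable \<mu> f" "integrable \<nu> f" for f
  proof -
    have "ext_integral \<mu> f \<le> ext_integral \<nu> f" using le that(1) unfolding convex_order_def by blast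
    then show ?thesis unfolding ext_integral_eq[OF that(2)] ext_integral_eq[OF that(3)] by simp
  qed
  have "convex_on UNIV (\<lambda>x::real. x)" "convex_on UNIV (\<lambda>x::real. - x)"
    by (auto simp: convex_on_def algebra_simps)
  then have "(\<integral>x. x \<partial>\<mu>) \<le> (\<integral>x. x \<partial>\<nu>)" "(\<integral>x. - x \<partial>\<mu>) \<le> (\<integral>x. - x \<partial>\<nu>)"
    using \<mu>(2) \<nu>(2) by (auto intro!: * simp del: integral_minus)
  then show "(\<integral>x. x \<partial>\<mu>) = (\<integral>x. x \<partial>\<nu>)" by simp
  have "convex_on UNIV (\<lambda>x. max 0 (x - c))"
    unfolding convex_on_def
  proof (intro conjI ballI allI impI convex_UNIV)
    fix x y u v :: real assume u: "0 \<le> u" "0 \<le> v" "u + v = 1"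
    have "u *\<^sub>R x + v *\<^sub>R y - c = u * (x - c) + v * (y - c) + (u + v - 1) * c" by (simp add: algebra_simps)
    also have "\<dots> \<le> u * max 0 (x - c) + v * max 0 (y - c)"
      using u by (auto intro!: add_mono mult_left_mono)
    finally show "max 0 (u *\<^sub>R x + v *\<^sub>R y - c) \<le> u * max 0 (x - c) + v * max 0 (y - c)"
      using u by auto
  qed
  then show "(\<integral>x. max 0 (x - c) \<partial>\<mu>) \<le> (\<integral>x. max 0 (x - c) \<partial>\<nu>)"
    using \<mu>(2) \<nu>(2) by (intro *) auto
qed

lemma kernel_problemI:
  assumes \<mu>: "real_distribution \<mu>" "integrable \<mu> (\<lambda>x. x)" and \<nu>: "real_distribution \<nu>" "integrable \<nu> (\<lambda>x. x)"
    and le: "\<mu> \<preceq>\<^sub>c \<nu>"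
  shows "kernel_problem \<mu> (cdf \<nu>)"
proof -
  interpret m: real_distribution \<mu> by fact
  interpret n: real_distribution \<nu> by fact
  note im = m.prob_space_axioms m.events_eq_borel \<mu>(2) and inu = n.prob_space_axioms n.events_eq_borel \<nu>(2)
  note i1 = integrable_cdf_diff[OF im] and i2 = integrable_cdf_diff[OF inu]
  show ?thesis
  proof
    have "(\<integral>t. (cdf \<mu> t - step 0 t) - (cdf \<nu> t - step 0 t) \<partial>lborel) = - (\<integral>x. x \<partial>\<mu>) + (\<integral>x. x \<partial>\<nu>)"
      unfolding Bochner_Integration.integral_diff[OF i1 i2] integral_cdf_diff[OF im] integral_cdf_diff[OF inu] by simp
    then show "(\<integral>t. cdf \<mu> t - cdf \<nu> t \<partial>lborel) = 0"
      using convex_order_integrals(1)[OF \<mu> \<nu> le] by simp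
    fix c
    have j: "integrable lborel (\<lambda>t. indicator {c..} t * (step 0 t - cdf M t))" if "integrable lborel (\<lambda>t. cdf M t - step 0 t)" for M
      by (rule Bochner_Integration.integrable_bound[OF that])
         (use borel_measurable_integrable[OF that] borel_measurable_uminus[OF borel_measurable_integrable[OF that]] in \<open>auto simp: indicator_def\<close>)
    have "(\<integral>t. indicator {c..} t * (cdf \<mu> t - cdf \<nu> t) \<partial>lborel)
        = (\<integral>t. indicator {c..} t * (step 0 t - cdf \<nu> t) - indicator {c..} t * (step 0 t - cdf \<mu> t) \<partial>lborel)"
      by (intro Bochner_Integration.integral_cong) (auto simp: algebra_simps)
    also have "\<dots> = (\<integral>x. max 0 (x - c) \<partial>\<nu>) - (\<integral>x. max 0 (x - c) \<partial>\<mu>)"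
      unfolding Bochner_Integration.integral_diff[OF j[OF i2] j[OF i1]] integral_tail_cdf_diff[OF im] integral_tail_cdf_diff[OF inu] by simp
    finally show "0 \<le> (\<integral>t. indicator {c..} t * (cdf \<mu> t - cdf \<nu> t) \<partial>lborel)"
      using convex_order_integrals(2)[OF \<mu> \<nu> le, of c] by simp
  qed (use \<mu> i2 m.prob_space_axioms in auto)
qed

lemma measurable_kernel_cdf:
  assumes K: "K \<in> borel \<rightarrow>\<^sub>M prob_algebra borel"
  shows "(\<lambda>z. cdf (K (fst z)) (snd z)) \<in> borel_measurable plane"
  unfolding cdf_def
proof (rule measure_measurable_subprob_algebra2)
  have "{w \<in> space (plane \<Otimes>\<^sub>M (borel :: real measure)). snd w \<le> snd (fst w)}
      \<in> sets (plane \<Otimes>\<^sub>M borel)"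
    by measurable
  also have "{w \<in> space (plane \<Otimes>\<^sub>M (borel :: real measure)). snd w \<le> snd (fst w)}
      = Sigma (space plane) (\<lambda>z. {..snd z})"
    by (auto simp: space_pair_measure)
  finally show "Sigma (space plane) (\<lambda>z. {..snd z}) \<in> sets (plane \<Otimes>\<^sub>M borel)" .
  show "(\<lambda>z. K (fst z)) \<in> plane \<rightarrow>\<^sub>M subprob_algebra borel"
    by (rule measurable_compose[OF measurable_fst measurable_prob_algebraD[OF K]])
qed

context
  fixes \<pi> \<mu> \<nu> K assumes \<pi>: "\<pi> \<in> couplings \<mu> \<nu>" and K: "is_disintegration \<pi> K"
begin

lemma disintegration_kernel: "K \<in> borel \<rightarrow>\<^sub>M prob_algebra borel"
  using K by (simp add: is_disintegration_def)

lemma second_marginal_eq_bind: "\<nu> = \<mu> \<bind> K"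
proof (rule measure_eqI)
  note m = marginals[OF \<pi>]
  have \<mu>: "\<mu> \<in> space (prob_algebra borel)" using m by (simp add: space_prob_algebra)
  show "sets \<nu> = sets (\<mu> \<bind> K)" using sets_bind'[OF \<mu> disintegration_kernel] m(8) by simp
  fix A assume "A \<in> sets \<nu>"
  then have A: "A \<in> sets borel" using m(8) by simp
  have "emeasure \<nu> A = (\<integral>\<^sup>+x. emeasure (K x) {y. (x, y) \<in> UNIV \<times> A} \<partial>\<mu>)"
    using K m(10)[OF A] Times_borel[OF _ A, of UNIV] m(4) by (auto simp: is_disintegration_def)
  then show "emeasure \<nu> A = emeasure (\<mu> \<bind> K) A"
    using emeasure_bind_prob_algebra[OF \<mu> disintegration_kernel A] by simp
qed

lemma integral_kernel_cdf: "(\<integral>x. cdf (K x) t \<partial>\<mu>) = cdf \<nu> t"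
proof -
  note m = marginals[OF \<pi>]
  have \<mu>: "\<mu> \<in> space (prob_algebra borel)" using m by (simp add: space_prob_algebra)
  have meas: "(\<lambda>x. cdf (K x) t) \<in> borel_measurable \<mu>"
    unfolding measurable_cong_sets[OF m(6) refl]
    using measurable_compose[OF _ measurable_kernel_cdf[OF disintegration_kernel], of "\<lambda>x. (x, t)" borel] by simp
  have "emeasure \<nu> {..t} = (\<integral>\<^sup>+x. emeasure (K x) {..t} \<partial>\<mu>)"
    using emeasure_bind_prob_algebra[OF \<mu> disintegration_kernel, of "{..t}"] second_marginal_eq_bind by simp
  also have "\<dots> = (\<integral>\<^sup>+x. ennreal (cdf (K x) t) \<partial>\<mu>)"
  proof (rule nn_integral_cong)
    fix x
    interpret real_distribution "K x" by (rule kernel_real_distribution[OF disintegration_kernel])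
    show "emeasure (K x) {..t} = ennreal (cdf (K x) t)" by (simp add: cdf_def emeasure_eq_measure)
  qed
  finally show ?thesis
    using integral_eq_nn_integral[OF meas] by (simp add: cdf_def measure_def)
qed

lemma AE_kernel_integrable:
  assumes "integrable \<nu> (\<lambda>y. y)" shows "AE x in \<mu>. integrable (K x) (\<lambda>y. y)"
proof -
  note m = marginals[OF \<pi>]
  have k: "K \<in> \<mu> \<rightarrow>\<^sub>M subprob_algebra borel"
    unfolding measurable_cong_sets[OF m(6) refl] by (rule measurable_prob_algebraD[OF disintegration_kernel])
  have "(\<integral>\<^sup>+x. (\<integral>\<^sup>+y. ennreal \<bar>y\<bar> \<partial>K x) \<partial>\<mu>) = (\<integral>\<^sup>+y. ennreal \<bar>y\<bar> \<partial>\<nu>)"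
    unfolding second_marginal_eq_bind by (rule nn_integral_bind[OF _ k, symmetric]) simp
  also have "\<dots> < \<infinity>" using assms by (simp add: integrable_iff_bounded)
  finally have "(\<integral>\<^sup>+x. (\<integral>\<^sup>+y. ennreal \<bar>y\<bar> \<partial>K x) \<partial>\<mu>) \<noteq> \<infinity>" by simp
  moreover have "(\<lambda>x. \<integral>\<^sup>+y. ennreal \<bar>y\<bar> \<partial>K x) \<in> borel_measurable \<mu>"
    by (rule measurable_compose[OF k nn_integral_measurable_subprob_algebra]) simp
  ultimately have "AE x in \<mu>. (\<integral>\<^sup>+y. ennreal \<bar>y\<bar> \<partial>K x) \<noteq> \<infinity>"
    by (intro nn_integral_PInf_AE) auto
  then show ?thesis
  proof eventually_elim
    case (elim x)
    interpret real_distribution "K x" by (rule kernel_real_distribution[OF disintegration_kernel])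
    show ?case using elim by (simp add: integrable_iff_bounded less_top)
  qed
qed

end

lemma is_disintegration_disint: "\<pi> \<in> couplings \<mu> \<nu> \<Longrightarrow> is_disintegration \<pi> (disint \<pi>)"
  unfolding disint_def by (erule disintegration_exists) (rule someI[where P = "is_disintegration \<pi>"])

locale convex_ordered_pair =
  fixes \<mu> \<nu> :: "real measure"
  assumes mu_1: "\<mu> \<in> Prob_p 1" and nu_1: "\<nu> \<in> Prob_p 1" and convex_le: "\<mu> \<preceq>\<^sub>c \<nu>"
begin

sublocale kernel_problem \<mu> "cdf \<nu>"
  by (rule kernel_problemI[OF Prob_p_1D[OF mu_1] Prob_p_1D[OF nu_1] convex_le])

sublocale nu: real_distribution \<nu> by (rule Prob_p_1D(1)[OF nu_1])

lemma adm_kernel_cdf: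
  assumes \<pi>: "\<pi> \<in> couplings \<mu> \<nu>" and K: "is_disintegration \<pi> K"
  shows "adm (\<lambda>z. cdf (K (fst z)) (snd z))"
proof -
  note K' = disintegration_kernel[OF \<pi> K]
  have "0 \<le> cdf (K x) t \<and> cdf (K x) t \<le> 1 \<and> (s \<le> t \<longrightarrow> cdf (K x) s \<le> cdf (K x) t)" for x s t
  proof -
    interpret K: real_distribution "K x" by (rule kernel_real_distribution[OF K'])
    show ?thesis using K.cdf_nonneg K.cdf_bounded_prob K.cdf_nondecreasing by auto
  qed
  then show ?thesis
    unfolding adm_def using measurable_kernel_cdf[OF K'] integral_kernel_cdf[OF \<pi> K] by auto
qed

lemma AE_drift_kernel_cdf:
  assumes \<pi>: "\<pi> \<in> couplings \<mu> \<nu>" and K: "is_disintegration \<pi> K"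
  shows "AE x in \<mu>. drift (\<lambda>z. cdf (K (fst z)) (snd z)) x = (\<integral>y. y - x \<partial>K x)"
  using AE_kernel_integrable[OF \<pi> K Prob_p_1D(2)[OF nu_1]]
  by eventually_elim
     (simp add: drift_def integral_step_cdf[OF kernel_real_distribution[OF disintegration_kernel[OF \<pi> K]]])

lemma martingale_defect_eq:
  assumes \<pi>: "\<pi> \<in> couplings \<mu> \<nu>"
  shows "martingale_defect \<pi> = ennreal (defect (\<lambda>z. cdf (disint \<pi> (fst z)) (snd z)))"
proof -
  let ?F = "\<lambda>z. cdf (disint \<pi> (fst z)) (snd z)"
  note K = is_disintegration_disint[OF \<pi>]
  have "martingale_defect \<pi> = (\<integral>\<^sup>+x. ennreal \<bar>drift ?F x\<bar> \<partial>\<mu>)"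
    unfolding martingale_defect_def marginals(4)[OF \<pi>]
    using AE_drift_kernel_cdf[OF \<pi> K] by (intro nn_integral_cong_AE) (auto elim!: eventually_mono)
  also have "\<dots> = ennreal (defect ?F)"
    unfolding defect_def using integrable_drift[OF adm_kernel_cdf[OF \<pi> K]]
    by (intro nn_integral_eq_integral integrable_abs) auto
  finally show ?thesis .
qed

text \<open>The marginal identity is known only at almost every level. Monotonicity extends it to
  all levels at the price of a shift by 1, which is harmless in the limits at infinity.\<close>

lemma adm_marginal_bounds:
  assumes F: "adm F"
  shows "(\<integral>x. F (x, t) \<partial>\<mu>) \<le> cdf \<nu> (t + 1)" "cdf \<nu> (t - 1) \<le> (\<integral>x. F (x, t) \<partial>\<mu>)"
proof -
  note i = adm_integrable_section[OF F]
  obtain s where s: "t < s" "s < t + 1" "(\<integral>x. F (x, s) \<partial>\<mu>) = cdf \<nu> s"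
    using AE_lborel_ex_between[OF adm_marginal[OF F], of t "t + 1"] by auto
  have "(\<integral>x. F (x, t) \<partial>\<mu>) \<le> (\<integral>x. F (x, s) \<partial>\<mu>)"
    using s by (intro integral_mono i adm_mono[OF F]) auto
  also have "\<dots> \<le> cdf \<nu> (t + 1)" using s nu.cdf_nondecreasing[of s "t + 1"] by simp
  finally show "(\<integral>x. F (x, t) \<partial>\<mu>) \<le> cdf \<nu> (t + 1)" .
  obtain r where r: "t - 1 < r" "r < t" "(\<integral>x. F (x, r) \<partial>\<mu>) = cdf \<nu> r"
    using AE_lborel_ex_between[OF adm_marginal[OF F], of "t - 1" t] by auto
  have "cdf \<nu> (t - 1) \<le> cdf \<nu> r" using r nu.cdf_nondecreasing[of "t - 1" r] by simp
  also have "\<dots> \<le> (\<integral>x. F (x, t) \<partial>\<mu>)"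
    unfolding r(3)[symmetric] using r by (intro integral_mono i adm_mono[OF F]) auto
  finally show "cdf \<nu> (t - 1) \<le> (\<integral>x. F (x, t) \<partial>\<mu>)" .
qed

lemma AE_proper_tails_adm:
  assumes F: "adm F" shows "AE x in \<mu>. proper_tails (\<lambda>t. F (x, t))"
proof (rule AE_proper_tails[OF prob sets_mu adm_measurable[OF F] adm_nonneg[OF F] adm_le_1[OF F] adm_mono[OF F]])
  have "filterlim (\<lambda>n. - real n + 1) at_bot sequentially" "filterlim (\<lambda>n. real n - 1) at_top sequentially"
    by real_asymp+
  then have l: "(\<lambda>n. cdf \<nu> (- real n + 1)) \<longlonglongrightarrow> 0" "(\<lambda>n. cdf \<nu> (real n - 1)) \<longlonglongrightarrow> 1"
    using filterlim_compose[OF nu.cdf_lim_at_bot] filterlim_compose[OF nu.cdf_lim_at_top_prob] by auto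
  show "(\<lambda>n. \<integral>x. F (x, - real n) \<partial>\<mu>) \<longlonglongrightarrow> 0"
  proof (rule tendsto_sandwich[OF always_eventually always_eventually tendsto_const l(1)]; intro allI)
    show "0 \<le> (\<integral>x. F (x, - real n) \<partial>\<mu>)" for n by (simp add: adm_nonneg[OF F])
    show "(\<integral>x. F (x, - real n) \<partial>\<mu>) \<le> cdf \<nu> (- real n + 1)" for n
      by (rule adm_marginal_bounds(1)[OF F])
  qed
  show "(\<lambda>n. \<integral>x. F (x, real n) \<partial>\<mu>) \<longlonglongrightarrow> 1"
  proof (rule tendsto_sandwich[OF always_eventually always_eventually l(2) tendsto_const]; intro allI)
    show "cdf \<nu> (real n - 1) \<le> (\<integral>x. F (x, real n) \<partial>\<mu>)" for n
      by (rule adm_marginal_bounds(2)[OF F])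
    have "(\<integral>x. F (x, real n) \<partial>\<mu>) \<le> (\<integral>x. 1 \<partial>\<mu>)" for n
      by (intro integral_mono adm_integrable_section[OF F] adm_le_1[OF F]) auto
    then show "(\<integral>x. F (x, real n) \<partial>\<mu>) \<le> 1" for n using prob_space by simp
  qed
qed

text \<open>The constructed kernel reproduces \<open>F\<close> only almost everywhere. So its second
  marginal has the distribution function of \<nu> at almost every level, and right continuity
  identifies it with \<nu>. Uniqueness of disintegrations then passes from this kernel to the
  version \<open>disint\<close>.\<close>

lemma coupling_of_adm:
  assumes F: "adm F"
  obtains \<pi> where "\<pi> \<in> couplings \<mu> \<nu>" "AE z in P. F z = cdf (disint \<pi> (fst z)) (snd z)"
proof -
  obtain K where K: "K \<in> borel \<rightarrow>\<^sub>M prob_algebra borel"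
    and sandwich: "AE x in \<mu>. \<forall>t. F (x, t) \<le> cdf (K x) t \<and> (\<forall>s>t. cdf (K x) t \<le> F (x, s))"
    using kernel_of_cdf[OF adm_measurable[OF F] adm_nonneg[OF F] adm_le_1[OF F] adm_mono[OF F] AE_proper_tails_adm[OF F]] by blast
  define \<pi> where "\<pi> = joint \<mu> K"
  define G where "G z = cdf (K (fst z)) (snd z)" for z
  note [measurable] = adm_measurable[OF F] measurable_kernel_cdf[OF K, folded G_def]
  have FG_sect: "AE x in \<mu>. AE t in lborel. F (x, t) = G (x, t)"
    using sandwich
    by eventually_elim (auto intro!: AE_eq_of_right_sandwich simp: G_def adm_mono[OF F])
  have "{z \<in> space P. F z = G z} \<in> sets P" by measurable
  then have FG: "AE z in P. F z = G z" using FG_sect by (rule AE_pair_measure)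
  have \<pi>: "\<pi> \<in> Prob" "marginal1 \<pi> = \<mu>" and dK: "is_disintegration \<pi> K"
    unfolding \<pi>_def Prob_def using prob_space_joint[OF prob sets_mu K] sets_joint[OF prob sets_mu K]
      marginal1_joint[OF prob sets_mu K] is_disintegration_joint[OF prob sets_mu K] by auto
  then have c: "\<pi> \<in> couplings \<mu> (marginal2 \<pi>)" by (simp add: couplings_def)
  have "AE t in lborel. AE x in \<mu>. F (x, t) = G (x, t)"
    by (rule AE_P_sections[OF FG]) measurable
  then have eq: "AE t in lborel. cdf (marginal2 \<pi>) t = cdf \<nu> t"
    using adm_marginal[OF F]
  proof eventually_elim
    case (elim t)
    have "(\<integral>x. F (x, t) \<partial>\<mu>) = (\<integral>x. G (x, t) \<partial>\<mu>)"
    proof (rule integral_cong_AE[OF _ _ elim(1)])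
      show "(\<lambda>x. F (x, t)) \<in> borel_measurable \<mu>" "(\<lambda>x. G (x, t)) \<in> borel_measurable \<mu>"
        unfolding measurable_cong_sets[OF sets_mu refl] by (rule measurable_section, measurable)+
    qed
    then show ?case using elim(2) integral_kernel_cdf[OF c dK, of t] by (simp add: G_def)
  qed
  have m2: "real_distribution (marginal2 \<pi>)"
    using marginals(7,8)[OF c] by (auto simp: real_distribution_def real_distribution_axioms_def)
  note fb = real_distribution.finite_borel_measure_M[OF m2] nu.finite_borel_measure_M
  have "cdf (marginal2 \<pi>) t \<le> cdf \<nu> t" for t
    by (rule cdf_le_of_AE[OF fb], rule eventually_mono[OF eq]) simp
  moreover have "cdf \<nu> t \<le> cdf (marginal2 \<pi>) t" for t
    by (rule cdf_le_of_AE[OF fb(2,1)], rule eventually_mono[OF eq]) simp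
  ultimately have "cdf (marginal2 \<pi>) = cdf \<nu>" by (intro ext antisym)
  then have "marginal2 \<pi> = \<nu>" by (intro cdf_unique m2 nu.real_distribution_axioms)
  then have cp: "\<pi> \<in> couplings \<mu> \<nu>" using c by simp
  define H where "H z = cdf (disint \<pi> (fst z)) (snd z)" for z
  have [measurable]: "H \<in> borel_measurable plane"
    unfolding H_def by (rule measurable_kernel_cdf[OF disintegration_kernel[OF cp is_disintegration_disint[OF cp]]])
  have "AE x in \<mu>. AE t in lborel. F (x, t) = H (x, t)"
    using FG_sect disintegration_unique[OF cp dK is_disintegration_disint[OF cp]]
    by eventually_elim (simp add: G_def H_def)
  moreover have "{z \<in> space P. F z = H z} \<in> sets P" by measurable
  ultimately have "AE z in P. F z = H z" by (intro AE_pair_measure)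
  then have "AE z in P. F z = cdf (disint \<pi> (fst z)) (snd z)" by (simp only: H_def)
  with cp show ?thesis by (rule that)
qed

text \<open>The first marginals coincide, so the diagonal coupling is available: the first term
  vanishes and the second compares the two kernels at the same point.\<close>

lemma W1_nested_le:
  assumes \<pi>: "\<pi> \<in> couplings \<mu> \<nu>" and \<rho>: "\<rho> \<in> couplings \<mu> \<nu>"
  shows "W1_nested \<pi> \<rho> \<le> ennreal (dist_on UNIV (\<lambda>z. cdf (disint \<pi> (fst z)) (snd z)) (\<lambda>z. cdf (disint \<rho> (fst z)) (snd z)))"
proof -
  note K = is_disintegration_disint[OF \<pi>] and L = is_disintegration_disint[OF \<rho>]
  note K' = disintegration_kernel[OF \<pi> K] and L' = disintegration_kernel[OF \<rho> L]
  let ?F = "\<lambda>z. cdf (disint \<pi> (fst z)) (snd z)" and ?G = "\<lambda>z. cdf (disint \<rho> (fst z)) (snd z)"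
  \<comment> \<open>Measurability of the inner distance in the pair of points is not established.
    The bound \<open>h\<close> is measurable, so the change of variables to the diagonal is applied
    to \<open>h\<close>, after the comparison.\<close>
  define h where "h z = (\<integral>\<^sup>+t. ennreal \<bar>?F (fst z, t) - ?G (snd z, t)\<bar> \<partial>lborel)" for z :: "real \<times> real"
  have d: "(\<lambda>x. (x, x)) \<in> \<mu> \<rightarrow>\<^sub>M (borel :: (real \<times> real) measure)"
    unfolding measurable_cong_sets[OF sets_mu sets_borel_pair[symmetric]] by measurable
  define \<gamma> where "\<gamma> = distr \<mu> borel (\<lambda>x. (x, x))"
  have "distr \<mu> borel (\<lambda>x. x) = \<mu>"
    by (rule distr_id2) simp
  then have \<gamma>: "\<gamma> \<in> couplings (marginal1 \<pi>) (marginal1 \<rho>)"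
    unfolding couplings_def Prob_def \<gamma>_def marginals(4)[OF \<pi>] marginals(4)[OF \<rho>]
    using prob_space_distr[OF d] distr_distr[OF measurable_fst_snd_plane(1) d] distr_distr[OF measurable_fst_snd_plane(2) d]
    by (simp add: comp_def marginal1_def marginal2_def)
  have mF: "?F \<in> borel_measurable plane" "?G \<in> borel_measurable plane"
    by (rule measurable_kernel_cdf, fact)+
  have h: "h \<in> borel_measurable borel"
  proof -
    have "(\<lambda>w. (fst (fst w), snd w)) \<in> plane \<Otimes>\<^sub>M lborel \<rightarrow>\<^sub>M plane"
      "(\<lambda>w. (snd (fst w), snd w)) \<in> plane \<Otimes>\<^sub>M lborel \<rightarrow>\<^sub>M plane"
      by measurable
    from measurable_compose[OF this(1) mF(1)] measurable_compose[OF this(2) mF(2)]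
    have "(\<lambda>(z, t). ennreal \<bar>?F (fst z, t) - ?G (snd z, t)\<bar>) \<in> borel_measurable (plane \<Otimes>\<^sub>M lborel)"
      by (simp add: split_beta')
    from lborel.borel_measurable_nn_integral[OF this] show ?thesis
      unfolding h_def measurable_cong_sets[OF sets_borel_pair[symmetric] refl] by simp
  qed
  have "W1_nested \<pi> \<rho> \<le> (\<integral>\<^sup>+(x1, y1). ennreal \<bar>x1 - y1\<bar> \<partial>\<gamma>) + (\<integral>\<^sup>+(x1, y1). W1 (disint \<pi> x1) (disint \<rho> y1) \<partial>\<gamma>)"
    unfolding W1_nested_def by (rule INF_lower[OF \<gamma>])
  also have "(\<integral>\<^sup>+(x1, y1). ennreal \<bar>x1 - y1\<bar> \<partial>\<gamma>) = 0"
  proof -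
    have "(\<lambda>z. ennreal \<bar>fst z - snd z\<bar>) \<in> borel_measurable (borel :: (real \<times> real) measure)"
      using measurable_fst_snd_plane by measurable
    then show ?thesis unfolding \<gamma>_def by (subst nn_integral_distr[OF d]) (auto simp: split_beta')
  qed
  also have "(\<integral>\<^sup>+(x1, y1). W1 (disint \<pi> x1) (disint \<rho> y1) \<partial>\<gamma>) \<le> (\<integral>\<^sup>+z. h z \<partial>\<gamma>)"
    using W1_le_cdf[OF kernel_real_distribution[OF K'] kernel_real_distribution[OF L']]
    by (intro nn_integral_mono) (auto simp: h_def)
  also have "(\<integral>\<^sup>+z. h z \<partial>\<gamma>) = (\<integral>\<^sup>+x. (\<integral>\<^sup>+t. ennreal \<bar>?F (x, t) - ?G (x, t)\<bar> \<partial>lborel) \<partial>\<mu>)"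
    unfolding \<gamma>_def by (subst nn_integral_distr[OF d], simp add: h) (simp add: h_def)
  also have "\<dots> = (\<integral>\<^sup>+z. ennreal \<bar>?F z - ?G z\<bar> \<partial>P)"
  proof -
    have "(\<lambda>z. ennreal \<bar>?F z - ?G z\<bar>) \<in> borel_measurable P"
      using measurable_P[OF mF(1)] measurable_P[OF mF(2)] by measurable
    from lborel.nn_integral_fst[OF this] show ?thesis by simp
  qed
  also have "\<dots> = ennreal (dist_on UNIV ?F ?G)"
    unfolding dist_on_def using integrable_adm_diff[OF adm_kernel_cdf[OF \<pi> K] adm_kernel_cdf[OF \<rho> L]]
    by (subst nn_integral_eq_integral) auto
  finally show ?thesis by simp
qed

lemma nearby_martingale_coupling:
  assumes \<pi>: "\<pi> \<in> couplings \<mu> \<nu>" and lam: "0 < lam" "lam < 1/18" and R: "0 < R" and e: "0 \<le> e"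
    and tail: "(\<integral>\<^sup>+x\<in>{x. R \<le> \<bar>x\<bar>}. ennreal \<bar>x\<bar> \<partial>\<nu>) \<le> ennreal e"
  shows "\<exists>\<rho>\<in>martingale_couplings \<mu> \<nu>.
    W1_nested \<pi> \<rho> \<le> ennreal (1 / lam) * martingale_defect \<pi> + ennreal (800 * R * lam + 2 * e)"
proof -
  define F0 where "F0 z = cdf (disint \<pi> (fst z)) (snd z)" for z
  have F0: "adm F0" unfolding F0_def by (rule adm_kernel_cdf[OF \<pi> is_disintegration_disint[OF \<pi>]])
  obtain F where F: "adm F" "defect F = 0" "dist_on {-R<..<R} F0 F \<le> defect F0 / lam + 800 * R * lam"
    using martingale_nearby[OF lam R F0] .
  obtain \<rho> where \<rho>: "\<rho> \<in> couplings \<mu> \<nu>" and eq: "AE z in P. F z = cdf (disint \<rho> (fst z)) (snd z)"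
    using coupling_of_adm[OF F(1)] .
  define G where "G z = cdf (disint \<rho> (fst z)) (snd z)" for z
  note L = is_disintegration_disint[OF \<rho>]
  have G: "adm G" unfolding G_def by (rule adm_kernel_cdf[OF \<rho> L])
  note [measurable] = adm_measurable[OF F0] adm_measurable[OF F(1)] adm_measurable[OF G]
  have eq: "AE z in P. F z = G z" using eq by (simp add: G_def)
  have dist_G: "dist_on A F0 G = dist_on A F0 F" if [measurable]: "A \<in> sets borel" for A
    unfolding dist_on_def using eq by (intro integral_cong_AE) (auto elim!: eventually_mono)
  have "dist_on UNIV F G = 0"
    unfolding dist_on_def using eq by (intro integral_eq_zero_AE) (auto elim!: eventually_mono)
  then have "defect G = 0" using defect_lipschitz[OF F(1) G] F(2) by simp
  then have "AE x in \<mu>. drift G x = 0"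
    unfolding defect_def using integral_nonneg_eq_0_iff_AE[OF integrable_abs[OF integrable_drift[OF G]]] by simp
  with AE_drift_kernel_cdf[OF \<rho> L, folded G_def] have "AE x in \<mu>. (\<integral>y. y - x \<partial>disint \<rho> x) = 0"
    by eventually_elim simp
  then have mart: "\<rho> \<in> martingale_couplings \<mu> \<nu>" using \<rho> by (simp add: martingale_couplings_def)
  have "dist_on UNIV F0 G = dist_on {-R<..<R} F0 G + dist_on (- {-R<..<R}) F0 G"
  proof -
    have "dist_on UNIV F0 G = (\<integral>z. indicator {-R<..<R} (snd z) * \<bar>F0 z - G z\<bar> + indicator (- {-R<..<R}) (snd z) * \<bar>F0 z - G z\<bar> \<partial>P)"
      unfolding dist_on_def by (intro Bochner_Integration.integral_cong) (auto simp: indicator_def)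
    then show ?thesis
      unfolding dist_on_def by (simp add: Bochner_Integration.integral_add[OF integrable_dist_on[OF F0 G] integrable_dist_on[OF F0 G]])
  qed
  also have "dist_on (- {-R<..<R}) F0 G \<le> 2 * e"
    using dist_on_le_tail[OF F0 G, of "- {-R<..<R}"]
      integral_tail_cdf_le[OF nu.real_distribution_axioms Prob_p_1D(2)[OF nu_1] less_imp_le[OF R] tail e] by simp
  finally have "dist_on UNIV F0 G \<le> defect F0 / lam + (800 * R * lam + 2 * e)"
    using F(3) dist_G[of "{-R<..<R}"] by simp
  then have "ennreal (dist_on UNIV F0 G) \<le> ennreal (1 / lam * defect F0 + (800 * R * lam + 2 * e))"
    by (intro ennreal_leI) simp
  also have "\<dots> = ennreal (1 / lam) * martingale_defect \<pi> + ennreal (800 * R * lam + 2 * e)"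
    unfolding martingale_defect_eq[OF \<pi>] F0_def[symmetric]
  proof -
    have "0 \<le> 1 / lam" "0 \<le> 800 * R * lam + 2 * e" using lam R e by auto
    then show "ennreal (1 / lam * defect F0 + (800 * R * lam + 2 * e)) = ennreal (1 / lam) * ennreal (defect F0) + ennreal (800 * R * lam + 2 * e)"
      using ennreal_plus[OF mult_nonneg_nonneg[OF _ defect_nonneg]] ennreal_mult[OF _ defect_nonneg] by presburger
  qed
  finally have "W1_nested \<pi> \<rho> \<le> ennreal (1 / lam) * martingale_defect \<pi> + ennreal (800 * R * lam + 2 * e)"
    by (rule order_trans[OF W1_nested_le[OF \<pi> \<rho>, folded F0_def G_def]])
  with mart show ?thesis by blast
qed

end

theorem theorem2p8:
  fixes P :: "real measure set"
  assumes "P \<subseteq> Prob_p 1"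
    and "unif_integrable P"
  shows "\<forall>\<delta>::real. \<delta> > 0 \<longrightarrow>
    (\<exists>K::real. K \<ge> 0 \<and>
      (\<forall>\<mu>\<in>Prob_p 1. \<forall>\<nu>\<in>P. \<mu> \<preceq>\<^sub>c \<nu> \<longrightarrow>
        (\<forall>\<pi>\<in>couplings \<mu> \<nu>.
          (INF \<pi>'\<in>martingale_couplings \<mu> \<nu>. W1_nested \<pi> \<pi>')
            \<le> ennreal K * martingale_defect \<pi> + ennreal \<delta>)))"
proof (intro allI impI)
  fix \<delta> :: real assume \<delta>: "0 < \<delta>"
  have "\<forall>\<^sub>F R in at_top. (SUP \<nu>\<in>P. \<integral>\<^sup>+x\<in>{x. R \<le> \<bar>x\<bar>}. ennreal \<bar>x\<bar> \<partial>\<nu>) < ennreal (\<delta> / 4)"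
    using assms(2) \<delta> unfolding unif_integrable_def by (intro order_tendstoD(2)) auto
  then have "\<forall>\<^sub>F R in at_top. (SUP \<nu>\<in>P. \<integral>\<^sup>+x\<in>{x. R \<le> \<bar>x\<bar>}. ennreal \<bar>x\<bar> \<partial>\<nu>) < ennreal (\<delta> / 4) \<and> 0 < R"
    using eventually_gt_at_top[of "0::real"] by (rule eventually_conj)
  then obtain R where R: "0 < R" and sup: "(SUP \<nu>\<in>P. \<integral>\<^sup>+x\<in>{x. R \<le> \<bar>x\<bar>}. ennreal \<bar>x\<bar> \<partial>\<nu>) < ennreal (\<delta> / 4)"
    using eventually_happens'[OF trivial_limit_at_top_linorder] by blast
  \<comment> \<open>The second entry makes 800 R \<open>lam\<close> at most \<delta> / 2, and the
    tail bound \<delta> / 4 enters twice; 1/36 respects the restriction \<open>lam\<close> < 1/18.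
    The constant K = 1 / \<open>lam\<close> depends on the family only through
    \<open>R\<close>.\<close>
  define lam where "lam = min (1 / 36) (\<delta> / (1600 * R))"
  have lam: "0 < lam" "lam < 1/18" using \<delta> R by (auto simp: lam_def)
  have "lam \<le> \<delta> / (1600 * R)" by (simp add: lam_def)
  then have small: "800 * R * lam + 2 * (\<delta> / 4) \<le> \<delta>" using R by (simp add: field_simps)
  show "\<exists>K::real. K \<ge> 0 \<and>
      (\<forall>\<mu>\<in>Prob_p 1. \<forall>\<nu>\<in>P. \<mu> \<preceq>\<^sub>c \<nu> \<longrightarrow>
        (\<forall>\<pi>\<in>couplings \<mu> \<nu>.
          (INF \<pi>'\<in>martingale_couplings \<mu> \<nu>. W1_nested \<pi> \<pi>')
            \<le> ennreal K * martingale_defect \<pi> + ennreal \<delta>))"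
  proof (intro exI[of _ "1 / lam"] conjI ballI impI)
    show "0 \<le> 1 / lam" using lam by simp
    fix \<mu> \<nu> :: "real measure" and \<pi>
    assume \<mu>: "\<mu> \<in> Prob_p 1" and \<nu>: "\<nu> \<in> P" and le: "\<mu> \<preceq>\<^sub>c \<nu>" and \<pi>: "\<pi> \<in> couplings \<mu> \<nu>"
    interpret convex_ordered_pair \<mu> \<nu>
      using \<mu> \<nu> le assms(1) by unfold_locales auto
    have tail: "(\<integral>\<^sup>+x\<in>{x. R \<le> \<bar>x\<bar>}. ennreal \<bar>x\<bar> \<partial>\<nu>) \<le> ennreal (\<delta> / 4)"
      using SUP_upper[OF \<nu>] sup by (rule order_trans[OF _ less_imp_le])
    have "0 \<le> \<delta> / 4" using \<delta> by simp
    then obtain \<rho> where \<rho>: "\<rho> \<in> martingale_couplings \<mu> \<nu>"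
      "W1_nested \<pi> \<rho> \<le> ennreal (1 / lam) * martingale_defect \<pi> + ennreal (800 * R * lam + 2 * (\<delta> / 4))"
      using nearby_martingale_coupling[OF \<pi> lam R _ tail] by blast
    have "(INF \<pi>'\<in>martingale_couplings \<mu> \<nu>. W1_nested \<pi> \<pi>') \<le> W1_nested \<pi> \<rho>"
      by (rule INF_lower[OF \<rho>(1)])
    also note \<rho>(2)
    also have "ennreal (1 / lam) * martingale_defect \<pi> + ennreal (800 * R * lam + 2 * (\<delta> / 4))
        \<le> ennreal (1 / lam) * martingale_defect \<pi> + ennreal \<delta>"
      using small by (intro add_left_mono ennreal_leI)
    finally show "(INF \<pi>'\<in>martingale_couplings \<mu> \<nu>. W1_nested \<pi> \<pi>') \<le> ennreal (1 / lam) * martingale_defect \<pi> + ennreal \<delta>" .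
  qed
qed

end
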